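(* Let $1<\alpha<2$, $\gamma\in\mathbb R\setminus\{0\}$, and let $\frac{2-3\alpha}{4(\alpha+1)}<s<\frac{2-\alpha}{4}$. Then the solution map of the initial value problem $$i\partial_t u+(-\Delta)^{\alpha/2}u=\gamma|u|^2u,\qquad u(0,\cdot)=\phi\in H^s(\mathbb R),$$ fails to be locally uniformly continuous into $C([0,T];H^s(\mathbb R))$ for any $T>0$. More precisely, for $0<\delta\ll\varepsilon\ll1$ and arbitrary $T>0$, there are two solutions $u_1,u_2$ of this equation with initial data $\phi_1,\phi_2$ such that $$\|\phi_1\|_{H^s},\ \|\phi_2\|_{H^s}\lesssim\varepsilon,\qquad \|\phi_1-\phi_2\|_{H^s}\lesssim\delta,\qquad \sup_{0\le t\le T}\|u_1(t)-u_2(t)\|_{H^s}\gtrsim\varepsilon.$$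
   Context: $\|f\|_{H^s(\mathbb R)}=\|(1+|\xi|^2)^{s/2}\mathcal Ff\|_{L^2(\mathbb R)}$ with $\mathcal Ff(\xi)=\int_{\mathbb R} e^{-ix\xi}f(x)\,dx$; $(-\Delta)^{\alpha/2}$ is the Fourier multiplier with symbol $|\xi|^\alpha$. Solutions are solutions of the Duhamel equation $u(t)=U(t)\phi-i\gamma\int_0^tU(t-t')(|u|^2u)(t')\,dt'$, $U(t)=e^{it(-\Delta)^{\alpha/2}}$; in particular the cubic term is required to be well defined. The implicit constants in $\lesssim,\gtrsim$ are independent of $\delta,\varepsilon,T$ (they may depend on $\alpha,\gamma,s$). "For $0<\delta\ll\varepsilon\ll1$" means: there are small positive constants $\varepsilon_0,\kappa$ depending only on $\alpha,\gamma,s$ such that the assertion holds for all $0<\varepsilon\le\varepsilon_0$ and $0<\delta\le\kappa\varepsilon$. *)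

theory Defs
  imports "HOL-Analysis.Analysis"
begin

section \<open>Schwartz functions and tempered distributions on the real line\<close>

definition vderiv :: "(real \<Rightarrow> complex) \<Rightarrow> real \<Rightarrow> complex" where
  "vderiv f = (\<lambda>x. vector_derivative f (at x))"

definition schwartz :: "(real \<Rightarrow> complex) set" where
  "schwartz = {\<psi>. (\<forall>n x. (vderiv ^^ n) \<psi> differentiable (at x)) \<and>
     (\<forall>k n. bounded (range (\<lambda>x. x ^ k *\<^sub>R (vderiv ^^ n) \<psi> x)))}"

definition schwartz_seminorm :: "nat \<Rightarrow> nat \<Rightarrow> (real \<Rightarrow> complex) \<Rightarrow> real" where
  "schwartz_seminorm k n \<psi> = (SUP x. norm (x ^ k *\<^sub>R (vderiv ^^ n) \<psi> x))"

text \<open>A distribution is a functional on all functions of which only the values on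
  Schwartz functions matter; differences of distributions are taken pointwise.\<close>

type_synonym dist = "(real \<Rightarrow> complex) \<Rightarrow> complex"

definition tempered :: "dist set" where
  "tempered = {v.
     (\<forall>\<psi>\<in>schwartz. \<forall>\<eta>\<in>schwartz. v (\<lambda>x. \<psi> x + \<eta> x) = v \<psi> + v \<eta>) \<and>
     (\<forall>\<psi>\<in>schwartz. \<forall>c. v (\<lambda>x. c * \<psi> x) = c * v \<psi>) \<and>
     (\<exists>C N. \<forall>\<psi>\<in>schwartz. norm (v \<psi>) \<le> C * (\<Sum>k\<le>N. \<Sum>n\<le>N. schwartz_seminorm k n \<psi>))}"

text \<open>The distribution \<open>v\<close> is (integration against) the function \<open>f\<close>.\<close>

definition represents :: "(real \<Rightarrow> complex) \<Rightarrow> dist \<Rightarrow> bool" where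
  "represents f v \<longleftrightarrow> f \<in> borel_measurable borel \<and>
     (\<forall>\<psi>\<in>schwartz. integrable lborel (\<lambda>x. f x * \<psi> x) \<and> v \<psi> = (LINT x|lborel. f x * \<psi> x))"

section \<open>Fourier transform and Fourier multipliers\<close>

definition fourier :: "(real \<Rightarrow> complex) \<Rightarrow> real \<Rightarrow> complex" where
  "fourier f \<xi> = (LINT x|lborel. exp (- \<i> * of_real (x * \<xi>)) * f x)"

definition inverse_fourier :: "(real \<Rightarrow> complex) \<Rightarrow> real \<Rightarrow> complex" where
  "inverse_fourier g x = of_real (1 / (2 * pi)) * (LINT \<xi>|lborel. exp (\<i> * of_real (x * \<xi>)) * g \<xi>)"

definition fourier_dist :: "dist \<Rightarrow> dist" where
  "fourier_dist v = (\<lambda>\<psi>. v (fourier \<psi>))"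

text \<open>The Fourier transform as a function, defined up to null sets; meaningful only for
  those \<open>v\<close> whose Fourier transform is a function.\<close>

definition fourier_fun :: "dist \<Rightarrow> real \<Rightarrow> complex" where
  "fourier_fun v = (SOME g. represents g (fourier_dist v))"

text \<open>The distribution with Fourier transform \<open>m \<cdot> fourier_fun v\<close>, expressed through
  \<open>\<langle>w, \<psi>\<rangle> = \<langle>fourier_dist w, inverse_fourier \<psi>\<rangle>\<close>.\<close>

definition fourier_multiplier :: "(real \<Rightarrow> complex) \<Rightarrow> dist \<Rightarrow> dist" where
  "fourier_multiplier m v = (\<lambda>\<psi>. LINT \<xi>|lborel. m \<xi> * fourier_fun v \<xi> * inverse_fourier \<psi> \<xi>)"

text \<open>\<open>U(t) = exp(i t (-\<Delta>)\<^sup>\<alpha>\<^sup>/\<^sup>2)\<close>, where \<open>(-\<Delta>)\<^sup>\<alpha>\<^sup>/\<^sup>2\<close> has symbol \<open>\<bar>\<xi>\<bar>\<^sup>\<alpha>\<close>.\<close>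

definition propagator :: "real \<Rightarrow> real \<Rightarrow> dist \<Rightarrow> dist" where
  "propagator \<alpha> t = fourier_multiplier (\<lambda>\<xi>. exp (\<i> * of_real (t * \<bar>\<xi>\<bar> powr \<alpha>)))"

section \<open>Sobolev spaces\<close>

definition sobolev :: "real \<Rightarrow> dist set" where
  "sobolev s = {v \<in> tempered. (\<exists>g. represents g (fourier_dist v)) \<and>
     integrable lborel (\<lambda>\<xi>. (norm ((1 + \<bar>\<xi>\<bar>\<^sup>2) powr (s / 2) *\<^sub>R fourier_fun v \<xi>))\<^sup>2)}"

definition sobolev_norm :: "real \<Rightarrow> dist \<Rightarrow> real" where
  "sobolev_norm s v =
     sqrt (LINT \<xi>|lborel. (norm ((1 + \<bar>\<xi>\<bar>\<^sup>2) powr (s / 2) *\<^sub>R fourier_fun v \<xi>))\<^sup>2)"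

definition continuous_into_sobolev :: "real \<Rightarrow> real \<Rightarrow> (real \<Rightarrow> dist) \<Rightarrow> bool" where
  "continuous_into_sobolev s T u \<longleftrightarrow> (\<forall>t\<in>{0..T}. u t \<in> sobolev s) \<and>
     (\<forall>t\<^sub>0\<in>{0..T}. ((\<lambda>t. sobolev_norm s (u t - u t\<^sub>0)) \<longlongrightarrow> 0) (at t\<^sub>0 within {0..T}))"

definition sup_sobolev_norm :: "real \<Rightarrow> real \<Rightarrow> (real \<Rightarrow> dist) \<Rightarrow> ereal" where
  "sup_sobolev_norm s T u = (SUP t\<in>{0..T}. ereal (sobolev_norm s (u t)))"

section \<open>The Duhamel equation\<close>

text \<open>\<open>w\<close> is the cubic term of \<open>v\<close>; this requires \<open>v\<close> to be a function.\<close>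

definition cubic_term :: "dist \<Rightarrow> dist \<Rightarrow> bool" where
  "cubic_term v w \<longleftrightarrow>
     (\<exists>f. represents f v \<and> represents (\<lambda>x. of_real ((norm (f x))\<^sup>2) * f x) w)"

text \<open>\<open>u\<close> lies in \<open>C([0,T]; H\<^sup>s)\<close>, the cubic term \<open>F\<close> of \<open>u\<close> exists at almost every time and
  lies in \<open>L\<^sup>1([0,T]; H\<^sup>\<sigma>)\<close> for some real \<open>\<sigma>\<close>, and the Duhamel equation holds in the sense
  of tempered distributions, the time integral being taken weakly.\<close>

definition duhamel_solution ::
    "real \<Rightarrow> real \<Rightarrow> real \<Rightarrow> real \<Rightarrow> dist \<Rightarrow> (real \<Rightarrow> dist) \<Rightarrow> bool" where
  "duhamel_solution \<alpha> \<gamma> s T \<phi> u \<longleftrightarrow>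
     \<phi> \<in> sobolev s \<and> continuous_into_sobolev s T u \<and>
     (\<exists>F \<sigma>.
        (AE t in lborel. t \<in> {0..T} \<longrightarrow> cubic_term (u t) (F t) \<and> F t \<in> sobolev \<sigma>) \<and>
        set_integrable lborel {0..T} (\<lambda>t. sobolev_norm \<sigma> (F t)) \<and>
        (\<forall>t\<in>{0..T}. \<forall>\<psi>\<in>schwartz.
           set_integrable lborel {0..t} (\<lambda>t'. propagator \<alpha> (t - t') (F t') \<psi>) \<and>
           u t \<psi> = propagator \<alpha> t \<phi> \<psi>
             - \<i> * of_real \<gamma> * (LINT t':{0..t}|lborel. propagator \<alpha> (t - t') (F t') \<psi>)))"

text \<open>Local uniform continuity of the data-to-solution correspondence. No uniqueness of
  solutions is presupposed, so the solution map is treated as a relation.\<close>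

definition solution_map_locally_uniformly_continuous ::
    "real \<Rightarrow> real \<Rightarrow> real \<Rightarrow> real \<Rightarrow> bool" where
  "solution_map_locally_uniformly_continuous \<alpha> \<gamma> s T \<longleftrightarrow>
     (\<forall>\<phi>\<^sub>0\<in>sobolev s. \<exists>r>0. \<forall>\<eta>>0. \<exists>d>0. \<forall>\<phi>\<^sub>1 \<phi>\<^sub>2 u\<^sub>1 u\<^sub>2.
        duhamel_solution \<alpha> \<gamma> s T \<phi>\<^sub>1 u\<^sub>1 \<longrightarrow> duhamel_solution \<alpha> \<gamma> s T \<phi>\<^sub>2 u\<^sub>2 \<longrightarrow>
        sobolev_norm s (\<phi>\<^sub>1 - \<phi>\<^sub>0) < r \<longrightarrow> sobolev_norm s (\<phi>\<^sub>2 - \<phi>\<^sub>0) < r \<longrightarrow>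
        sobolev_norm s (\<phi>\<^sub>1 - \<phi>\<^sub>2) < d \<longrightarrow>
        sup_sobolev_norm s T (\<lambda>t. u\<^sub>1 t - u\<^sub>2 t) < ereal \<eta>)"

end

theory Submission
  imports Defs "HOL-Probability.Levy"
begin

text \<open>
  At frequency \<open>N\<close> the second-order Taylor remainder of the symbol \<open>\<bar>\<xi>\<bar>\<^sup>\<alpha>\<close> is \<open>O(N powr (\<alpha> - 2) \<cdot> h\<^sup>2)\<close>,
  while the zeroth and first order parts are removed by a phase and a translation. A wave packet of
  amplitude \<open>a\<close> and width \<open>L = b N powr (- 2 s)\<close> has \<open>H\<^sup>s\<close> norm of order \<open>a \<surd>b\<close>, independently of \<open>N\<close>,
  and in the rescaled variable its dispersion is of order \<open>N powr (\<alpha> - 2) / L\<^sup>2 = b powr (- 2) N powr (4 s + \<alpha> - 2)\<close>,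
  which tends to \<open>0\<close> exactly when \<open>s < (2 - \<alpha>) / 4\<close>. Hence for large \<open>N\<close> the equation is, on the fixed
  interval \<open>[0, T]\<close>, a small perturbation of \<open>i w' = \<gamma> \<bar>w\<bar>\<^sup>2 w\<close>, whose solutions \<open>a G exp (- i \<gamma> a\<^sup>2 t G\<^sup>2)\<close>
  rotate with an amplitude dependent speed. With \<open>b = 3 \<bar>\<gamma>\<bar> T \<epsilon> \<delta>\<close>, amplitudes \<open>(\<epsilon> + \<delta>) / \<surd>b\<close> and \<open>\<epsilon> / \<surd>b\<close>
  are \<open>\<delta>\<close>-close in \<open>H\<^sup>s\<close> but their phases differ by a quantity in \<open>[2/3, 1]\<close> at time \<open>T\<close>.
  The perturbation argument is carried out on the Fourier side, where continuous functions bounded by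
  \<open>C / (1 + \<eta>\<^sup>2)\<close> are closed under convolution; the quadratic decay also controls the Sobolev weight.
\<close>

section \<open>Decay weight and Fourier transform\<close>

text \<open>No well-posedness in H^s is available to rely on, so both exact solutions are
  constructed by hand, from Gaussian data, in a convolution algebra where the cubic term is
  Lipschitz on bounded sets. The order of the choices shapes the argument. The numbers \<epsilon>,
  \<delta>, T fix b and hence both amplitudes; these fix every constant of the perturbation
  argument, which may be huge; the frequency N is chosen last and beats them all. The Sobolev
  estimates are taken at fixed b and see an amplitude a only through b a^2, so none of those
  constants reaches the final bounds. A short time T is no obstacle because b is proportional to T:
  a smaller b means larger amplitudes, hence faster rotation. The perturbation is of size \<eta>^2
  in the profile variable, so the approximate solution must decay by one power of the weight more
  than the algebra requires. This is why the profile is Gaussian: its rotated versions expand into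
  series of Gaussians with explicit transforms, which yields the extra decay uniformly for bounded
  phases.\<close>

definition wt :: "real \<Rightarrow> real" where
  "wt x = 1 / (1 + x\<^sup>2)"

lemma wt_pos: "0 < wt x"
  by (simp add: wt_def add_pos_nonneg)

lemma wt_nonneg [simp]: "0 \<le> wt x"
  using wt_pos[of x] by simp

lemma wt_le_1: "wt x \<le> 1"
  by (simp add: wt_def divide_le_eq add_pos_nonneg)

lemma wt_square_le: "(wt x)\<^sup>2 \<le> wt x"
  unfolding power2_eq_square using wt_le_1[of x] by (intro mult_left_le) auto

lemma wt_minus [simp]: "wt (- x) = wt x"
  by (simp add: wt_def)

lemma one_plus_square_nonzero: "1 + x\<^sup>2 \<noteq> (0::real)"
  by (metis add_pos_nonneg less_irrefl zero_le_power2 zero_less_one)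

lemma wt_cancel: "(1 + x\<^sup>2) * wt x = 1"
  by (simp add: wt_def one_plus_square_nonzero)

lemma square_wt_le_1: "x\<^sup>2 * wt x \<le> 1"
  by (simp add: wt_def divide_le_eq add_pos_nonneg)

lemma continuous_on_wt [continuous_intros]:
  "continuous_on S f \<Longrightarrow> continuous_on S (\<lambda>x. wt (f x))"
  unfolding wt_def by (intro continuous_intros) (auto simp: one_plus_square_nonzero)

lemma borel_measurable_wt [measurable]: "wt \<in> borel_measurable borel"
  unfolding wt_def by measurable

lemma integrable_wt: "integrable lborel wt"
  using integrable_I0i_1_div_plus_square integrable_inverse_1_plus_square
  by (simp add: set_integrable_def wt_def[abs_def] inverse_eq_divide)

lemma integral_wt: "integral\<^sup>L lborel wt = pi"
  using LBINT_inverse_1_plus_square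
  by (simp add: interval_lebesgue_integral_def set_lebesgue_integral_def wt_def[abs_def] inverse_eq_divide)

lemma integrable_wt_shift: "integrable lborel (\<lambda>a. wt (x - a))"
  using lborel_integrable_real_affine[OF integrable_wt, of "-1" x] by simp

lemma integral_wt_shift: "integral\<^sup>L lborel (\<lambda>a. wt (x - a)) = pi"
  using lborel_integral_real_affine[of "-1" wt x] integral_wt by simp

text \<open>Since x = a + (x - a), one of the two factors is bounded by a multiple of
  \<open>wt x\<close>. Integrated over a, this bounds the convolution of \<open>wt\<close> with
  itself by 4 pi \<open>wt\<close>, the algebra property behind all nonlinear estimates.\<close>

lemma wt_mult_le: "wt a * wt (x - a) \<le> 2 * wt x * (wt a + wt (x - a))"
proof -
  have *: "1 / (A * B) \<le> 2 * (1 / X) * (1 / A + 1 / B)"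
    if "X \<le> 2 * (A + B)" "0 < A" "0 < B" "0 < X" for A B X :: real
  proof -
    have "1 / (A * B) = X / X / (A * B)" using that by simp
    also have "\<dots> \<le> 2 * (A + B) / X / (A * B)"
      using that by (intro divide_right_mono) auto
    also have "\<dots> = 2 * (1 / X) * (1 / A + 1 / B)"
      using that by (simp add: field_simps)
    finally show ?thesis .
  qed
  have "1 + x\<^sup>2 \<le> 2 * ((1 + a\<^sup>2) + (1 + (x - a)\<^sup>2))"
    using zero_le_power2[of "x - 2 * a"] by (simp add: power2_eq_square algebra_simps)
  from *[OF this] show ?thesis
    by (simp add: wt_def add_pos_nonneg)
qed

section \<open>Domination, and continuity in a parameter\<close>

lemma integrable_complex_bound:
  fixes f :: "real \<Rightarrow> complex"
  assumes "f \<in> borel_measurable borel" "integrable lborel g" "\<And>x. norm (f x) \<le> g x"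
  shows "integrable lborel f"
  using assms(2) by (rule Bochner_Integration.integrable_bound) (use assms in \<open>auto intro: order_trans[OF _ abs_ge_self]\<close>)

text \<open>A non-integrable \<open>f\<close> has integral 0 by convention, so the bound holds in
  that case too, and applications carry no measurability side condition for
  \<open>f\<close>.\<close>

lemma norm_integral_complex_bound:
  fixes f :: "real \<Rightarrow> complex"
  assumes "integrable lborel g" "\<And>x. norm (f x) \<le> g x"
  shows "norm (integral\<^sup>L lborel f) \<le> integral\<^sup>L lborel g"
proof (cases "integrable lborel f")
  case True
  then have "norm (integral\<^sup>L lborel f) \<le> integral\<^sup>L lborel (\<lambda>x. norm (f x))" by simp
  also have "\<dots> \<le> integral\<^sup>L lborel g"
    using True assms by (intro integral_mono) auto
  finally show ?thesis .
next
  case False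
  have "0 \<le> g x" for x using assms(2)[of x] norm_ge_zero[of "f x"] by linarith
  with False show ?thesis by (simp add: not_integrable_integral_eq)
qed

text \<open>Dominated convergence along sequences. Continuity is asked almost everywhere, with an
  exceptional set that may depend on \<open>z\<close>, so that integrands cut off at a moving end
  point are covered.\<close>

lemma continuous_on_lborel_integral:
  fixes f :: "'a::metric_space \<Rightarrow> real \<Rightarrow> 'b::{banach, second_countable_topology}"
  assumes "\<And>z. f z \<in> borel_measurable borel"
    and "\<And>z. AE y in lborel. isCont (\<lambda>z. f z y) z"
    and "integrable lborel g" and "\<And>z y. norm (f z y) \<le> g y"
  shows "continuous_on UNIV (\<lambda>z. integral\<^sup>L lborel (f z))"
  unfolding continuous_on_eq_continuous_within
proof (intro ballI, rule continuous_within_sequentiallyI)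
  fix z :: 'a and u :: "nat \<Rightarrow> 'a"
  assume u: "u \<longlonglongrightarrow> z"
  show "(\<lambda>n. integral\<^sup>L lborel (f (u n))) \<longlonglongrightarrow> integral\<^sup>L lborel (f z)"
  proof (rule integral_dominated_convergence)
    show "AE y in lborel. (\<lambda>n. f (u n) y) \<longlonglongrightarrow> f z y"
      using assms(2)[of z] by eventually_elim (use u isCont_tendsto_compose in blast)
  qed (use assms in auto)
qed

section \<open>Elementary rules for the Fourier transform, and the transform of a Gaussian\<close>

lemma norm_exp_i [simp]: "norm (iexp x) = 1"
  using norm_exp_i_times by simp

lemma norm_exp_minus_i [simp]: "norm (exp (- (\<i> * of_real x))) = 1"
  using norm_exp_i_times[of "-x"] by simp

lemma inverse_fourier_eq: "inverse_fourier g x = of_real (1 / (2 * pi)) * fourier g (- x)"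
  by (simp add: inverse_fourier_def fourier_def mult.commute)

lemma fourier_reflect: "fourier (\<lambda>x. f (- x)) \<xi> = fourier f (- \<xi>)"
  unfolding fourier_def
  using lborel_integral_real_affine[of "-1" "\<lambda>x. exp (- \<i> * of_real (x * - \<xi>)) * f x" 0]
  by simp

lemma fourier_eq_inverse_fourier: "fourier g x = of_real (2 * pi) * inverse_fourier g (- x)"
  by (simp add: inverse_fourier_eq)

lemma fourier_integrand_integrable:
  "integrable lborel f \<Longrightarrow> integrable lborel (\<lambda>x. exp (- \<i> * of_real (x * \<xi>)) * f x)"
  by (rule Bochner_Integration.integrable_bound[where f = f]) (auto simp: norm_mult)

lemma norm_fourier_le:
  "integrable lborel g \<Longrightarrow> (\<And>x. norm (f x) \<le> g x) \<Longrightarrow> norm (fourier f \<xi>) \<le> integral\<^sup>L lborel g"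
  unfolding fourier_def by (rule norm_integral_complex_bound) (auto simp: norm_mult)

lemma continuous_on_fourier_UNIV:
  assumes "integrable lborel f"
  shows "continuous_on UNIV (fourier f)"
  unfolding fourier_def[abs_def]
proof (rule continuous_on_lborel_integral)
  show "integrable lborel (\<lambda>x. norm (f x))" using assms by simp
  have [measurable]: "f \<in> borel_measurable borel" using assms by auto
  show "(\<lambda>x. exp (- \<i> * complex_of_real (x * z)) * f x) \<in> borel_measurable borel" for z
    by measurable
  show "AE y in lborel. isCont (\<lambda>z. exp (- \<i> * complex_of_real (y * z)) * f y) z" for z
    by (intro always_eventually allI continuous_intros)
qed (auto simp: norm_mult)

lemma fourier_add:
  "integrable lborel f \<Longrightarrow> integrable lborel g \<Longrightarrow>
    fourier (\<lambda>x. f x + g x) \<xi> = fourier f \<xi> + fourier g \<xi>"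
  unfolding fourier_def distrib_left
  by (intro Bochner_Integration.integral_add fourier_integrand_integrable)

lemma fourier_diff:
  "integrable lborel f \<Longrightarrow> integrable lborel g \<Longrightarrow>
    fourier (\<lambda>x. f x - g x) \<xi> = fourier f \<xi> - fourier g \<xi>"
  unfolding fourier_def right_diff_distrib
  by (intro Bochner_Integration.integral_diff fourier_integrand_integrable)

lemma fourier_mult: "fourier (\<lambda>x. c * f x) \<xi> = c * fourier f \<xi>"
  unfolding fourier_def by (simp add: mult.left_commute)

lemma fourier_modulate: "fourier (\<lambda>x. iexp (x * a) * f x) \<xi> = fourier f (\<xi> - a)"
proof -
  have *: "exp (- \<i> * of_real (x * \<xi>)) * (iexp (x * a) * f x) =
      exp (- \<i> * of_real (x * (\<xi> - a))) * f x" for x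
  proof -
    have "exp (- \<i> * of_real (x * \<xi>)) * iexp (x * a) =
        exp (- \<i> * of_real (x * (\<xi> - a)))"
      unfolding exp_add[symmetric] by (rule arg_cong[where f = exp]) (simp add: algebra_simps)
    then show ?thesis by (simp only: mult.assoc[symmetric])
  qed
  show ?thesis unfolding fourier_def by (simp only: *)
qed

lemma fourier_cnj: "fourier (\<lambda>x. cnj (f x)) \<xi> = cnj (fourier f (- \<xi>))"
proof -
  have "fourier (\<lambda>x. cnj (f x)) \<xi> = (LBINT x. cnj (exp (- \<i> * of_real (x * - \<xi>)) * f x))"
    unfolding fourier_def by (simp add: exp_cnj)
  then show ?thesis unfolding fourier_def by (simp only: Bochner_Integration.integral_cnj)
qed

lemma integrable_tensor:
  fixes f g :: "real \<Rightarrow> complex"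
  assumes "integrable lborel f" "integrable lborel g"
  shows "integrable (lborel \<Otimes>\<^sub>M lborel) (\<lambda>(x, y). f x * g y)"
proof (rule lborel_pair.Fubini_integrable)
  have [measurable]: "f \<in> borel_measurable borel" "g \<in> borel_measurable borel" using assms by auto
  show "(\<lambda>(x, y). f x * g y) \<in> borel_measurable (lborel \<Otimes>\<^sub>M lborel)" by measurable
  show "integrable lborel (\<lambda>x. LBINT y. norm (case (x, y) of (x, y) \<Rightarrow> f x * g y))"
    using assms by (simp add: norm_mult)
  show "AE x in lborel. integrable lborel (\<lambda>y. case (x, y) of (x, y) \<Rightarrow> f x * g y)"
    using assms by simp
qed

lemma integrable_tensor_phase:
  fixes f g :: "real \<Rightarrow> complex"
  assumes "integrable lborel f" "integrable lborel g"
    and [measurable]: "p \<in> borel_measurable (borel \<Otimes>\<^sub>M borel)" and "\<And>x. norm (p x) \<le> 1"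
  shows "integrable (lborel \<Otimes>\<^sub>M lborel) (\<lambda>(x, y). p (x, y) * (f x * g y))"
proof -
  have [measurable]: "f \<in> borel_measurable borel" "g \<in> borel_measurable borel" using assms by auto
  have "(\<lambda>(x, y). p (x, y) * (f x * g y)) \<in> borel_measurable (borel \<Otimes>\<^sub>M borel)" by measurable
  then have *: "(\<lambda>(x, y). p (x, y) * (f x * g y)) \<in> borel_measurable (lborel \<Otimes>\<^sub>M lborel)"
    by (simp cong: measurable_cong_sets)
  show ?thesis
    using integrable_tensor[OF assms(1,2)]
    by (rule Bochner_Integration.integrable_bound[OF _ *])
      (intro always_eventually allI, auto simp: norm_mult intro!: mult_left_le_one_le assms(4))
qed

lemma fourier_multiplication_formula:
  assumes "integrable lborel f" "integrable lborel g"
  shows "(LBINT x. fourier f x * g x) = (LBINT x. f x * fourier g x)"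
proof -
  have i: "integrable (lborel \<Otimes>\<^sub>M lborel)
      (\<lambda>(x, y). exp (- \<i> * of_real (x * y)) * (f x * g y))"
    using integrable_tensor_phase[OF assms, of "\<lambda>(x, y). exp (- \<i> * of_real (x * y))"]
    by (simp add: case_prod_beta)
  have "(LBINT y. LBINT x. exp (- \<i> * of_real (x * y)) * (f x * g y)) =
        (LBINT x. LBINT y. exp (- \<i> * of_real (x * y)) * (f x * g y))"
    using lborel_pair.Fubini_integral[OF i] by simp
  moreover have "(LBINT x. exp (- \<i> * of_real (x * y)) * (f x * g y)) = fourier f y * g y" for y
  proof -
    have "(LBINT x. exp (- \<i> * of_real (x * y)) * (f x * g y)) =
       (LBINT x. (exp (- \<i> * of_real (x * y)) * f x) * g y)"
      by (simp add: mult.assoc)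
    then show ?thesis unfolding fourier_def by simp
  qed
  moreover have "(LBINT y. exp (- \<i> * of_real (x * y)) * (f x * g y)) = f x * fourier g x" for x
  proof -
    have "(LBINT y. exp (- \<i> * of_real (x * y)) * (f x * g y)) =
       (LBINT y. f x * (exp (- \<i> * of_real (y * x)) * g y))"
      by (simp add: mult_ac)
    then show ?thesis unfolding fourier_def by (simp only: integral_mult_right_zero)
  qed
  ultimately show ?thesis by simp
qed

lemma integrable_gaussian:
  assumes "0 < (m::real)" 
  shows "integrable lborel (\<lambda>x. exp (- (m * x\<^sup>2) / 2))"
    "(LBINT x. exp (- (m * x\<^sup>2) / 2)) = sqrt (2 * pi / m)"
proof -
  have n: "normal_density 0 (1 / sqrt m) x = exp (- (m * x\<^sup>2) / 2) / sqrt (2 * pi / m)" for x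
    using assms by (simp add: normal_density_def power_divide)
  have "has_bochner_integral lborel (\<lambda>x. sqrt (2 * pi / m) * normal_density 0 (1 / sqrt m) x) (sqrt (2 * pi / m) * 1)"
    using assms by (intro has_bochner_integral_mult_right)
      (simp add: has_bochner_integral_iff integral_normal_density)
  then have "has_bochner_integral lborel (\<lambda>x. exp (- (m * x\<^sup>2) / 2)) (sqrt (2 * pi / m))"
    using assms by (simp add: n)
  then show "integrable lborel (\<lambda>x. exp (- (m * x\<^sup>2) / 2))"
    "(LBINT x. exp (- (m * x\<^sup>2) / 2)) = sqrt (2 * pi / m)"
    by (simp_all add: has_bochner_integral_iff)
qed

text \<open>The substitution of x / sqrt m for x reduces the claim to the characteristic function of
  the standard normal distribution.\<close>

lemma fourier_gaussian:
  assumes "0 < (m::real)"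
  shows "fourier (\<lambda>x. of_real (exp (- (m * x\<^sup>2) / 2))) \<xi> = of_real (sqrt (2 * pi / m) * exp (- \<xi>\<^sup>2 / (2 * m)))"
proof -
  have c: "char std_normal_distribution t = of_real (exp (- (t\<^sup>2) / 2))" for t
    by (simp add: char_std_normal_distribution)
  have "char std_normal_distribution t = (LBINT x. of_real (std_normal_density x) * iexp (t * x))" for t
    unfolding char_def
    by (subst integral_density) (auto simp: scaleR_conv_of_real normal_density_nonneg)
  then have g: "(LBINT x. of_real (std_normal_density x) * iexp (t * x)) = of_real (exp (- (t\<^sup>2) / 2))" for t
    using c by simp
  have sm: "sqrt m > 0" using assms by simp
  have "fourier (\<lambda>x. of_real (exp (- (m * x\<^sup>2) / 2))) \<xi> =
    \<bar>1 / sqrt m\<bar> *\<^sub>R (LBINT x. exp (- \<i> * of_real ((1 / sqrt m * x) * \<xi>)) * of_real (exp (- (m * (1 / sqrt m * x)\<^sup>2) / 2)))"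
    unfolding fourier_def using sm
    by (subst lborel_integral_real_affine[where c = "1 / sqrt m" and t = 0]) auto
  also have "(\<lambda>x. exp (- \<i> * of_real ((1 / sqrt m * x) * \<xi>)) * of_real (exp (- (m * (1 / sqrt m * x)\<^sup>2) / 2))) =
     (\<lambda>x. of_real (sqrt (2 * pi)) * (of_real (std_normal_density x) * iexp ((- \<xi> / sqrt m) * x)))"
    using assms by (auto simp: fun_eq_iff std_normal_density_def power_mult_distrib power_divide mult_ac)
  also have "(LBINT x. of_real (sqrt (2 * pi)) * (of_real (std_normal_density x) * iexp ((- \<xi> / sqrt m) * x)))
     = of_real (sqrt (2 * pi)) * of_real (exp (- ((- \<xi> / sqrt m)\<^sup>2) / 2))"
    by (simp only: integral_mult_right_zero g)
  finally show ?thesis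
    using assms by (simp add: scaleR_conv_of_real power_divide real_sqrt_divide)
qed

section \<open>Fourier inversion and uniqueness\<close>

text \<open>Gaussian summation. The transform of the modulated Gaussian \<open>g n\<close> is an
  approximate identity concentrated at \<open>x\<close>. Moving the transform from \<open>f\<close>
  to \<open>g n\<close> evaluates the regularised inversion integral in two ways, and both limits
  follow by dominated convergence.\<close>

lemma fourier_inversion:
  assumes cont: "continuous_on UNIV f" and bd: "\<And>x. norm (f x) \<le> M"
    and f: "integrable lborel f" and Ff: "integrable lborel (fourier f)"
  shows "inverse_fourier (fourier f) x = f x"
proof -
  define e :: "nat \<Rightarrow> real" where "e n = 1 / Suc n" for n
  have e: "e n > 0" for n by (simp add: e_def)
  have elim: "e \<longlonglongrightarrow> 0" unfolding e_def using LIMSEQ_inverse_real_of_nat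
    by (simp add: inverse_eq_divide)
  define g :: "nat \<Rightarrow> real \<Rightarrow> complex" where
    "g n = (\<lambda>\<xi>. iexp (\<xi> * x) * of_real (exp (- ((e n)\<^sup>2 * \<xi>\<^sup>2) / 2)))" for n
  have gi: "integrable lborel (g n)" for n
  proof (rule integrable_complex_bound)
    show "integrable lborel (\<lambda>\<xi>. exp (- ((e n)\<^sup>2 * \<xi>\<^sup>2) / 2))"
      using e[of n] by (intro integrable_gaussian) simp
  qed (auto simp: g_def norm_mult)
  have Fg: "fourier (g n) y = of_real (sqrt (2 * pi) / e n * exp (- ((y - x) / e n)\<^sup>2 / 2))" for n y
    using e[of n] unfolding g_def fourier_modulate
    by (subst fourier_gaussian) (auto simp: real_sqrt_divide power_divide mult.commute)
  have f_meas [measurable]: "f \<in> borel_measurable borel" using f by auto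
  have Ff_meas [measurable]: "fourier f \<in> borel_measurable borel" using Ff by auto
  have eq: "(LBINT \<xi>. fourier f \<xi> * g n \<xi>) =
      of_real (sqrt (2 * pi)) * (LBINT z. f (x + e n * z) * of_real (exp (- z\<^sup>2 / 2)))" for n
  proof -
    have "(LBINT \<xi>. fourier f \<xi> * g n \<xi>) = (LBINT y. f y * fourier (g n) y)"
      by (rule fourier_multiplication_formula[OF f gi])
    also have "\<dots> = \<bar>e n\<bar> *\<^sub>R (LBINT z. f (x + e n * z) * fourier (g n) (x + e n * z))"
      using e[of n] by (subst lborel_integral_real_affine[where c = "e n" and t = x]) auto
    also have "(\<lambda>z. f (x + e n * z) * fourier (g n) (x + e n * z)) =
       (\<lambda>z. of_real (sqrt (2 * pi) / e n) * (f (x + e n * z) * of_real (exp (- z\<^sup>2 / 2))))"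
      using e[of n] by (auto simp: Fg fun_eq_iff)
    also have "\<bar>e n\<bar> *\<^sub>R (LBINT z. of_real (sqrt (2 * pi) / e n) * (f (x + e n * z) * of_real (exp (- z\<^sup>2 / 2))))
      = of_real (sqrt (2 * pi)) * (LBINT z. f (x + e n * z) * of_real (exp (- z\<^sup>2 / 2)))"
      using e[of n] by (subst integral_mult_right_zero) (simp add: scaleR_conv_of_real)
    finally show ?thesis .
  qed
  have "(\<lambda>n. LBINT \<xi>. fourier f \<xi> * g n \<xi>) \<longlonglongrightarrow>
     (LBINT \<xi>. fourier f \<xi> * iexp (\<xi> * x))"
  proof (rule integral_dominated_convergence)
    show "integrable lborel (\<lambda>\<xi>. norm (fourier f \<xi>))" using Ff by simp
    show "AE \<xi> in lborel. (\<lambda>n. fourier f \<xi> * g n \<xi>) \<longlonglongrightarrow> fourier f \<xi> * iexp (\<xi> * x)"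
    proof (intro always_eventually allI)
      fix \<xi>
      have "(\<lambda>n. fourier f \<xi> * g n \<xi>) \<longlonglongrightarrow>
          fourier f \<xi> * (iexp (\<xi> * x) * of_real (exp (- (0\<^sup>2 * \<xi>\<^sup>2) / 2)))"
        unfolding g_def by (intro tendsto_intros elim) auto
      then show "(\<lambda>n. fourier f \<xi> * g n \<xi>) \<longlonglongrightarrow> fourier f \<xi> * iexp (\<xi> * x)" by simp
    qed
    show "AE \<xi> in lborel. norm (fourier f \<xi> * g n \<xi>) \<le> norm (fourier f \<xi>)" for n
      by (intro always_eventually allI) (auto simp: g_def norm_mult intro!: mult_right_le_one_le)
    show "(\<lambda>\<xi>. fourier f \<xi> * g n \<xi>) \<in> borel_measurable lborel" for n
      unfolding g_def by simp
  qed auto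
  moreover have "(\<lambda>n. LBINT \<xi>. fourier f \<xi> * g n \<xi>) \<longlonglongrightarrow> of_real (2 * pi) * f x"
  proof -
    have "(\<lambda>n. LBINT z. f (x + e n * z) * of_real (exp (- z\<^sup>2 / 2))) \<longlonglongrightarrow>
      (LBINT z. f x * of_real (exp (- z\<^sup>2 / 2)))"
    proof (rule integral_dominated_convergence)
      show "integrable lborel (\<lambda>z. M * exp (- z\<^sup>2 / 2))"
        using integrable_gaussian(1)[of 1] by (intro integrable_mult_right) simp
      show "AE z in lborel. (\<lambda>n. f (x + e n * z) * of_real (exp (- z\<^sup>2 / 2))) \<longlonglongrightarrow> f x * of_real (exp (- z\<^sup>2 / 2))"
      proof (intro always_eventually allI)
        fix z
        have "(\<lambda>n. x + e n * z) \<longlonglongrightarrow> x + 0 * z" by (intro tendsto_intros elim)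
        then have "(\<lambda>n. f (x + e n * z)) \<longlonglongrightarrow> f x"
          using cont isCont_tendsto_compose[of x f "\<lambda>n. x + e n * z"]
          by (simp add: continuous_on_eq_continuous_at)
        then show "(\<lambda>n. f (x + e n * z) * of_real (exp (- z\<^sup>2 / 2))) \<longlonglongrightarrow> f x * of_real (exp (- z\<^sup>2 / 2))"
          by (intro tendsto_intros)
      qed
      show "AE z in lborel. norm (f (x + e n * z) * of_real (exp (- z\<^sup>2 / 2))) \<le> M * exp (- z\<^sup>2 / 2)" for n
        using bd by (intro always_eventually allI) (auto simp: norm_mult intro!: mult_right_mono)
    qed auto
    moreover have l: "(LBINT z. f x * of_real (exp (- z\<^sup>2 / 2))) = f x * of_real (sqrt (2 * pi))"
      using integrable_gaussian(2)[of 1]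
      by (simp only: integral_mult_right_zero integral_complex_of_real) simp
    ultimately have "(\<lambda>n. of_real (sqrt (2 * pi)) * (LBINT z. f (x + e n * z) * of_real (exp (- z\<^sup>2 / 2)))) \<longlonglongrightarrow>
      of_real (sqrt (2 * pi)) * (f x * of_real (sqrt (2 * pi)))"
      unfolding l by (intro tendsto_mult tendsto_const)
    also have "of_real (sqrt (2 * pi)) * (f x * of_real (sqrt (2 * pi))) = of_real (sqrt (2 * pi) * sqrt (2 * pi)) * f x"
      unfolding of_real_mult by (simp add: mult_ac)
    also have "sqrt (2 * pi) * sqrt (2 * pi) = 2 * pi" by simp
    finally show ?thesis by (simp add: eq)
  qed
  ultimately have "(LBINT \<xi>. fourier f \<xi> * iexp (\<xi> * x)) = of_real (2 * pi) * f x"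
    by (rule LIMSEQ_unique)
  then show ?thesis by (simp add: inverse_fourier_def mult.commute)
qed

lemma integrable_reflect: 
  fixes f :: "real \<Rightarrow> complex"
  shows "integrable lborel f \<Longrightarrow> integrable lborel (\<lambda>x. f (- x))"
  using lborel_integrable_real_affine[of f "-1" 0] by simp

lemma fourier_inverse_fourier:
  assumes "continuous_on UNIV f" "\<And>x. norm (f x) \<le> M"
    and "integrable lborel f" "integrable lborel (inverse_fourier f)"
  shows "fourier (inverse_fourier f) x = f x"
proof -
  have F: "integrable lborel (fourier f)"
    using integrable_reflect[OF assms(4)] by (simp add: fourier_eq_inverse_fourier[abs_def])
  have "fourier (inverse_fourier f) x = of_real (1 / (2 * pi)) * fourier (\<lambda>x. fourier f (- x)) x"
    by (simp only: inverse_fourier_eq[abs_def] fourier_mult)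
  also have "\<dots> = inverse_fourier (fourier f) x"
    by (simp only: fourier_reflect inverse_fourier_eq)
  also have "\<dots> = f x" using fourier_inversion[OF assms(1-3) F] .
  finally show ?thesis .
qed

lemma inverse_fourier_multiplication_formula:
  assumes "integrable lborel f" "integrable lborel g"
  shows "(LBINT x. inverse_fourier f x * g x) = (LBINT x. f x * inverse_fourier g x)"
proof -
  have "(LBINT x. fourier f (- x) * g x) = (LBINT x. fourier f x * g (- x))"
    using lborel_integral_real_affine[of "-1" "\<lambda>x. fourier f (- x) * g x" 0] by simp
  also have "\<dots> = (LBINT x. f x * fourier g (- x))"
    using fourier_multiplication_formula[OF assms(1) integrable_reflect[OF assms(2)]]
    by (simp add: fourier_reflect)
  finally show ?thesis
    by (simp add: inverse_fourier_eq mult.left_commute mult.assoc)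
qed

section \<open>Convolution, and injectivity of the Fourier transform\<close>

definition conv :: "(real \<Rightarrow> complex) \<Rightarrow> (real \<Rightarrow> complex) \<Rightarrow> real \<Rightarrow> complex" where
  "conv f g x = (LBINT a. f a * g (x - a))"

lemma fourier_shift: "fourier (\<lambda>x. g (x - a)) \<xi> = exp (- \<i> * of_real (a * \<xi>)) * fourier g \<xi>"
proof -
  have "fourier (\<lambda>x. g (x - a)) \<xi> = (LBINT x. exp (- \<i> * of_real ((a + x) * \<xi>)) * g x)"
    unfolding fourier_def
    by (subst lborel_integral_real_affine[where c = 1 and t = a]) auto
  also have "\<dots> = (LBINT x. exp (- \<i> * of_real (a * \<xi>)) * (exp (- \<i> * of_real (x * \<xi>)) * g x))"
  proof -
    have "exp (- \<i> * of_real ((a + x) * \<xi>)) = exp (- \<i> * of_real (a * \<xi>)) * exp (- \<i> * of_real (x * \<xi>))" for x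
      unfolding exp_add[symmetric] by (rule arg_cong[where f = exp]) (simp add: algebra_simps)
    then show ?thesis by (simp only: mult.assoc)
  qed
  finally show ?thesis by (simp only: fourier_def integral_mult_right_zero)
qed

lemma fourier_conv:
  assumes f: "integrable lborel f" and g: "integrable lborel g"
  shows "fourier (conv f g) \<xi> = fourier f \<xi> * fourier g \<xi>"
proof -
  have [measurable]: "f \<in> borel_measurable borel" "g \<in> borel_measurable borel" using f g by auto
  have gs: "integrable lborel (\<lambda>x. g (x - a))" for a
    using lborel_integrable_real_affine[OF g, of 1 "- a"] by simp
  have ng: "(LBINT x. norm (g (x - a))) = (LBINT x. norm (g x))" for a
    using lborel_integral_real_affine[of 1 "\<lambda>x. norm (g x)" "- a"] by simp
  have i: "integrable (lborel \<Otimes>\<^sub>M lborel) (\<lambda>(a, x). exp (- \<i> * of_real (x * \<xi>)) * (f a * g (x - a)))"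
  proof (rule lborel_pair.Fubini_integrable)
    have "(\<lambda>(a, x). exp (- \<i> * of_real (x * \<xi>)) * (f a * g (x - a))) \<in> borel_measurable (borel \<Otimes>\<^sub>M borel)"
      by measurable
    then show "(\<lambda>(a, x). exp (- \<i> * of_real (x * \<xi>)) * (f a * g (x - a))) \<in> borel_measurable (lborel \<Otimes>\<^sub>M lborel)"
      by (simp cong: measurable_cong_sets)
    show "integrable lborel (\<lambda>a. LBINT x. norm (case (a, x) of (a, x) \<Rightarrow> exp (- \<i> * of_real (x * \<xi>)) * (f a * g (x - a))))"
      using f by (simp add: norm_mult ng)
    show "AE a in lborel. integrable lborel (\<lambda>x. case (a, x) of (a, x) \<Rightarrow> exp (- \<i> * of_real (x * \<xi>)) * (f a * g (x - a)))"
    proof (intro always_eventually allI)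
      fix a
      show "integrable lborel (\<lambda>x. case (a, x) of (a, x) \<Rightarrow> exp (- \<i> * of_real (x * \<xi>)) * (f a * g (x - a)))"
        using fourier_integrand_integrable[OF integrable_mult_right[OF gs, of "f a"]] by simp
    qed
  qed
  have "fourier (conv f g) \<xi> = (LBINT x. LBINT a. exp (- \<i> * of_real (x * \<xi>)) * (f a * g (x - a)))"
    unfolding fourier_def conv_def by (simp only: integral_mult_right_zero)
  also have "\<dots> = (LBINT a. LBINT x. exp (- \<i> * of_real (x * \<xi>)) * (f a * g (x - a)))"
    using lborel_pair.Fubini_integral[OF i] by simp
  also have "\<dots> = (LBINT a. (exp (- \<i> * of_real (a * \<xi>)) * f a) * fourier g \<xi>)"
  proof (rule Bochner_Integration.integral_cong[OF refl])
    fix a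
    have "(LBINT x. exp (- \<i> * of_real (x * \<xi>)) * (f a * g (x - a))) = fourier (\<lambda>x. f a * g (x - a)) \<xi>"
      by (simp only: fourier_def)
    then show "(LBINT x. exp (- \<i> * of_real (x * \<xi>)) * (f a * g (x - a))) = (exp (- \<i> * of_real (a * \<xi>)) * f a) * fourier g \<xi>"
      by (simp only: fourier_mult fourier_shift mult_ac)
  qed
  finally show ?thesis by (simp only: fourier_def[of f] integral_mult_left_zero)
qed

text \<open>The positive and negative parts have equal transforms, and in particular, at frequency
  0, equal mass. If the mass is positive, both normalise to probability measures with the same
  characteristic function and Levy's uniqueness theorem applies; if it is 0, both parts vanish
  almost everywhere.\<close>

lemma fourier_eq_0_real:
  fixes f :: "real \<Rightarrow> real"
  assumes f: "integrable lborel f" and 0: "\<And>\<xi>. fourier (\<lambda>x. of_real (f x)) \<xi> = 0"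
  shows "AE x in lborel. f x = 0"
proof -
  have [measurable]: "f \<in> borel_measurable borel" using f by auto
  define P where "P = (\<lambda>x. max 0 (f x))"
  define Q where "Q = (\<lambda>x. max 0 (- f x))"
  have PQ: "f x = P x - Q x" "0 \<le> P x" "0 \<le> Q x" for x by (auto simp: P_def Q_def)
  have [measurable]: "P \<in> borel_measurable borel" "Q \<in> borel_measurable borel" by (auto simp: P_def Q_def)
  have P: "integrable lborel P" and Q: "integrable lborel Q"
    using f by (auto simp: P_def Q_def)
  have F: "fourier (\<lambda>x. of_real (P x)) \<xi> = fourier (\<lambda>x. of_real (Q x)) \<xi>" for \<xi>
    using 0[of \<xi>] P Q by (simp add: PQ(1) fourier_diff)
  define c where "c = (LBINT x. P x)"
  have cQ: "c = (LBINT x. Q x)"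
    using F[of 0] by (simp add: fourier_def c_def)
  show ?thesis
  proof (cases "c = 0")
    case True
    then have "AE x in lborel. P x = 0" "AE x in lborel. Q x = 0"
      using integral_nonneg_eq_0_iff_AE[OF P] integral_nonneg_eq_0_iff_AE[OF Q] PQ cQ c_def by auto
    then show ?thesis by eventually_elim (simp add: PQ(1))
  next
    case False
    have c: "c > 0" using False PQ(2) by (simp add: c_def order_less_le)
    have dist: "real_distribution (density lborel (\<lambda>x. ennreal (R x / c)))"
      if R: "integrable lborel R" "\<And>x. 0 \<le> R x" "c = (LBINT x. R x)" for R
    proof -
      have [measurable]: "R \<in> borel_measurable borel" using R by auto
      have "emeasure (density lborel (\<lambda>x. ennreal (R x / c))) UNIV = (\<integral>\<^sup>+ x. ennreal (R x / c) \<partial>lborel)"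
        by (simp add: emeasure_density)
      also have "\<dots> = ennreal (LBINT x. R x / c)"
        using R c by (intro nn_integral_eq_integral) auto
      also have "\<dots> = 1" using R c by simp
      finally have "prob_space (density lborel (\<lambda>x. ennreal (R x / c)))"
        by (intro prob_spaceI) simp
      then show ?thesis by (simp add: real_distribution_def real_distribution_axioms_def)
    qed
    have ch: "char (density lborel (\<lambda>x. ennreal (R x / c))) t = fourier (\<lambda>x. of_real (R x)) (- t) / c"
      if R: "integrable lborel R" "\<And>x. 0 \<le> R x" for R t
    proof -
      have [measurable]: "R \<in> borel_measurable borel" using R by auto
      have "char (density lborel (\<lambda>x. ennreal (R x / c))) t = (LBINT x. (R x / c) *\<^sub>R iexp (t * x))"
        unfolding char_def using R c by (subst integral_density) auto
      also have "\<dots> = (LBINT x. (exp (- \<i> * of_real (x * - t)) * of_real (R x)) / c)"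
        by (simp add: scaleR_conv_of_real mult_ac)
      finally show ?thesis by (simp only: fourier_def integral_divide_zero)
    qed
    have "density lborel (\<lambda>x. ennreal (P x / c)) = density lborel (\<lambda>x. ennreal (Q x / c))"
      by (rule Levy_uniqueness) (use dist[OF P] dist[OF Q] PQ c_def cQ ch[OF P] ch[OF Q] F in \<open>auto simp: fun_eq_iff\<close>)
    then have "AE x in lborel. ennreal (P x / c) = ennreal (Q x / c)"
      
      by (subst (asm) sigma_finite_measure.density_unique_iff[OF sigma_finite_lborel]) auto
    then show ?thesis
      by eventually_elim (use PQ c in \<open>auto simp: ennreal_inj divide_nonneg_pos\<close>)
  qed
qed

lemma fourier_eq_0:
  assumes f: "integrable lborel f" and 0: "\<And>\<xi>. fourier f \<xi> = 0"
  shows "AE x in lborel. f x = 0"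
proof -
  have c: "fourier (\<lambda>x. cnj (f x)) \<xi> = 0" for \<xi>
    by (simp add: fourier_cnj 0)
  have R: "of_real (Re z) = (1/2) * z + (1/2) * cnj z" and I: "of_real (Im z) = (- \<i> / 2) * z + (\<i> / 2) * cnj z" for z
    by (auto simp: complex_eq_iff)
  have "fourier (\<lambda>x. a * f x + b * cnj (f x)) \<xi> = 0" for a b \<xi>
    using f by (subst fourier_add) (auto simp: fourier_mult 0 c)
  then have "fourier (\<lambda>x. of_real (Re (f x))) \<xi> = 0" "fourier (\<lambda>x. of_real (Im (f x))) \<xi> = 0" for \<xi>
    by (simp_all only: R I)
  with f have "AE x in lborel. Re (f x) = 0" "AE x in lborel. Im (f x) = 0"
    by (intro fourier_eq_0_real; auto)+
  then show ?thesis by eventually_elim (simp add: complex_eq_iff)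
qed

section \<open>Schwartz functions\<close>

lemma schwartz_differentiable:
  "\<psi> \<in> schwartz \<Longrightarrow> (vderiv ^^ n) \<psi> differentiable (at x)"
  by (simp add: schwartz_def)

lemma schwartz_has_vector_derivative:
  "\<psi> \<in> schwartz \<Longrightarrow> (\<psi> has_vector_derivative vderiv \<psi> x) (at x)"
  using schwartz_differentiable[of \<psi> 0 x] by (simp add: vderiv_def vector_derivative_works)

lemma vderiv_schwartz: "\<psi> \<in> schwartz \<Longrightarrow> vderiv \<psi> \<in> schwartz"
proof -
  assume "\<psi> \<in> schwartz"
  moreover have "(vderiv ^^ n) (vderiv \<psi>) = (vderiv ^^ Suc n) \<psi>" for n
    by (simp add: funpow_swap1)
  ultimately show "vderiv \<psi> \<in> schwartz"
    unfolding schwartz_def mem_Collect_eq by presburger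
qed

lemma schwartz_continuous: "\<psi> \<in> schwartz \<Longrightarrow> continuous_on UNIV \<psi>"
  using schwartz_differentiable[of \<psi> 0]
  by (auto simp: continuous_on_eq_continuous_at intro: differentiable_imp_continuous_within)

lemma schwartz_seminorm_upper:
  assumes "\<psi> \<in> schwartz"
  shows "norm (x ^ k *\<^sub>R (vderiv ^^ n) \<psi> x) \<le> schwartz_seminorm k n \<psi>"
  unfolding schwartz_seminorm_def
proof (rule cSUP_upper)
  have "bounded (range (\<lambda>x. x ^ k *\<^sub>R (vderiv ^^ n) \<psi> x))"
    using assms by (simp add: schwartz_def)
  then show "bdd_above (range (\<lambda>x. norm (x ^ k *\<^sub>R (vderiv ^^ n) \<psi> x)))"
    unfolding bounded_iff by (auto simp: bdd_above_def)
qed simp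

lemma schwartz_decay:
  assumes "\<psi> \<in> schwartz"
  shows "norm (\<psi> x) \<le> (schwartz_seminorm 0 0 \<psi> + schwartz_seminorm 2 0 \<psi>) * wt x"
proof -
  have "norm (\<psi> x) \<le> schwartz_seminorm 0 0 \<psi>" "x\<^sup>2 * norm (\<psi> x) \<le> schwartz_seminorm 2 0 \<psi>"
    using schwartz_seminorm_upper[OF assms, where n = 0 and k = 0 and x = x] schwartz_seminorm_upper[OF assms, where n = 0 and k = 2 and x = x]
    by simp_all
  then have "(1 + x\<^sup>2) * norm (\<psi> x) \<le> schwartz_seminorm 0 0 \<psi> + schwartz_seminorm 2 0 \<psi>"
    by (simp add: algebra_simps)
  then have "(1 + x\<^sup>2) * norm (\<psi> x) * wt x \<le> (schwartz_seminorm 0 0 \<psi> + schwartz_seminorm 2 0 \<psi>) * wt x"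
    by (rule mult_right_mono) simp
  then show ?thesis using wt_cancel[of x] by (simp add: mult.assoc mult.left_commute)
qed

text \<open>Membership in the ball of radius \<open>C\<close> of a weighted space of continuous
  functions. The radius is kept explicit because Lipschitz constants of the cubic term and Sobolev
  bounds are computed from it.\<close>

definition decaying :: "real \<Rightarrow> (real \<Rightarrow> complex) \<Rightarrow> bool" where
  "decaying C f \<longleftrightarrow> continuous_on UNIV f \<and> (\<forall>x. norm (f x) \<le> C * wt x)"

lemma decayingD: "decaying C f \<Longrightarrow> continuous_on UNIV f" "decaying C f \<Longrightarrow> norm (f x) \<le> C * wt x"
  by (auto simp: decaying_def)

lemma decaying_nonneg: "decaying C f \<Longrightarrow> 0 \<le> C"
  using decayingD(2)[of C f 0] norm_ge_zero[of "f 0"] by (simp add: wt_def del: norm_ge_zero)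

lemma decaying_bounded: "decaying C f \<Longrightarrow> norm (f x) \<le> C"
  using decayingD(2)[of C f x] mult_left_mono[OF wt_le_1[of x] decaying_nonneg[of C f]] by simp

lemma decaying_measurable: "decaying C f \<Longrightarrow> f \<in> borel_measurable borel"
  by (intro borel_measurable_continuous_onI decayingD)

lemma decaying_integrable: "decaying C f \<Longrightarrow> integrable lborel f"
  by (rule integrable_complex_bound[OF decaying_measurable integrable_mult_right[OF integrable_wt]])
    (auto intro: decayingD)

lemma decaying_diff: "decaying A f \<Longrightarrow> decaying B g \<Longrightarrow> decaying (A + B) (\<lambda>x. f x - g x)"
  unfolding decaying_def distrib_right
  by (auto intro!: continuous_intros intro: order_trans[OF norm_triangle_ineq4] add_mono)

lemma decaying_mult:
  "decaying A f \<Longrightarrow> continuous_on UNIV m \<Longrightarrow> (\<And>x. norm (m x) \<le> M) \<Longrightarrow> decaying (M * A) (\<lambda>x. m x * f x)"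
  unfolding decaying_def
  by (auto intro!: continuous_intros mult_mono simp: norm_mult mult.assoc intro: order_trans[OF norm_ge_zero])

lemma decaying_reflect_cnj: "decaying A f \<Longrightarrow> decaying A (\<lambda>x. cnj (f (- x)))"
  unfolding decaying_def
  by (auto intro!: continuous_intros intro: continuous_on_compose2)
    (metis wt_minus)

lemma schwartz_decaying:
  "\<psi> \<in> schwartz \<Longrightarrow> decaying (schwartz_seminorm 0 0 \<psi> + schwartz_seminorm 2 0 \<psi>) \<psi>"
  by (simp add: decaying_def schwartz_continuous schwartz_decay)

lemma schwartz_integrable: "\<psi> \<in> schwartz \<Longrightarrow> integrable lborel \<psi>"
  by (rule decaying_integrable[OF schwartz_decaying])

lemma wt_tendsto_0: "(wt \<longlongrightarrow> 0) at_top" "(wt \<longlongrightarrow> 0) at_bot"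
proof -
  show 1: "(wt \<longlongrightarrow> 0) at_top"
    unfolding wt_def[abs_def]
    by (intro tendsto_divide_0[OF tendsto_const] filterlim_at_top_imp_at_infinity
        filterlim_tendsto_add_at_top[OF tendsto_const] filterlim_pow_at_top filterlim_ident) simp
  show "(wt \<longlongrightarrow> 0) at_bot"
    using filterlim_compose[OF 1 filterlim_uminus_at_top_at_bot] by simp
qed

text \<open>Integration by parts: the integral of the derivative of exp(- i x \<xi>) f(x) over the
  line is 0, since decay removes the boundary terms.\<close>

lemma fourier_derivative:
  assumes f: "decaying A f" and f': "decaying B f'"
    and deriv: "\<And>x. (f has_vector_derivative f' x) (at x)"
  shows "fourier f' \<xi> = \<i> * of_real \<xi> * fourier f \<xi>"
proof -
  let ?e = "\<lambda>x::real. exp (- \<i> * of_real (x * \<xi>))"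
  let ?F = "\<lambda>x. ?e x * f x"
  let ?F' = "\<lambda>x. ?e x * f' x - \<i> * of_real \<xi> * (?e x * f x)"
  have e: "(?e has_vector_derivative (- \<i> * of_real \<xi>) * ?e x) (at x)" for x
  proof -
    have "((\<lambda>z. exp (- \<i> * (z * of_real \<xi>))) has_field_derivative
        (- \<i> * of_real \<xi>) * exp (- \<i> * (of_real x * of_real \<xi>))) (at (of_real x))"
      by (auto intro!: derivative_eq_intros)
    from has_vector_derivative_real_field[OF this] show ?thesis by (simp add: o_def)
  qed
  have "(?F has_vector_derivative ?e x * f' x + (- \<i> * of_real \<xi>) * ?e x * f x) (at x)" for x
    by (rule has_vector_derivative_mult[OF e deriv])
  moreover have "E * p + (- \<i> * X) * E * q = E * p - \<i> * X * (E * q)" for E p q X :: complex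
    by (simp add: algebra_simps)
  ultimately have D: "(?F has_vector_derivative ?F' x) (at x)" for x
    by (simp only:)
  have i: "integrable lborel (\<lambda>x. ?e x * f' x)" "integrable lborel (\<lambda>x. \<i> * of_real \<xi> * (?e x * f x))"
    using fourier_integrand_integrable[OF decaying_integrable[OF f]]
      fourier_integrand_integrable[OF decaying_integrable[OF f']] by (auto intro: integrable_mult_right)
  have iF': "integrable lborel ?F'" using i by (rule Bochner_Integration.integrable_diff)
  have lim: "(?F \<longlongrightarrow> 0) F" if "(wt \<longlongrightarrow> 0) F" for F
  proof (rule Lim_null_comparison)
    show "((\<lambda>x. A * wt x) \<longlongrightarrow> 0) F" using tendsto_mult_right_zero[OF that] by simp
  qed (auto simp: norm_mult intro!: always_eventually decayingD(2)[OF f])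
  have "(LBINT x=-\<infinity>..\<infinity>. ?F' x) = 0 - 0"
  proof (rule interval_integral_FTC_integrable[OF _ D])
    show "set_integrable lborel (einterval (-\<infinity>) \<infinity>) ?F'"
      using iF' by (simp add: set_integrable_def)
    show "((?F \<circ> real_of_ereal) \<longlongrightarrow> 0) (at_right (- \<infinity>))"
      unfolding ereal_tendsto_simps by (rule lim[OF wt_tendsto_0(2)])
    show "((?F \<circ> real_of_ereal) \<longlongrightarrow> 0) (at_left \<infinity>)"
      unfolding ereal_tendsto_simps by (rule lim[OF wt_tendsto_0(1)])
    show "isCont ?F' x" for x
      using decayingD(1)[OF f] decayingD(1)[OF f'] by (auto intro!: continuous_intros simp: continuous_on_eq_continuous_at)
  qed simp
  then have "(LBINT x. ?F' x) = 0"
    by (simp add: interval_lebesgue_integral_def set_lebesgue_integral_def)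
  then have "(LBINT x. ?e x * f' x) - (LBINT x. \<i> * of_real \<xi> * (?e x * f x)) = 0"
    using Bochner_Integration.integral_diff[OF i] by simp
  then show ?thesis unfolding fourier_def by (simp only: integral_mult_right_zero) simp
qed

text \<open>The function (1 + \<xi>^2) times the transform of \<psi> is the transform of \<psi>
  minus its second derivative, an integrable function, and is therefore bounded.\<close>

lemma decaying_fourier_schwartz:
  assumes "\<psi> \<in> schwartz"
  shows "\<exists>C. decaying C (fourier \<psi>)"
proof -
  note s0 = assms and s1 = vderiv_schwartz[OF assms] and s2 = vderiv_schwartz[OF vderiv_schwartz[OF assms]]
  note d0 = schwartz_decaying[OF s0] and d1 = schwartz_decaying[OF s1] and d2 = schwartz_decaying[OF s2]
  have "fourier (vderiv (vderiv \<psi>)) \<xi> = - of_real (\<xi>\<^sup>2) * fourier \<psi> \<xi>" for \<xi>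
    unfolding fourier_derivative[OF d1 d2 schwartz_has_vector_derivative[OF s1]]
      fourier_derivative[OF d0 d1 schwartz_has_vector_derivative[OF s0]]
    by (simp add: power2_eq_square algebra_simps)
  then have eq: "of_real (1 + \<xi>\<^sup>2) * fourier \<psi> \<xi> = fourier (\<lambda>x. \<psi> x - vderiv (vderiv \<psi>) x) \<xi>" for \<xi>
    using s0 s2 by (simp add: fourier_diff schwartz_integrable algebra_simps)
  obtain C where C: "decaying C (\<lambda>x. \<psi> x - vderiv (vderiv \<psi>) x)"
    using decaying_diff[OF d0 d2] by blast
  have "norm (fourier \<psi> \<xi>) \<le> C * pi * wt \<xi>" for \<xi>
  proof -
    have "norm (of_real (1 + \<xi>\<^sup>2) * fourier \<psi> \<xi>) \<le> C * pi"
      unfolding eq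
      using norm_fourier_le[OF integrable_mult_right[OF integrable_wt] decayingD(2)[OF C]] by (simp add: integral_wt)
    then have "(1 + \<xi>\<^sup>2) * norm (fourier \<psi> \<xi>) \<le> C * pi"
      by (simp only: norm_mult norm_of_real) (simp add: add_nonneg_nonneg)
    then have "(1 + \<xi>\<^sup>2) * norm (fourier \<psi> \<xi>) * wt \<xi> \<le> C * pi * wt \<xi>"
      by (rule mult_right_mono) simp
    then show ?thesis using wt_cancel[of \<xi>] by (simp add: mult.assoc mult.left_commute)
  qed
  then show ?thesis
    unfolding decaying_def using continuous_on_fourier_UNIV[OF schwartz_integrable[OF assms]] by blast
qed

lemma inverse_fourier_fourier_schwartz:
  assumes "\<psi> \<in> schwartz"
  shows "inverse_fourier (fourier \<psi>) x = \<psi> x"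
  using decaying_fourier_schwartz[OF assms] schwartz_decaying[OF assms] assms
  by (auto intro!: fourier_inversion decaying_integrable schwartz_continuous decaying_bounded)

text \<open>A supply of Schwartz functions. The polynomial factor makes the class closed under
  differentiation; the oscillation of frequency \<open>t\<close> makes testing against the whole
  family amount to computing a Fourier transform.\<close>

definition gauss_poly :: "real \<Rightarrow> complex poly \<Rightarrow> real \<Rightarrow> complex" where
  "gauss_poly t P x = poly P (of_real x) * exp (- (of_real x)\<^sup>2 / 2 + \<i> * of_real t * of_real x)"

lemma vderiv_gauss_poly:
  "(gauss_poly t P has_vector_derivative gauss_poly t (pderiv P + P * [:\<i> * of_real t, -1:]) x) (at x)"
  unfolding gauss_poly_def[abs_def]
  by (rule has_vector_derivative_eq_rhs[OF has_vector_derivative_real_field[where f = "\<lambda>z. poly P z * exp (- z\<^sup>2 / 2 + \<i> * of_real t * z)", simplified o_def]])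
    (auto intro!: derivative_eq_intros poly_DERIV simp: algebra_simps)

lemma funpow_vderiv_gauss_poly: "\<exists>Q. (vderiv ^^ n) (gauss_poly t P) = gauss_poly t Q"
proof (induction n)
  case (Suc n)
  then obtain Q where "(vderiv ^^ n) (gauss_poly t P) = gauss_poly t Q" by blast
  moreover have "vderiv (gauss_poly t Q) = gauss_poly t (pderiv Q + Q * [:\<i> * of_real t, -1:])"
    unfolding vderiv_def by (intro ext vector_derivative_at vderiv_gauss_poly)
  ultimately have "(vderiv ^^ Suc n) (gauss_poly t P) = gauss_poly t (pderiv Q + Q * [:\<i> * of_real t, -1:])"
    by (simp only: funpow.simps o_apply)
  then show ?case by blast
qed auto

text \<open>The k-th term of the exponential series at x^2 / 2 already dominates x^(2k) up to a
  constant, and |x|^k is at most 1 + x^(2k).\<close>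

lemma bounded_power_gaussian: "\<exists>C. \<forall>x::real. \<bar>x\<bar> ^ k * exp (- x\<^sup>2 / 2) \<le> C"
proof -
  have "\<bar>x\<bar> ^ k * exp (- x\<^sup>2 / 2) \<le> 1 + 2 ^ k * fact k" for x :: real
  proof -
    have "(\<Sum>n\<in>{k}. (x\<^sup>2 / 2) ^ n /\<^sub>R fact n) \<le> (\<Sum>n. (x\<^sup>2 / 2) ^ n /\<^sub>R fact n)"
      by (rule sum_le_suminf[OF summable_exp_generic]) auto
    then have "(x\<^sup>2 / 2) ^ k /\<^sub>R fact k \<le> exp (x\<^sup>2 / 2)"
      unfolding exp_def by simp
    then have "(x\<^sup>2 / 2) ^ k / fact k \<le> exp (x\<^sup>2 / 2)"
      by (simp only: real_scaleR_def divide_inverse_commute)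
    then have "(x\<^sup>2) ^ k \<le> 2 ^ k * fact k * exp (x\<^sup>2 / 2)"
      by (simp add: field_simps power_divide)
    moreover have "\<bar>x\<bar> ^ k \<le> 1 + (x\<^sup>2) ^ k"
    proof (cases "\<bar>x\<bar> \<le> 1")
      case True
      then have "\<bar>x\<bar> ^ k \<le> 1" by (simp add: power_le_one)
      then show ?thesis by (simp add: add_increasing2)
    next
      case False
      then have "\<bar>x\<bar> ^ k \<le> \<bar>x\<bar> ^ (2 * k)" by (intro power_increasing) auto
      then show ?thesis by (simp add: power_mult)
    qed
    moreover have "1 \<le> exp (x\<^sup>2 / 2)" by simp
    ultimately have "\<bar>x\<bar> ^ k \<le> (1 + 2 ^ k * fact k) * exp (x\<^sup>2 / 2)"
      unfolding distrib_right by linarith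
    then have "\<bar>x\<bar> ^ k * exp (- x\<^sup>2 / 2) \<le> (1 + 2 ^ k * fact k) * exp (x\<^sup>2 / 2) * exp (- x\<^sup>2 / 2)"
      by (rule mult_right_mono) simp
    also have "\<dots> = 1 + 2 ^ k * fact k"
      by (simp add: mult.assoc exp_add[symmetric])
    finally show ?thesis .
  qed
  then show ?thesis by blast
qed

lemma bounded_gauss_poly: "\<exists>C. \<forall>x. norm (x ^ k *\<^sub>R gauss_poly t P x) \<le> C"
proof -
  have n: "norm (x ^ k *\<^sub>R gauss_poly t P x) = \<bar>x\<bar> ^ k * exp (- x\<^sup>2 / 2) * norm (poly P (of_real x))" for x k
    by (simp add: gauss_poly_def norm_mult power_abs mult_ac)
  have "\<exists>C. \<forall>x. \<bar>x\<bar> ^ k * exp (- x\<^sup>2 / 2) * norm (poly P (of_real x)) \<le> C"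
  \<comment> \<open>The exponent \<open>k\<close> has to vary: removing the constant coefficient
    leaves a factor x, which is moved into the power.\<close>
  proof (induction P arbitrary: k)
    case (pCons a P)
    obtain A where A: "\<bar>x\<bar> ^ k * exp (- x\<^sup>2 / 2) \<le> A" for x :: real
      using bounded_power_gaussian by blast
    obtain B where B: "\<bar>x\<bar> ^ Suc k * exp (- x\<^sup>2 / 2) * norm (poly P (of_real x)) \<le> B" for x :: real
      using pCons.IH by blast
    have "\<bar>x\<bar> ^ k * exp (- x\<^sup>2 / 2) * norm (poly (pCons a P) (of_real x)) \<le> A * norm a + B" for x :: real
    proof -
      have "norm (poly (pCons a P) (of_real x)) \<le> norm a + \<bar>x\<bar> * norm (poly P (of_real x))"
        using norm_triangle_ineq[of a "of_real x * poly P (of_real x)"] by (simp add: norm_mult)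
      then have "\<bar>x\<bar> ^ k * exp (- x\<^sup>2 / 2) * norm (poly (pCons a P) (of_real x)) \<le>
          \<bar>x\<bar> ^ k * exp (- x\<^sup>2 / 2) * (norm a + \<bar>x\<bar> * norm (poly P (of_real x)))"
        by (intro mult_left_mono) auto
      also have "\<dots> = (\<bar>x\<bar> ^ k * exp (- x\<^sup>2 / 2)) * norm a + \<bar>x\<bar> ^ Suc k * exp (- x\<^sup>2 / 2) * norm (poly P (of_real x))"
        by (simp add: algebra_simps)
      also have "\<dots> \<le> A * norm a + B"
        using A B by (intro add_mono mult_right_mono) auto
      finally show ?thesis .
    qed
    then show ?case by blast
  qed auto
  then show ?thesis unfolding n .
qed

lemma gauss_poly_schwartz: "gauss_poly t P \<in> schwartz"
  unfolding schwartz_def mem_Collect_eq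
proof (intro conjI allI)
  show "(vderiv ^^ n) (gauss_poly t P) differentiable at x" for n x
    using funpow_vderiv_gauss_poly[of n t P] differentiableI_vector[OF vderiv_gauss_poly[of t _ x]]
    by metis
  show "bounded (range (\<lambda>x. x ^ k *\<^sub>R (vderiv ^^ n) (gauss_poly t P) x))" for k n
    using funpow_vderiv_gauss_poly[of n t P] bounded_gauss_poly[of k t]
    unfolding bounded_iff by (metis (no_types, lifting) imageE)
qed

section \<open>Distributions with a given Fourier transform\<close>

text \<open>Multiplying the difference of the two representatives by a Gaussian makes it integrable,
  and testing against modulated Gaussians shows that the Fourier transform of the product vanishes.
  Since the Gaussian has no zeros, it can be divided out.\<close>

lemma represents_unique:
  assumes g: "represents g v" and h: "represents h v"
  shows "AE x in lborel. g x = h x"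
proof -
  define \<psi> where "\<psi> t = gauss_poly t 1" for t
  have \<psi>: "\<psi> t \<in> schwartz" for t by (simp add: \<psi>_def gauss_poly_schwartz)
  have i: "integrable lborel (\<lambda>x. g x * \<psi> t x)" "integrable lborel (\<lambda>x. h x * \<psi> t x)" for t
    using g h \<psi> by (auto simp: represents_def)
  have e: "(LBINT x. g x * \<psi> t x) = (LBINT x. h x * \<psi> t x)" for t
    using g h \<psi>[of t] by (metis represents_def)
  have shift: "exp (- \<i> * of_real (x * \<xi>)) * \<psi> 0 x = \<psi> (- \<xi>) x" for x \<xi>
    by (simp add: \<psi>_def gauss_poly_def exp_add[symmetric] algebra_simps)
  have "fourier (\<lambda>x. (g x - h x) * \<psi> 0 x) \<xi> = 0" for \<xi>
  proof -
    have "fourier (\<lambda>x. (g x - h x) * \<psi> 0 x) \<xi> = (LBINT x. g x * \<psi> (- \<xi>) x - h x * \<psi> (- \<xi>) x)"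
      unfolding fourier_def shift[symmetric] by (simp add: algebra_simps)
    then show ?thesis using i[of "- \<xi>"] e by simp
  qed
  moreover have "integrable lborel (\<lambda>x. (g x - h x) * \<psi> 0 x)"
    using i[of 0] by (simp add: left_diff_distrib)
  ultimately have "AE x in lborel. (g x - h x) * \<psi> 0 x = 0"
    by (intro fourier_eq_0)
  then show ?thesis by eventually_elim (simp add: \<psi>_def gauss_poly_def)
qed

text \<open>The distribution whose Fourier transform is the function \<open>g\<close>.\<close>

definition dist_of :: "(real \<Rightarrow> complex) \<Rightarrow> dist" where
  "dist_of g = (\<lambda>\<psi>. LBINT \<xi>. g \<xi> * inverse_fourier \<psi> \<xi>)"

text \<open>A \<open>dist\<close> is a functional on all functions, so equalities such as
  \<open>dist_of_diff\<close> must hold at every argument, Schwartz or not. The default value 0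
  makes the inverse transform bounded and continuous in every case.\<close>

lemma inverse_fourier_not_integrable:
  assumes "\<not> integrable lborel f"
  shows "inverse_fourier f = (\<lambda>x. 0)"
proof -
  have "(\<lambda>y. iexp (x * y) * f y) = (\<lambda>y. exp (- \<i> * of_real (y * (- x))) * f y)" for x
    by (simp add: mult.commute)
  moreover have "\<not> integrable lborel (\<lambda>y. exp (- \<i> * of_real (y * (- x))) * f y)" for x
  proof
    assume "integrable lborel (\<lambda>y. exp (- \<i> * of_real (y * (- x))) * f y)"
    from fourier_integrand_integrable[OF this, of x] have "integrable lborel f"
      by (simp add: mult.assoc[symmetric] exp_add[symmetric])
    with assms show False by simp
  qed
  ultimately show ?thesis
    unfolding inverse_fourier_def by (simp add: not_integrable_integral_eq)
qed

lemma norm_inverse_fourier_le: "norm (inverse_fourier f x) \<le> (LBINT y. norm (f y)) / (2 * pi)"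
proof (cases "integrable lborel f")
  case True
  then have "norm (fourier f (- x)) \<le> (LBINT y. norm (f y))"
    by (intro norm_fourier_le) auto
  then show ?thesis by (simp add: inverse_fourier_eq norm_mult norm_divide divide_right_mono)
qed (simp add: inverse_fourier_not_integrable)

lemma continuous_on_inverse_fourier: "continuous_on UNIV (inverse_fourier f)"
proof (cases "integrable lborel f")
  case True
  then show ?thesis
    unfolding inverse_fourier_eq[abs_def]
    by (intro continuous_intros continuous_on_compose2[OF continuous_on_fourier_UNIV]) auto
qed (simp add: inverse_fourier_not_integrable)

lemma borel_measurable_inverse_fourier: "inverse_fourier f \<in> borel_measurable borel"
  by (intro borel_measurable_continuous_onI continuous_on_inverse_fourier)

lemma dist_of_integrable:
  assumes "decaying C g"
  shows "integrable lborel (\<lambda>\<xi>. g \<xi> * inverse_fourier \<psi> \<xi>)"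
proof (rule integrable_complex_bound)
  let ?M = "(LBINT y. norm (\<psi> y)) / (2 * pi)"
  show "integrable lborel (\<lambda>\<xi>. C * wt \<xi> * ?M)"
    using integrable_wt by (intro integrable_mult_left integrable_mult_right)
  show "norm (g \<xi> * inverse_fourier \<psi> \<xi>) \<le> C * wt \<xi> * ?M" for \<xi>
    unfolding norm_mult using decayingD(2)[OF assms]
    by (intro mult_mono norm_inverse_fourier_le) (auto intro: order_trans[OF norm_ge_zero])
  have [measurable]: "g \<in> borel_measurable borel" using decaying_measurable[OF assms] .
  note borel_measurable_inverse_fourier[measurable]
  show "(\<lambda>\<xi>. g \<xi> * inverse_fourier \<psi> \<xi>) \<in> borel_measurable borel" by measurable
qed

lemma dist_of_diff:
  assumes "decaying A f" "decaying B g"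
  shows "dist_of f - dist_of g = dist_of (\<lambda>x. f x - g x)"
  using dist_of_integrable[OF assms(1)] dist_of_integrable[OF assms(2)]
  by (simp add: dist_of_def fun_eq_iff left_diff_distrib)

lemma dist_of_zero: "dist_of (\<lambda>x. 0) = (\<lambda>\<psi>. 0)"
  by (simp add: dist_of_def)

lemma represents_fourier_dist:
  assumes "decaying C g"
  shows "represents g (fourier_dist (dist_of g))"
  unfolding represents_def
proof (intro conjI ballI)
  show "g \<in> borel_measurable borel" using assms by (rule decaying_measurable)
  fix \<psi> assume s: "\<psi> \<in> schwartz"
  have eq: "(\<lambda>\<xi>. g \<xi> * inverse_fourier (fourier \<psi>) \<xi>) = (\<lambda>\<xi>. g \<xi> * \<psi> \<xi>)"
    using s by (simp add: inverse_fourier_fourier_schwartz)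
  show "integrable lborel (\<lambda>x. g x * \<psi> x)"
    using dist_of_integrable[OF assms, of "fourier \<psi>"] eq by simp
  show "fourier_dist (dist_of g) \<psi> = (LBINT x. g x * \<psi> x)"
    unfolding fourier_dist_def dist_of_def eq ..
qed

lemma represents_dist_of:
  assumes "decaying C g"
  shows "represents (inverse_fourier g) (dist_of g)"
  unfolding represents_def
proof (intro conjI ballI)
  show "inverse_fourier g \<in> borel_measurable borel" by (rule borel_measurable_inverse_fourier)
  fix \<psi> assume s: "\<psi> \<in> schwartz"
  show "integrable lborel (\<lambda>x. inverse_fourier g x * \<psi> x)"
    using dist_of_integrable[OF schwartz_decaying[OF s], of g] by (simp add: mult.commute)
  show "dist_of g \<psi> = (LBINT x. inverse_fourier g x * \<psi> x)"
    unfolding dist_of_def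
    using inverse_fourier_multiplication_formula[OF decaying_integrable[OF assms] schwartz_integrable[OF s]] by simp
qed

text \<open>\<open>fourier_fun\<close> chooses an arbitrary representative; uniqueness pins it down
  up to a null set, which is all that the Sobolev norm and the multipliers can see.\<close>

lemma fourier_fun_dist_of:
  assumes "decaying C g"
  shows "fourier_fun (dist_of g) \<in> borel_measurable borel"
    and "AE \<xi> in lborel. fourier_fun (dist_of g) \<xi> = g \<xi>"
proof -
  have "represents (fourier_fun (dist_of g)) (fourier_dist (dist_of g))"
    unfolding fourier_fun_def using represents_fourier_dist[OF assms]
    by (rule someI[where P = "\<lambda>f. represents f (fourier_dist (dist_of g))"])
  then show "fourier_fun (dist_of g) \<in> borel_measurable borel"
    and "AE \<xi> in lborel. fourier_fun (dist_of g) \<xi> = g \<xi>"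
    using represents_unique[OF _ represents_fourier_dist[OF assms]] by (auto simp: represents_def)
qed

lemma inverse_fourier_add:
  "integrable lborel f \<Longrightarrow> integrable lborel g \<Longrightarrow>
    inverse_fourier (\<lambda>x. f x + g x) \<xi> = inverse_fourier f \<xi> + inverse_fourier g \<xi>"
  by (simp add: inverse_fourier_eq fourier_add distrib_left)

lemma inverse_fourier_mult: "inverse_fourier (\<lambda>x. c * f x) \<xi> = c * inverse_fourier f \<xi>"
  by (simp add: inverse_fourier_eq fourier_mult)

lemma dist_of_tempered:
  assumes "decaying C g"
  shows "dist_of g \<in> tempered"
  unfolding tempered_def mem_Collect_eq
proof (intro conjI ballI allI)
  show "dist_of g (\<lambda>x. \<psi> x + \<eta> x) = dist_of g \<psi> + dist_of g \<eta>" if "\<psi> \<in> schwartz" "\<eta> \<in> schwartz" for \<psi> \<eta>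
    using that dist_of_integrable[OF assms]
    by (simp add: dist_of_def inverse_fourier_add schwartz_integrable distrib_left)
  show "dist_of g (\<lambda>x. c * \<psi> x) = c * dist_of g \<psi>" if "\<psi> \<in> schwartz" for \<psi> c
    by (simp add: dist_of_def inverse_fourier_mult mult.left_commute)
  have "norm (dist_of g \<psi>) \<le> C * pi * (\<Sum>k\<le>2. \<Sum>n\<le>2. schwartz_seminorm k n \<psi>)" if s: "\<psi> \<in> schwartz" for \<psi>
  proof -
    let ?S = "\<Sum>k\<le>2. \<Sum>n\<le>2. schwartz_seminorm k n \<psi>"
    let ?N = "schwartz_seminorm 0 0 \<psi> + schwartz_seminorm 2 0 \<psi>"
    have nn: "0 \<le> schwartz_seminorm k n \<psi>" for k n
      using schwartz_seminorm_upper[OF s, of 0 k n] norm_ge_zero order_trans by blast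
    have NS: "?N \<le> ?S"
      by (simp add: numeral_2_eq_2 nn)
    have "(LBINT y. norm (\<psi> y)) \<le> (LBINT y. ?N * wt y)"
      using schwartz_integrable[OF s] integrable_wt schwartz_decay[OF s] by (intro integral_mono) auto
    also have "\<dots> = ?N * pi" by (simp add: integral_wt)
    also have "\<dots> \<le> ?S * pi" using NS by simp
    also have "\<dots> \<le> ?S * (2 * pi)" using order_trans[OF decaying_nonneg[OF schwartz_decaying[OF s]] NS] by (intro mult_left_mono) auto
    finally have b: "(LBINT y. norm (\<psi> y)) / (2 * pi) \<le> ?S"
      by (simp add: divide_le_eq)
    have "norm (g \<xi> * inverse_fourier \<psi> \<xi>) \<le> C * wt \<xi> * ?S" for \<xi>
      unfolding norm_mult using decayingD(2)[OF assms] order_trans[OF norm_inverse_fourier_le b]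
      by (intro mult_mono) (auto intro: order_trans[OF norm_ge_zero])
    then have "norm (dist_of g \<psi>) \<le> (LBINT \<xi>. C * wt \<xi> * ?S)"
      unfolding dist_of_def using integrable_wt by (intro norm_integral_complex_bound) auto
    then show ?thesis by (simp add: integral_wt)
  qed
  then show "\<exists>C N. \<forall>\<psi>\<in>schwartz. norm (dist_of g \<psi>) \<le> C * (\<Sum>k\<le>N. \<Sum>n\<le>N. schwartz_seminorm k n \<psi>)"
    by blast
qed

lemma fourier_multiplier_dist_of:
  assumes "decaying C g" and [measurable]: "m \<in> borel_measurable borel"
  shows "fourier_multiplier m (dist_of g) = dist_of (\<lambda>\<xi>. m \<xi> * g \<xi>)"
proof
  fix \<psi>
  note [measurable] = fourier_fun_dist_of(1)[OF assms(1)] decaying_measurable[OF assms(1)]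
    borel_measurable_inverse_fourier[of \<psi>]
  show "fourier_multiplier m (dist_of g) \<psi> = dist_of (\<lambda>\<xi>. m \<xi> * g \<xi>) \<psi>"
    unfolding fourier_multiplier_def dist_of_def[of "\<lambda>\<xi>. m \<xi> * g \<xi>"]
    by (rule integral_cong_AE) (use fourier_fun_dist_of(2)[OF assms(1)] in auto)
qed

text \<open>The square of \<open>g\<close> is bounded by two powers of \<open>wt\<close>; for s
  \<le> 1 the Sobolev weight consumes at most one of them, and the other is integrable.\<close>

lemma sobolev_weight_bound:
  assumes "decaying C g" "s \<le> 1"
  shows "(1 + \<bar>\<xi>\<bar>\<^sup>2) powr s * (norm (g \<xi>))\<^sup>2 \<le> C\<^sup>2 * wt \<xi>"
proof -
  have p: "1 \<le> 1 + \<bar>\<xi>\<bar>\<^sup>2" by simp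
  have "(1 + \<bar>\<xi>\<bar>\<^sup>2) powr s \<le> (1 + \<bar>\<xi>\<bar>\<^sup>2) powr 1" using assms(2) p by (intro powr_mono) auto
  moreover have "(norm (g \<xi>))\<^sup>2 \<le> (C * wt \<xi>)\<^sup>2"
    using decayingD(2)[OF assms(1)] by (intro power_mono) auto
  ultimately have "(1 + \<bar>\<xi>\<bar>\<^sup>2) powr s * (norm (g \<xi>))\<^sup>2 \<le> (1 + \<bar>\<xi>\<bar>\<^sup>2) powr 1 * (C * wt \<xi>)\<^sup>2"
    by (intro mult_mono) auto
  also have "\<dots> = C\<^sup>2 * wt \<xi> * ((1 + \<xi>\<^sup>2) * wt \<xi>)"
    using p by (simp add: power2_eq_square mult_ac)
  finally show ?thesis by (simp add: wt_cancel)
qed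

lemma sobolev_integrand_eq:
  "(norm ((1 + \<bar>\<xi>\<bar>\<^sup>2) powr (s / 2) *\<^sub>R z))\<^sup>2 = (1 + \<bar>\<xi>\<bar>\<^sup>2) powr s * (norm z)\<^sup>2"
proof -
  have "((1 + \<bar>\<xi>\<bar>\<^sup>2) powr (s / 2))\<^sup>2 = (1 + \<bar>\<xi>\<bar>\<^sup>2) powr s"
    unfolding power2_eq_square powr_add[symmetric] by simp
  then show ?thesis by (simp add: power_mult_distrib)
qed

lemma sobolev_integrable:
  assumes "decaying C g" "s \<le> 1"
  shows "integrable lborel (\<lambda>\<xi>. (1 + \<bar>\<xi>\<bar>\<^sup>2) powr s * (norm (g \<xi>))\<^sup>2)"
proof (rule Bochner_Integration.integrable_bound)
  show "integrable lborel (\<lambda>\<xi>. C\<^sup>2 * wt \<xi>)" using integrable_wt by simp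
  have [measurable]: "g \<in> borel_measurable borel" using decaying_measurable[OF assms(1)] .
  show "(\<lambda>\<xi>. (1 + \<bar>\<xi>\<bar>\<^sup>2) powr s * (norm (g \<xi>))\<^sup>2) \<in> borel_measurable lborel" by simp
qed (use sobolev_weight_bound[OF assms] in auto)

lemma sobolev_dist_of:
  assumes "decaying C g" "s \<le> 1"
  shows "dist_of g \<in> sobolev s"
    and "sobolev_norm s (dist_of g) = sqrt (LBINT \<xi>. (1 + \<bar>\<xi>\<bar>\<^sup>2) powr s * (norm (g \<xi>))\<^sup>2)"
proof -
  note [measurable] = fourier_fun_dist_of(1)[OF assms(1)] decaying_measurable[OF assms(1)]
  have ae: "AE \<xi> in lborel. (1 + \<bar>\<xi>\<bar>\<^sup>2) powr s * (norm (g \<xi>))\<^sup>2 = (1 + \<bar>\<xi>\<bar>\<^sup>2) powr s * (norm (fourier_fun (dist_of g) \<xi>))\<^sup>2"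
    using fourier_fun_dist_of(2)[OF assms(1)] by eventually_elim simp
  have "integrable lborel (\<lambda>\<xi>. (1 + \<bar>\<xi>\<bar>\<^sup>2) powr s * (norm (fourier_fun (dist_of g) \<xi>))\<^sup>2)"
    by (rule integrable_cong_AE_imp[OF sobolev_integrable[OF assms] _ ae]) simp
  then show "dist_of g \<in> sobolev s"
    unfolding sobolev_def sobolev_integrand_eq
    using dist_of_tempered[OF assms(1)] represents_fourier_dist[OF assms(1)] by blast
  show "sobolev_norm s (dist_of g) = sqrt (LBINT \<xi>. (1 + \<bar>\<xi>\<bar>\<^sup>2) powr s * (norm (g \<xi>))\<^sup>2)"
    unfolding sobolev_norm_def sobolev_integrand_eq
    by (rule arg_cong[where f = sqrt], rule integral_cong_AE) (use ae in auto)
qed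

section \<open>Convolution and the cubic term\<close>

text \<open>Time runs over the whole real line, so that joint continuity is a statement on
  \<open>UNIV\<close>. Functions of interest on [0, T] are extended by clamping the time.\<close>

definition unif_decaying :: "real \<Rightarrow> (real \<Rightarrow> real \<Rightarrow> complex) \<Rightarrow> bool" where
  "unif_decaying C f \<longleftrightarrow> continuous_on UNIV (\<lambda>(t, x). f t x) \<and> (\<forall>t x. norm (f t x) \<le> C * wt x)"

lemma continuous_on_pair_compose:
  fixes f :: "real \<Rightarrow> real \<Rightarrow> complex"
  assumes "continuous_on UNIV (\<lambda>(t, x). f t x)" "continuous_on S a" "continuous_on S b"
  shows "continuous_on S (\<lambda>z. f (a z) (b z))"
  using continuous_on_compose2[OF assms(1) continuous_on_Pair[OF assms(2,3)]] by simp

lemma unif_decaying_continuous: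
  "unif_decaying C f \<Longrightarrow> continuous_on S a \<Longrightarrow> continuous_on S b \<Longrightarrow> continuous_on S (\<lambda>z. f (a z) (b z))"
  by (rule continuous_on_pair_compose) (auto simp: unif_decaying_def)

lemma unif_decayingD: "unif_decaying C f \<Longrightarrow> decaying C (f t)"
  by (auto simp: decaying_def unif_decaying_def intro!: continuous_on_pair_compose continuous_intros)

lemma unif_decaying_const: "decaying C f \<Longrightarrow> unif_decaying C (\<lambda>t. f)"
  by (auto simp: decaying_def unif_decaying_def case_prod_beta intro!: continuous_on_compose2[of UNIV f] continuous_intros)

lemma unif_decaying_mult:
  assumes "unif_decaying A f" "continuous_on UNIV (\<lambda>(t, x). m t x)" "\<And>t x. norm (m t x) \<le> M"
  shows "unif_decaying (M * A) (\<lambda>t x. m t x * f t x)"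
  using assms unfolding unif_decaying_def
  by (auto intro!: continuous_intros mult_mono simp: norm_mult mult.assoc case_prod_beta intro: order_trans[OF norm_ge_zero])

lemma norm_conv_le:
  assumes "\<And>x. norm (f x) \<le> A * wt x" "\<And>x. norm (g x) \<le> B * wt x"
  shows "norm (conv f g x) \<le> 4 * pi * A * B * wt x"
proof -
  have A: "0 \<le> A" "0 \<le> B"
    using order_trans[OF norm_ge_zero assms(1)[of 0]] order_trans[OF norm_ge_zero assms(2)[of 0]] by (simp_all add: wt_def)
  have "norm (f a * g (x - a)) \<le> A * B * (2 * wt x) * (wt a + wt (x - a))" for a
  proof -
    have "norm (f a * g (x - a)) \<le> (A * wt a) * (B * wt (x - a))"
      unfolding norm_mult using A by (intro mult_mono assms) auto
    also have "\<dots> = A * B * (wt a * wt (x - a))" by simp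
    also have "\<dots> \<le> A * B * (2 * wt x * (wt a + wt (x - a)))"
      using A by (intro mult_left_mono wt_mult_le) auto
    finally show ?thesis by (simp add: mult.assoc)
  qed
  then have "norm (conv f g x) \<le> (LBINT a. A * B * (2 * wt x) * (wt a + wt (x - a)))"
    unfolding conv_def using integrable_wt integrable_wt_shift by (intro norm_integral_complex_bound) auto
  also have "\<dots> = A * B * (2 * wt x) * (pi + pi)"
    using integrable_wt integrable_wt_shift by (simp add: integral_wt integral_wt_shift)
  finally show ?thesis by (simp add: mult_ac)
qed

lemma unif_decaying_conv:
  assumes f: "unif_decaying A f" and g: "unif_decaying B g"
  shows "unif_decaying (4 * pi * A * B) (\<lambda>t. conv (f t) (g t))"
  unfolding unif_decaying_def
proof (intro conjI allI)
  show "norm (conv (f t) (g t) x) \<le> 4 * pi * A * B * wt x" for t x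
    by (rule norm_conv_le) (use f g in \<open>auto simp: unif_decaying_def\<close>)
  have "continuous_on UNIV (\<lambda>z. LBINT a. f (fst z) a * g (fst z) (snd z - a))"
  proof (rule continuous_on_lborel_integral)
    show "(\<lambda>a. f (fst z) a * g (fst z) (snd z - a)) \<in> borel_measurable borel" for z
      by (intro borel_measurable_continuous_onI continuous_intros unif_decaying_continuous[OF f] unif_decaying_continuous[OF g])
    have "continuous_on UNIV (\<lambda>z. f (fst z) a * g (fst z) (snd z - a))" for a
      by (intro continuous_intros unif_decaying_continuous[OF f] unif_decaying_continuous[OF g])
    then show "AE a in lborel. isCont (\<lambda>z. f (fst z) a * g (fst z) (snd z - a)) z" for z
      by (simp add: continuous_on_eq_continuous_at del: split_paired_All)
    show "integrable lborel (\<lambda>a. A * wt a * B)" using integrable_wt by simp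
    show "norm (f (fst z) a * g (fst z) (snd z - a)) \<le> A * wt a * B" for z a
      unfolding norm_mult
      by (intro mult_mono decayingD(2) unif_decayingD decaying_bounded[OF unif_decayingD] f g)
        (use decaying_nonneg[OF unif_decayingD[OF f]] in auto)
  qed
  then show "continuous_on UNIV (\<lambda>(t, x). conv (f t) (g t) x)"
    by (simp add: conv_def case_prod_beta)
qed

lemma conv_integrable:
  "decaying A f \<Longrightarrow> decaying B g \<Longrightarrow> integrable lborel (\<lambda>a. f a * g (x - a))"
proof (rule integrable_complex_bound)
  assume f: "decaying A f" and g: "decaying B g"
  show "integrable lborel (\<lambda>a. A * wt a * B)" using integrable_wt by simp
  show "norm (f a * g (x - a)) \<le> A * wt a * B" for a
    unfolding norm_mult
    by (intro mult_mono decayingD(2)[OF f] decaying_bounded[OF g]) (use decaying_nonneg[OF f] in auto)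
  show "(\<lambda>a. f a * g (x - a)) \<in> borel_measurable borel"
    by (intro borel_measurable_continuous_onI continuous_intros decayingD(1)[OF f] continuous_on_compose2[OF decayingD(1)[OF g]]) auto
qed

lemma decaying_conv: "decaying A f \<Longrightarrow> decaying B g \<Longrightarrow> decaying (4 * pi * A * B) (conv f g)"
  using unif_decayingD[OF unif_decaying_conv[OF unif_decaying_const unif_decaying_const]] .

lemma norm_conv_diff_le:
  assumes "decaying A f" "decaying A f'" "decaying B g" "decaying B g'"
    and "\<And>x. norm (f x - f' x) \<le> d * wt x" "\<And>x. norm (g x - g' x) \<le> e * wt x"
  shows "norm (conv f g x - conv f' g' x) \<le> 4 * pi * (d * B + A * e) * wt x"
proof -
  have i: "integrable lborel (\<lambda>a. (f a - f' a) * g (x - a))" "integrable lborel (\<lambda>a. f' a * (g (x - a) - g' (x - a)))"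
    using conv_integrable[OF assms(1,3), of x] conv_integrable[OF assms(2,3), of x] conv_integrable[OF assms(2,4), of x]
    by (auto simp: left_diff_distrib right_diff_distrib)
  have "conv f g x - conv f' g' x = (LBINT a. f a * g (x - a) - f' a * g' (x - a))"
    unfolding conv_def using conv_integrable assms by (subst Bochner_Integration.integral_diff) auto
  also have "\<dots> = (LBINT a. (f a - f' a) * g (x - a) + f' a * (g (x - a) - g' (x - a)))"
    by (simp add: algebra_simps)
  also have "\<dots> = conv (\<lambda>a. f a - f' a) g x + conv f' (\<lambda>a. g a - g' a) x"
    unfolding conv_def using i by (rule Bochner_Integration.integral_add)
  finally have "norm (conv f g x - conv f' g' x) \<le> norm (conv (\<lambda>a. f a - f' a) g x) + norm (conv f' (\<lambda>a. g a - g' a) x)"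
    by (simp add: norm_triangle_ineq)
  also have "\<dots> \<le> 4 * pi * d * B * wt x + 4 * pi * A * e * wt x"
    using assms by (intro add_mono norm_conv_le) (auto intro: decayingD)
  finally show ?thesis by (simp add: algebra_simps)
qed

text \<open>The Fourier transform of the cubic term \<open>\<bar>u\<bar>\<^sup>2 u\<close> is, up to a constant, \<open>cubic_conv\<close> of the
  Fourier transform of \<open>u\<close>.\<close>

definition cubic_conv :: "(real \<Rightarrow> complex) \<Rightarrow> real \<Rightarrow> complex" where
  "cubic_conv f = conv (conv f (\<lambda>x. cnj (f (- x)))) f"

lemma unif_decaying_cubic_conv:
  assumes "unif_decaying A f"
  shows "unif_decaying (16 * pi\<^sup>2 * A ^ 3) (\<lambda>t. cubic_conv (f t))"
proof -
  have "unif_decaying A (\<lambda>t x. cnj (f t (- x)))"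
    using assms decaying_reflect_cnj[OF unif_decayingD[OF assms]]
    by (auto simp: unif_decaying_def decaying_def case_prod_beta intro!: continuous_intros unif_decaying_continuous[OF assms])
  from unif_decaying_conv[OF unif_decaying_conv[OF assms this] assms] show ?thesis
    by (simp add: cubic_conv_def power2_eq_square power3_eq_cube mult_ac)
qed

lemma decaying_cubic_conv: "decaying A f \<Longrightarrow> decaying (16 * pi\<^sup>2 * A ^ 3) (cubic_conv f)"
  using unif_decayingD[OF unif_decaying_cubic_conv[OF unif_decaying_const]] .

text \<open>The three factors are replaced one at a time; 48 = 3 * 16, one contribution of the size
  in \<open>decaying_cubic_conv\<close> for each factor.\<close>

lemma norm_cubic_conv_diff_le:
  assumes f: "decaying A f" and g: "decaying A g" and d: "\<And>x. norm (f x - g x) \<le> d * wt x"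
  shows "norm (cubic_conv f x - cubic_conv g x) \<le> 48 * pi\<^sup>2 * A\<^sup>2 * d * wt x"
proof -
  have r: "norm (cnj (f (- x)) - cnj (g (- x))) \<le> d * wt x" for x
    using d[of "- x"] by (simp flip: complex_cnj_diff)
  have 1: "norm (conv f (\<lambda>x. cnj (f (- x))) x - conv g (\<lambda>x. cnj (g (- x))) x) \<le> 8 * pi * A * d * wt x" for x
    using norm_conv_diff_le[OF f g decaying_reflect_cnj[OF f] decaying_reflect_cnj[OF g] d r, of x]
    by (simp add: mult_ac)
  show ?thesis
    using norm_conv_diff_le[OF decaying_conv[OF f decaying_reflect_cnj[OF f]] decaying_conv[OF g decaying_reflect_cnj[OF g]] f g 1 d, of x]
    by (simp add: cubic_conv_def power2_eq_square algebra_simps)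
qed

lemma inverse_fourier_conv:
  "integrable lborel f \<Longrightarrow> integrable lborel g \<Longrightarrow>
    inverse_fourier (conv f g) x = 2 * pi * inverse_fourier f x * inverse_fourier g x"
  by (simp add: inverse_fourier_eq fourier_conv)

lemma inverse_fourier_reflect_cnj: "inverse_fourier (\<lambda>x. cnj (f (- x))) x = cnj (inverse_fourier f x)"
  using fourier_cnj[of "\<lambda>x. f (- x)" "- x"] by (simp add: inverse_fourier_eq fourier_reflect)

text \<open>The reflected conjugate of \<open>f\<close> becomes the conjugate of its inverse
  transform, and each of the two convolutions contributes a factor 2 pi.\<close>

lemma inverse_fourier_cubic_conv:
  assumes f: "decaying A f"
  shows "inverse_fourier (cubic_conv f) x = of_real (4 * pi\<^sup>2) * (of_real ((norm (inverse_fourier f x))\<^sup>2) * inverse_fourier f x)"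
proof -
  note i = decaying_integrable[OF f] decaying_integrable[OF decaying_reflect_cnj[OF f]]
    decaying_integrable[OF decaying_conv[OF f decaying_reflect_cnj[OF f]]]
  show ?thesis
    unfolding cubic_conv_def inverse_fourier_conv[OF i(3,1)] inverse_fourier_conv[OF i(1,2)] inverse_fourier_reflect_cnj
    by (simp only: complex_norm_square) (simp add: power2_eq_square mult_ac)
qed

section \<open>From the pointwise equation in frequency to a solution in the sense of
  distributions\<close>

lemma integrable_strip:
  assumes K: "unif_decaying C K"
  shows "integrable (lborel \<Otimes>\<^sub>M lborel) (\<lambda>(t, x). indicator {a..b} t *\<^sub>R K t x)"
proof (rule Bochner_Integration.integrable_bound)
  show "integrable (lborel \<Otimes>\<^sub>M lborel) (\<lambda>(t, x). (of_real (indicator {a..b} t) :: complex) * of_real (C * wt x))"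
    using integrable_wt by (intro integrable_tensor integrable_of_real integrable_mult_right) (auto simp: integrable_indicator_iff emeasure_lborel_Icc_eq)
  have "(\<lambda>(t, x). K t x) \<in> borel_measurable (borel \<Otimes>\<^sub>M borel)"
    unfolding borel_prod using K by (intro borel_measurable_continuous_onI) (simp add: unif_decaying_def)
  then have "(\<lambda>(t, x). indicator {a..b} t *\<^sub>R K t x) \<in> borel_measurable (borel \<Otimes>\<^sub>M borel)"
    by (simp add: case_prod_beta)
  then show "(\<lambda>(t, x). indicator {a..b} t *\<^sub>R K t x) \<in> borel_measurable (lborel \<Otimes>\<^sub>M lborel)"
    by (simp cong: measurable_cong_sets)
  have "0 \<le> C" "norm (K t x) \<le> C * wt x" for t x
    using decaying_nonneg[OF unif_decayingD[OF K]] K by (auto simp: unif_decaying_def)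
  then show "AE z in lborel \<Otimes>\<^sub>M lborel. norm (case z of (t, x) \<Rightarrow> indicator {a..b} t *\<^sub>R K t x)
      \<le> norm (case z of (t, x) \<Rightarrow> (of_real (indicator {a..b} t) :: complex) * of_real (C * wt x))"
    by (intro always_eventually allI) (auto simp: norm_mult indicator_def)
qed

lemma
  assumes "unif_decaying C K"
  shows set_integrable_strip: "set_integrable lborel {a..b} (\<lambda>t. LBINT x. K t x)"
    and integral_strip_swap: "(LBINT t:{a..b}. LBINT x. K t x) = (LBINT x. (LBINT t:{a..b}. K t x))"
proof -
  note i = integrable_strip[OF assms, of a b]
  show "set_integrable lborel {a..b} (\<lambda>t. LBINT x. K t x)"
    using lborel_pair.integrable_fst'[OF i] by (simp add: set_integrable_def)
  show "(LBINT t:{a..b}. LBINT x. K t x) = (LBINT x. (LBINT t:{a..b}. K t x))"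
    using lborel_pair.Fubini_integral[OF i] by (simp add: set_lebesgue_integral_def)
qed

lemma continuous_on_phase:
  assumes "0 < \<alpha>" "continuous_on S a" "continuous_on S b"
  shows "continuous_on S (\<lambda>z. iexp (a z * \<bar>b z\<bar> powr \<alpha>))"
  using assms by (intro continuous_intros continuous_on_powr') auto

lemma continuous_on_sobolev_norm:
  assumes g: "unif_decaying C g" and h: "decaying D h" and s: "s \<le> 1"
  shows "continuous_on UNIV (\<lambda>t. sobolev_norm s (dist_of (\<lambda>x. g t x - h x)))"
proof -
  have d: "decaying (C + D) (\<lambda>x. g t x - h x)" for t
    by (intro decaying_diff unif_decayingD[OF g] h)
  have "continuous_on UNIV (\<lambda>t. LBINT \<xi>. (1 + \<bar>\<xi>\<bar>\<^sup>2) powr s * (norm (g t \<xi> - h \<xi>))\<^sup>2)"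
  proof (rule continuous_on_lborel_integral)
    have [measurable]: "g t \<in> borel_measurable borel" "h \<in> borel_measurable borel" for t
      using decaying_measurable[OF unif_decayingD[OF g]] decaying_measurable[OF h] by auto
    show "(\<lambda>\<xi>. (1 + \<bar>\<xi>\<bar>\<^sup>2) powr s * (norm (g t \<xi> - h \<xi>))\<^sup>2) \<in> borel_measurable borel" for t by measurable
    have "continuous_on UNIV (\<lambda>t. (1 + \<bar>\<xi>\<bar>\<^sup>2) powr s * (norm (g t \<xi> - h \<xi>))\<^sup>2)" for \<xi>
      by (intro continuous_intros unif_decaying_continuous[OF g])
    then show "AE \<xi> in lborel. isCont (\<lambda>t. (1 + \<bar>\<xi>\<bar>\<^sup>2) powr s * (norm (g t \<xi> - h \<xi>))\<^sup>2) t" for t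
      by (simp add: continuous_on_eq_continuous_at)
    show "integrable lborel (\<lambda>\<xi>. (C + D)\<^sup>2 * wt \<xi>)" using integrable_wt by simp
    show "norm ((1 + \<bar>\<xi>\<bar>\<^sup>2) powr s * (norm (g t \<xi> - h \<xi>))\<^sup>2) \<le> (C + D)\<^sup>2 * wt \<xi>" for t \<xi>
      using sobolev_weight_bound[OF d s, of \<xi> t] by simp
  qed
  then show ?thesis
    using sobolev_dist_of(2)[OF d s] by (simp add: continuous_on_real_sqrt)
qed

lemma sobolev_norm_zero: "s \<le> 1 \<Longrightarrow> sobolev_norm s (dist_of (\<lambda>x. 0)) = 0"
  using sobolev_dist_of(2)[of 0 "\<lambda>x. 0" s] by (simp add: decaying_def)

text \<open>The hypothesis is the Duhamel equation at each single frequency. Pairing it with the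
  inverse transform of a test function and exchanging the time and frequency integrals gives the
  weak form; the factor 1 / (4 pi^2) turns \<open>cubic_conv\<close> into the transform of the cubic
  term.\<close>

lemma duhamel_solutionI:
  assumes \<alpha>: "0 < \<alpha>" and s: "s \<le> 1" and T: "0 \<le> T" and g: "unif_decaying A g"
    and eq: "\<And>t \<xi>. t \<in> {0..T} \<Longrightarrow> g t \<xi> = iexp (t * \<bar>\<xi>\<bar> powr \<alpha>) * g 0 \<xi>
      - \<i> * of_real \<gamma> * (LBINT t':{0..t}. iexp ((t - t') * \<bar>\<xi>\<bar> powr \<alpha>) *
          (of_real (1 / (4 * pi\<^sup>2)) * cubic_conv (g t') \<xi>))"
  shows "duhamel_solution \<alpha> \<gamma> s T (dist_of (g 0)) (\<lambda>t. dist_of (g t))"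
proof -
  define k where "k t \<xi> = of_real (1 / (4 * pi\<^sup>2)) * cubic_conv (g t) \<xi>" for t \<xi>
  define e where "e t \<xi> = iexp (t * \<bar>\<xi>\<bar> powr \<alpha>)" for t \<xi>
  have e_cont: "continuous_on S (\<lambda>z. e (a z) (b z))" if "continuous_on S a" "continuous_on S b" for a b and S :: "'b::t2_space set"
    unfolding e_def using continuous_on_phase[OF \<alpha> that] .
  have e_norm: "norm (e t \<xi>) = 1" for t \<xi> by (simp add: e_def)
  have k: "unif_decaying (norm (of_real (1 / (4 * pi\<^sup>2)) :: complex) * (16 * pi\<^sup>2 * A ^ 3)) k"
    unfolding k_def[abs_def] by (intro unif_decaying_mult unif_decaying_cubic_conv g) (auto intro!: continuous_intros simp: case_prod_beta)
  then obtain K where k: "unif_decaying K k" by blast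
  have dg: "decaying A (g t)" and dk: "decaying K (k t)" for t
    using unif_decayingD g k by auto
  have pr: "propagator \<alpha> t (dist_of h) = dist_of (\<lambda>\<xi>. e t \<xi> * h \<xi>)" if "decaying D h" for t h D
    unfolding propagator_def e_def
    by (rule fourier_multiplier_dist_of[OF that]) measurable
  have cubic: "cubic_term (dist_of (g t)) (dist_of (k t))" for t
    unfolding cubic_term_def
  proof (intro exI conjI)
    show "represents (inverse_fourier (g t)) (dist_of (g t))" by (rule represents_dist_of[OF dg])
    have "inverse_fourier (k t) = (\<lambda>x. of_real ((norm (inverse_fourier (g t) x))\<^sup>2) * inverse_fourier (g t) x)"
      unfolding k_def inverse_fourier_mult inverse_fourier_cubic_conv[OF dg]
      by (auto simp: fun_eq_iff)
    then show "represents (\<lambda>x. of_real ((norm (inverse_fourier (g t) x))\<^sup>2) * inverse_fourier (g t) x) (dist_of (k t))"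
      using represents_dist_of[OF dk, of t] by simp
  qed
  have cont: "continuous_into_sobolev s T (\<lambda>t. dist_of (g t))"
    unfolding continuous_into_sobolev_def
  proof (intro conjI ballI)
    show "dist_of (g t) \<in> sobolev s" for t by (rule sobolev_dist_of[OF dg s])
    fix t\<^sub>0
    have "continuous_on UNIV (\<lambda>t. sobolev_norm s (dist_of (g t) - dist_of (g t\<^sub>0)))"
      using continuous_on_sobolev_norm[OF g dg s] by (simp add: dist_of_diff[OF dg dg])
    then have "((\<lambda>t. sobolev_norm s (dist_of (g t) - dist_of (g t\<^sub>0))) \<longlongrightarrow> sobolev_norm s (dist_of (g t\<^sub>0) - dist_of (g t\<^sub>0))) (at t\<^sub>0 within {0..T})"
      by (meson UNIV_I continuous_on_def subset_UNIV tendsto_within_subset)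
    moreover have "sobolev_norm s (dist_of (g t\<^sub>0) - dist_of (g t\<^sub>0)) = 0"
      using sobolev_norm_zero[OF s] by (simp add: dist_of_diff[OF dg dg])
    ultimately show "((\<lambda>t. sobolev_norm s (dist_of (g t) - dist_of (g t\<^sub>0))) \<longlongrightarrow> 0) (at t\<^sub>0 within {0..T})"
      by simp
  qed
  have Fint: "set_integrable lborel {0..T} (\<lambda>t. sobolev_norm s (dist_of (k t)))"
  proof -
    have "decaying 0 (\<lambda>x. 0)" by (simp add: decaying_def)
    from continuous_on_sobolev_norm[OF k this s]
    have "continuous_on {0..T} (\<lambda>t. sobolev_norm s (dist_of (k t)))"
      by (auto intro: continuous_on_subset)
    then show ?thesis by (rule borel_integrable_atLeastAtMost')
  qed
  have main: "set_integrable lborel {0..t} (\<lambda>t'. propagator \<alpha> (t - t') (dist_of (k t')) \<psi>) \<and>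
           dist_of (g t) \<psi> = propagator \<alpha> t (dist_of (g 0)) \<psi>
             - \<i> * of_real \<gamma> * (LBINT t':{0..t}. propagator \<alpha> (t - t') (dist_of (k t')) \<psi>)"
    if t: "t \<in> {0..T}" and \<psi>: "\<psi> \<in> schwartz" for t \<psi>
  proof -
    let ?p = "inverse_fourier \<psi>"
    let ?K = "\<lambda>t' \<xi>. (e (t - t') \<xi> * ?p \<xi>) * k t' \<xi>"
    have p1: "propagator \<alpha> (t - t') (dist_of (k t')) \<psi> = (LBINT \<xi>. ?K t' \<xi>)" for t'
      by (subst pr[OF dk]) (simp add: dist_of_def mult_ac)
    have "unif_decaying ((LBINT y. norm (\<psi> y)) / (2 * pi) * K) ?K"
      by (intro unif_decaying_mult k)
        (auto intro!: continuous_intros e_cont continuous_on_compose2[OF continuous_on_inverse_fourier] norm_inverse_fourier_le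
          simp: case_prod_beta norm_mult e_norm)
    then obtain C where C: "unif_decaying C ?K" by blast
    have inner: "(LBINT t':{0..t}. ?K t' \<xi>) = (LBINT t':{0..t}. e (t - t') \<xi> * k t' \<xi>) * ?p \<xi>" for \<xi>
      unfolding set_integral_mult_left[symmetric] by (simp add: mult_ac)
    have swap: "(LBINT t':{0..t}. propagator \<alpha> (t - t') (dist_of (k t')) \<psi>)
        = (LBINT \<xi>. (LBINT t':{0..t}. e (t - t') \<xi> * k t' \<xi>) * ?p \<xi>)"
      unfolding p1 integral_strip_swap[OF C] inner ..
    have i1: "integrable lborel (\<lambda>\<xi>. e t \<xi> * g 0 \<xi> * ?p \<xi>)"
      by (rule dist_of_integrable[OF decaying_mult[OF dg, of _ 1]]) (auto intro!: e_cont continuous_intros simp: e_norm)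
    have i2: "integrable lborel (\<lambda>\<xi>. (LBINT t':{0..t}. e (t - t') \<xi> * k t' \<xi>) * ?p \<xi>)"
    proof -
      have "integrable lborel (\<lambda>\<xi>. LBINT t'. indicator {0..t} t' *\<^sub>R ?K t' \<xi>)"
        using lborel_pair.integrable_snd[OF integrable_strip[OF C, of 0 t]] by simp
      moreover have "(LBINT t'. indicator {0..t} t' *\<^sub>R ?K t' \<xi>) = (LBINT t':{0..t}. e (t - t') \<xi> * k t' \<xi>) * ?p \<xi>" for \<xi>
        using inner[of \<xi>] by (simp add: set_lebesgue_integral_def)
      ultimately show ?thesis by simp
    qed
    have "dist_of (g t) \<psi> = (LBINT \<xi>. e t \<xi> * g 0 \<xi> * ?p \<xi>
       - \<i> * of_real \<gamma> * ((LBINT t':{0..t}. e (t - t') \<xi> * k t' \<xi>) * ?p \<xi>))"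
      unfolding dist_of_def using eq[OF t] by (simp add: e_def k_def left_diff_distrib mult.assoc)
    also have "\<dots> = (LBINT \<xi>. e t \<xi> * g 0 \<xi> * ?p \<xi>)
       - \<i> * of_real \<gamma> * (LBINT \<xi>. (LBINT t':{0..t}. e (t - t') \<xi> * k t' \<xi>) * ?p \<xi>)"
      using i1 i2 by (subst Bochner_Integration.integral_diff) auto
    finally have "dist_of (g t) \<psi> = propagator \<alpha> t (dist_of (g 0)) \<psi>
             - \<i> * of_real \<gamma> * (LBINT t':{0..t}. propagator \<alpha> (t - t') (dist_of (k t')) \<psi>)"
      unfolding swap pr[OF dg] by (simp add: dist_of_def)
    moreover have "set_integrable lborel {0..t} (\<lambda>t'. propagator \<alpha> (t - t') (dist_of (k t')) \<psi>)"
      unfolding p1 by (rule set_integrable_strip[OF C])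
    ultimately show ?thesis by blast
  qed
  show ?thesis
    unfolding duhamel_solution_def
  \<comment> \<open>The cubic term is again decaying in frequency, so the exponent required of it
    can be taken to be \<open>s\<close> itself.\<close>
  proof (intro conjI exI[of _ "\<lambda>t. dist_of (k t)"] exI[of _ s])
    show "AE t in lborel. t \<in> {0..T} \<longrightarrow> cubic_term (dist_of (g t)) (dist_of (k t)) \<and> dist_of (k t) \<in> sobolev s"
      using cubic sobolev_dist_of(1)[OF dk s] by simp
  qed (use sobolev_dist_of(1)[OF dg s] cont Fint main in auto)
qed

section \<open>Solving the Duhamel equation near an approximate solution\<close>

text \<open>The indicator of {0..a z} jumps as a function of \<open>z\<close> only at t = a z (or
  where the interval becomes empty), so continuity of the integrand can fail at most on the null set
  t = a z. The bound \<open>T\<close> on the end points confines the dominating function to a fixed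
  interval.\<close>

lemma continuous_on_integral_upper:
  fixes K :: "'a::metric_space \<Rightarrow> real \<Rightarrow> complex"
  assumes K: "continuous_on UNIV (\<lambda>(z, t). K z t)" and a: "continuous_on UNIV a"
    and aT: "\<And>z. a z \<le> T" and bd: "\<And>z t. norm (K z t) \<le> C"
  shows "continuous_on UNIV (\<lambda>z. LBINT t:{0..a z}. K z t)"
  unfolding set_lebesgue_integral_def
proof (rule continuous_on_lborel_integral)
  have Kt: "continuous_on UNIV (\<lambda>t. K z t)" for z
    using continuous_on_compose2[OF K, of UNIV "\<lambda>t. (z, t)"]
      continuous_on_Pair[OF continuous_on_const[of UNIV z] continuous_on_id[of UNIV]] by simp
  have Kz: "continuous_on UNIV (\<lambda>z. K z t)" for t
    using continuous_on_compose2[OF K, of UNIV "\<lambda>z. (z, t)"]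
      continuous_on_Pair[OF continuous_on_id[of UNIV] continuous_on_const[of UNIV t]] by simp
  show "(\<lambda>t. indicator {0..a z} t *\<^sub>R K z t) \<in> borel_measurable borel" for z
    using borel_measurable_continuous_onI[OF Kt[of z]] by simp
  show "AE t in lborel. isCont (\<lambda>z. indicator {0..a z} t *\<^sub>R K z t) z" for z
  proof (rule AE_mp[OF AE_lborel_singleton[of "a z"]], intro always_eventually allI impI)
    fix t assume t: "t \<noteq> a z"
    have "isCont a z" using a by (simp add: continuous_on_eq_continuous_at)
    then have lim: "(a \<longlongrightarrow> a z) (nhds z)" by (simp add: continuous_at tendsto_at_iff_tendsto_nhds)
    have "eventually (\<lambda>y. indicator {0..a y} t = (indicator {0..a z} t :: real)) (nhds z)"
    proof (cases "t < a z")
      case True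
      show ?thesis
        using order_tendstoD(1)[OF lim True] by eventually_elim (use True in \<open>auto simp: indicator_def\<close>)
    next
      case False
      then have "a z < t" using t by simp
      show ?thesis
        using order_tendstoD(2)[OF lim \<open>a z < t\<close>]
        by eventually_elim (use \<open>a z < t\<close> in \<open>auto simp: indicator_def\<close>)
    qed
    then have "eventually (\<lambda>y. indicator {0..a y} t *\<^sub>R K y t = (indicator {0..a z} t :: real) *\<^sub>R K y t) (nhds z)"
      by eventually_elim simp
    then have "isCont (\<lambda>y. indicator {0..a y} t *\<^sub>R K y t) z = isCont (\<lambda>y. (indicator {0..a z} t :: real) *\<^sub>R K y t) z"
      by (rule isCont_cong)
    then show "isCont (\<lambda>y. indicator {0..a y} t *\<^sub>R K y t) z"
      using Kz[of t] by (auto intro!: continuous_intros simp: continuous_on_eq_continuous_at)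
  qed
  show "integrable lborel (\<lambda>t. indicator {0..T} t * C)"
    by (intro integrable_mult_left) (simp add: integrable_indicator_iff emeasure_lborel_Icc_eq)
  show "norm (indicator {0..a z} t *\<^sub>R K z t) \<le> indicator {0..T} t * C" for z t
    using aT[of z] bd[of z t] order_trans[OF norm_ge_zero bd[of z t]] by (auto simp: indicator_def)
qed

lemma set_integral_Icc_self:
  fixes F :: "real \<Rightarrow> complex"
  shows "(LBINT t:{a..a}. F t) = 0"
proof -
  have "AE t in lborel. indicator {a..a} t *\<^sub>R F t = 0"
    using AE_lborel_singleton[of a] by eventually_elim simp
  then show ?thesis unfolding set_lebesgue_integral_def by (rule integral_eq_zero_AE)
qed

text \<open>The initial profile is a separate argument, so that it stays fixed while
  \<open>h\<close> runs through the contraction. The factor 1 / (4 pi^2) of the original equation is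
  absent because the normalisation of \<open>wave_packet\<close> absorbs it.\<close>

definition duhamel_map :: "real \<Rightarrow> (real \<Rightarrow> real) \<Rightarrow> (real \<Rightarrow> complex) \<Rightarrow> (real \<Rightarrow> real \<Rightarrow> complex) \<Rightarrow> real \<Rightarrow> real \<Rightarrow> complex" where
  "duhamel_map \<gamma> p h\<^sub>0 h t \<eta> = iexp (t * p \<eta>) * h\<^sub>0 \<eta>
     - \<i> * of_real \<gamma> * (LBINT t':{0..t}. iexp ((t - t') * p \<eta>) * cubic_conv (h t') \<eta>)"

lemma continuous_on_duhamel_map:
  fixes \<tau> :: "real \<Rightarrow> real"
  assumes p: "continuous_on UNIV p" and h0: "decaying A h\<^sub>0" and h: "unif_decaying B h"
    and \<tau>: "continuous_on UNIV \<tau>" "\<And>t. \<tau> t \<le> T"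
  shows "continuous_on UNIV (\<lambda>(t, \<eta>). duhamel_map \<gamma> p h\<^sub>0 h (\<tau> t) \<eta>)"
proof -
  note c = unif_decaying_cubic_conv[OF h]
  have "continuous_on UNIV (\<lambda>z. LBINT t':{0..\<tau> (fst z)}.
      iexp ((\<tau> (fst z) - t') * p (snd z)) * cubic_conv (h t') (snd z))"
  proof (rule continuous_on_integral_upper[where T = T and C = "16 * pi\<^sup>2 * B ^ 3" and a = "\<lambda>z. \<tau> (fst z)"
        and K = "\<lambda>z t'. iexp ((\<tau> (fst z) - t') * p (snd z)) * cubic_conv (h t') (snd z)"])
    show "continuous_on UNIV (\<lambda>(z, t'). iexp ((\<tau> (fst z) - t') * p (snd z)) * cubic_conv (h t') (snd z))"
      unfolding case_prod_beta
      by (intro continuous_intros unif_decaying_continuous[OF c] continuous_on_compose2[OF p] continuous_on_compose2[OF \<tau>(1)]) auto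
    show "continuous_on UNIV (\<lambda>z. \<tau> (fst z))"
      by (intro continuous_on_compose2[OF \<tau>(1)] continuous_intros) auto
    show "norm (iexp ((\<tau> (fst z) - t') * p (snd z)) * cubic_conv (h t') (snd z)) \<le> 16 * pi\<^sup>2 * B ^ 3" for z t'
      using decaying_bounded[OF unif_decayingD[OF c]] by (simp add: norm_mult)
  qed (rule \<tau>)
  then show ?thesis
    unfolding duhamel_map_def case_prod_beta
    by (intro continuous_intros continuous_on_compose2[OF p] continuous_on_compose2[OF \<tau>(1)] continuous_on_compose2[OF decayingD(1)[OF h0]]) auto
qed

text \<open>Integration in time gains the factor 1 / K relative to the weight exp (K t), uniformly
  in t. This gain is what makes the Duhamel map contracting without a restriction on the length of
  the interval.\<close>

lemma norm_exp_weighted_integral_le: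
  fixes F :: "real \<Rightarrow> complex"
  assumes "0 < K" "0 \<le> t" "0 \<le> B" and F: "\<And>t'. t' \<in> {0..t} \<Longrightarrow> norm (F t') \<le> B * exp (K * t')"
  shows "norm (LBINT t':{0..t}. F t') \<le> B * exp (K * t) / K"
proof -
  have i: "set_integrable lborel {0..t} (\<lambda>t'. B * exp (K * t'))"
    by (intro borel_integrable_atLeastAtMost' continuous_intros)
  have "norm (LBINT t':{0..t}. F t') \<le> (LBINT t':{0..t}. B * exp (K * t'))"
    unfolding set_lebesgue_integral_def
    by (rule norm_integral_complex_bound[OF i[unfolded set_integrable_def]])
      (use F in \<open>auto simp: indicator_def\<close>)
  also have "\<dots> = B * exp (K * t) / K - B * exp (K * 0) / K"
    unfolding set_lebesgue_integral_def
    by (rule integral_FTC_atLeastAtMost)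
      (use assms in \<open>auto intro!: derivative_eq_intros continuous_intros simp: has_real_derivative_iff_has_vector_derivative[symmetric]\<close>)
  also have "\<dots> \<le> B * exp (K * t) / K" using assms by simp
  finally show ?thesis .
qed

lemma duhamel_map_diff_le:
  assumes p: "continuous_on UNIV p" and h: "unif_decaying A h" and g: "unif_decaying A g"
    and K: "0 < K" and t: "0 \<le> t" and D: "0 \<le> D"
    and hg: "\<And>t' \<eta>. t' \<in> {0..t} \<Longrightarrow> norm (h t' \<eta> - g t' \<eta>) \<le> D * exp (K * t') * wt \<eta>"
  shows "norm (duhamel_map \<gamma> p h\<^sub>0 h t \<eta> - duhamel_map \<gamma> p h\<^sub>0 g t \<eta>) \<le> \<bar>\<gamma>\<bar> * (48 * pi\<^sup>2 * A\<^sup>2) / K * D * exp (K * t) * wt \<eta>"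
proof -
  let ?e = "\<lambda>t'. iexp ((t - t') * p \<eta>)"
  have i: "set_integrable lborel {0..t} (\<lambda>t'. ?e t' * cubic_conv (f t') \<eta>)" if f: "unif_decaying A f" for f
    by (intro borel_integrable_atLeastAtMost' continuous_intros unif_decaying_continuous[OF unif_decaying_cubic_conv[OF f]])
  have "duhamel_map \<gamma> p h\<^sub>0 h t \<eta> - duhamel_map \<gamma> p h\<^sub>0 g t \<eta> =
      - \<i> * of_real \<gamma> * ((LBINT t':{0..t}. ?e t' * cubic_conv (h t') \<eta>) - (LBINT t':{0..t}. ?e t' * cubic_conv (g t') \<eta>))"
    by (simp add: duhamel_map_def algebra_simps)
  also have "\<dots> = - \<i> * of_real \<gamma> * (LBINT t':{0..t}. ?e t' * (cubic_conv (h t') \<eta> - cubic_conv (g t') \<eta>))"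
    using i[OF h] i[OF g] by (subst set_integral_diff(2)[symmetric]) (auto simp: right_diff_distrib)
  finally have "norm (duhamel_map \<gamma> p h\<^sub>0 h t \<eta> - duhamel_map \<gamma> p h\<^sub>0 g t \<eta>) =
      \<bar>\<gamma>\<bar> * norm (LBINT t':{0..t}. ?e t' * (cubic_conv (h t') \<eta> - cubic_conv (g t') \<eta>))"
    by (simp add: norm_mult)
  also have "\<dots> \<le> \<bar>\<gamma>\<bar> * ((48 * pi\<^sup>2 * A\<^sup>2 * D * wt \<eta>) * exp (K * t) / K)"
  proof (intro mult_left_mono norm_exp_weighted_integral_le K t)
    fix t' assume t': "t' \<in> {0..t}"
    have "norm (cubic_conv (h t') \<eta> - cubic_conv (g t') \<eta>) \<le> 48 * pi\<^sup>2 * A\<^sup>2 * (D * exp (K * t')) * wt \<eta>"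
      by (rule norm_cubic_conv_diff_le[OF unif_decayingD[OF h] unif_decayingD[OF g] hg[OF t']])
    then show "norm (?e t' * (cubic_conv (h t') \<eta> - cubic_conv (g t') \<eta>)) \<le> 48 * pi\<^sup>2 * A\<^sup>2 * D * wt \<eta> * exp (K * t')"
      by (simp add: norm_mult mult_ac)
  qed (use D in auto)
  finally show ?thesis by (simp add: mult_ac)
qed

text \<open>An approximate solution \<open>H\<close> of the Duhamel equation on \<open>[0, T]\<close> is corrected to an exact one by a
  contraction argument in the norm \<open>sup e\<^sup>-\<^sup>K\<^sup>t (1 + \<eta>\<^sup>2) \<bar>E(t, \<eta>)\<bar>\<close>; the exponential weight makes
  the map contracting on the whole interval.\<close>

lemma duhamel_fixed_point:
  assumes T: "0 \<le> T" and p: "continuous_on UNIV p" and H: "unif_decaying R H" and \<sigma>: "0 \<le> \<sigma>"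
    and K: "1 \<le> K" "2 * (\<bar>\<gamma>\<bar> * (48 * pi\<^sup>2 * (R + 1)\<^sup>2)) \<le> K"
    and source: "\<And>t \<eta>. t \<in> {0..T} \<Longrightarrow> norm (duhamel_map \<gamma> p (H 0) H t \<eta> - H t \<eta>) \<le> \<sigma> * wt \<eta>"
    and small: "2 * \<sigma> * exp (K * T) \<le> 1"
  shows "\<exists>h. unif_decaying (R + 1) h \<and>
      (\<forall>t\<in>{0..T}. \<forall>\<eta>. h t \<eta> = duhamel_map \<gamma> p (h 0) h t \<eta> \<and> norm (h t \<eta> - H t \<eta>) \<le> 2 * \<sigma> * exp (K * T) * wt \<eta>) \<and>
      h 0 = H 0"
proof -
  define \<tau> where "\<tau> t = max 0 (min T t)" for t
  have \<tau>_cont: "continuous_on UNIV \<tau>" unfolding \<tau>_def by (intro continuous_intros)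
  have \<tau>: "0 \<le> \<tau> t" "\<tau> t \<le> T" and \<tau>_eq: "t \<in> {0..T} \<Longrightarrow> \<tau> t = t" for t
    using T by (auto simp: \<tau>_def)
  \<comment> \<open>The unknown \<open>g\<close> is the correction divided by the weight: a bounded
    continuous function on the plane, hence an element of the complete space
    \<open>bcontfun\<close>. Clamping by \<tau> extends everything from [0, T] to all times.\<close>
  define E where "E g t \<eta> = of_real (exp (K * \<tau> t) * wt \<eta>) * apply_bcontfun g (\<tau> t, \<eta>)" for g :: "(real \<times> real) \<Rightarrow>\<^sub>C complex" and t \<eta>
  define h where "h g t \<eta> = H t \<eta> + E g t \<eta>" for g t \<eta>
  \<comment> \<open>The radius is twice the residual: the image of 0 has norm at most \<sigma>, and
    a contraction by 1/2 adds at most another \<sigma> on this ball, so the ball is mapped into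
    itself.\<close>
  define B where "B = cball (0 :: (real \<times> real) \<Rightarrow>\<^sub>C complex) (2 * \<sigma>)"
  have E_le: "norm (E g t \<eta>) \<le> 2 * \<sigma> * exp (K * T) * wt \<eta>" if "g \<in> B" for g t \<eta>
  proof -
    have "norm (apply_bcontfun g (\<tau> t, \<eta>)) \<le> 2 * \<sigma>"
      using norm_bounded[of g "(\<tau> t, \<eta>)"] that by (simp add: B_def)
    moreover have "exp (K * \<tau> t) \<le> exp (K * T)" using K \<tau> by simp
    ultimately have "exp (K * \<tau> t) * norm (apply_bcontfun g (\<tau> t, \<eta>)) \<le> exp (K * T) * (2 * \<sigma>)"
      by (intro mult_mono) auto
    then have "exp (K * \<tau> t) * norm (apply_bcontfun g (\<tau> t, \<eta>)) * wt \<eta> \<le> exp (K * T) * (2 * \<sigma>) * wt \<eta>"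
      by (rule mult_right_mono) simp
    then show ?thesis by (simp add: E_def norm_mult mult_ac)
  qed
  have E_cont: "continuous_on UNIV (\<lambda>(t, \<eta>). E g t \<eta>)" for g
    unfolding E_def case_prod_beta
    by (intro continuous_intros continuous_on_compose2[OF \<tau>_cont] continuous_on_compose2[OF continuous_on_apply_bcontfun[of UNIV g]]) auto
  have h: "unif_decaying (R + 1) (h g)" if g: "g \<in> B" for g
    unfolding unif_decaying_def
  proof (intro conjI allI)
    show "continuous_on UNIV (\<lambda>(t, \<eta>). h g t \<eta>)"
      using E_cont[of g] H unfolding h_def unif_decaying_def by (auto simp: case_prod_beta intro!: continuous_intros)
    \<comment> \<open>The smallness assumption keeps every candidate within the ball of radius R +
      1, for which the Lipschitz constant in the condition on \<open>K\<close> was computed.\<close>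
    have "norm (E g t \<eta>) \<le> 1 * wt \<eta>" for t \<eta>
      using mult_right_mono[OF small wt_nonneg[of \<eta>]] E_le[OF g, of t \<eta>] by linarith
    then show "norm (h g t \<eta>) \<le> (R + 1) * wt \<eta>" for t \<eta>
      using decayingD(2)[OF unif_decayingD[OF H], of t \<eta>] unfolding h_def distrib_right
      by (intro order_trans[OF norm_triangle_ineq] add_mono)
  qed
  define f where "f g = (\<lambda>(t, \<eta>). of_real (exp (- K * \<tau> t) * (1 + \<eta>\<^sup>2)) *
      (duhamel_map \<gamma> p (H 0) (h g) (\<tau> t) \<eta> - H (\<tau> t) \<eta>))" for g
  have f_diff: "norm (f g z - f g' z) \<le> dist g g' / 2" if g: "g \<in> B" "g' \<in> B" for g g' z
  proof -
    obtain t \<eta> where z: "z = (t, \<eta>)" by fastforce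
    have "norm (duhamel_map \<gamma> p (H 0) (h g) (\<tau> t) \<eta> - duhamel_map \<gamma> p (H 0) (h g') (\<tau> t) \<eta>) \<le>
       \<bar>\<gamma>\<bar> * (48 * pi\<^sup>2 * (R + 1)\<^sup>2) / K * dist g g' * exp (K * \<tau> t) * wt \<eta>"
    proof (rule duhamel_map_diff_le[OF p h[OF g(1)] h[OF g(2)] _ \<tau>(1)])
      fix t' \<eta> assume "t' \<in> {0..\<tau> t}"
      then have t': "\<tau> t' = t'" using \<tau>[of t] by (auto intro: \<tau>_eq)
      have "norm (h g t' \<eta> - h g' t' \<eta>) = exp (K * t') * wt \<eta> * dist (apply_bcontfun g (t', \<eta>)) (apply_bcontfun g' (t', \<eta>))"
        by (simp add: h_def E_def t' dist_norm norm_mult flip: right_diff_distrib)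
      also have "\<dots> \<le> exp (K * t') * wt \<eta> * dist g g'"
        by (intro mult_left_mono dist_bounded) auto
      finally show "norm (h g t' \<eta> - h g' t' \<eta>) \<le> dist g g' * exp (K * t') * wt \<eta>"
        by (simp add: mult_ac)
    qed (use K in auto)
    also have "\<dots> \<le> (1 / 2) * dist g g' * exp (K * \<tau> t) * wt \<eta>"
      using K by (intro mult_right_mono) (auto simp: divide_le_eq)
    finally have d: "norm (duhamel_map \<gamma> p (H 0) (h g) (\<tau> t) \<eta> - duhamel_map \<gamma> p (H 0) (h g') (\<tau> t) \<eta>) \<le>
        dist g g' / 2 * (exp (K * \<tau> t) * wt \<eta>)" by simp
    have "norm (f g z - f g' z) = exp (- K * \<tau> t) * (1 + \<eta>\<^sup>2) *
        norm (duhamel_map \<gamma> p (H 0) (h g) (\<tau> t) \<eta> - duhamel_map \<gamma> p (H 0) (h g') (\<tau> t) \<eta>)"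
    proof -
      have "f g z - f g' z = of_real (exp (- K * \<tau> t) * (1 + \<eta>\<^sup>2)) *
        (duhamel_map \<gamma> p (H 0) (h g) (\<tau> t) \<eta> - duhamel_map \<gamma> p (H 0) (h g') (\<tau> t) \<eta>)"
        unfolding f_def z case_prod_conv right_diff_distrib by simp
      moreover have "0 \<le> exp (- K * \<tau> t) * (1 + \<eta>\<^sup>2)" by (intro mult_nonneg_nonneg) auto
      ultimately show ?thesis by (simp only: norm_mult norm_of_real abs_of_nonneg)
    qed
    also have "\<dots> \<le> exp (- K * \<tau> t) * (1 + \<eta>\<^sup>2) * (dist g g' / 2 * (exp (K * \<tau> t) * wt \<eta>))"
      by (intro mult_left_mono d) auto
    also have "\<dots> = (exp (- K * \<tau> t) * exp (K * \<tau> t)) * ((1 + \<eta>\<^sup>2) * wt \<eta>) * (dist g g' / 2)"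
      by (simp only: mult_ac)
    also have "\<dots> = dist g g' / 2"
      unfolding wt_cancel exp_add[symmetric] by simp
    finally show ?thesis .
  qed
  have B0: "0 \<in> B" using \<sigma> by (simp add: B_def)
  have f_0: "norm (f 0 z) \<le> \<sigma>" for z
  proof -
    obtain t \<eta> where z: "z = (t, \<eta>)" by fastforce
    have h0: "h 0 = H" by (simp add: h_def E_def fun_eq_iff)
    have "norm (f 0 z) = exp (- K * \<tau> t) * ((1 + \<eta>\<^sup>2) * norm (duhamel_map \<gamma> p (H 0) H (\<tau> t) \<eta> - H (\<tau> t) \<eta>))"
    proof -
      have "0 \<le> exp (- K * \<tau> t) * (1 + \<eta>\<^sup>2)" by (intro mult_nonneg_nonneg) auto
      then show ?thesis by (simp only: f_def z case_prod_conv h0 norm_mult norm_of_real abs_of_nonneg mult.assoc)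
    qed
    also have "\<dots> \<le> 1 * ((1 + \<eta>\<^sup>2) * (\<sigma> * wt \<eta>))"
      using K \<tau> by (intro mult_mono source) auto
    also have "\<dots> = \<sigma> * ((1 + \<eta>\<^sup>2) * wt \<eta>)" by (simp only: mult_ac mult_1)
    finally show ?thesis by (simp add: wt_cancel)
  qed
  have f_le: "norm (f g z) \<le> 2 * \<sigma>" if g: "g \<in> B" for g z
  proof -
    have "norm (f g z) \<le> norm (f 0 z) + norm (f g z - f 0 z)" using norm_triangle_sub by blast
    also have "\<dots> \<le> \<sigma> + dist g 0 / 2" by (intro add_mono f_0 f_diff g B0)
    also have "\<dots> \<le> 2 * \<sigma>" using g by (simp add: B_def dist_commute)
    finally show ?thesis .
  qed
  have f_cont: "continuous_on UNIV (f g)" if g: "g \<in> B" for g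
  proof -
    have "continuous_on UNIV (\<lambda>z. duhamel_map \<gamma> p (H 0) (h g) (\<tau> (fst z)) (snd z))"
      using continuous_on_duhamel_map[OF p unif_decayingD[OF H] h[OF g] \<tau>_cont \<tau>(2), of \<gamma> 0] by (simp add: case_prod_beta)
    then show ?thesis
      unfolding f_def case_prod_beta
      by (intro continuous_intros unif_decaying_continuous[OF H] continuous_on_compose2[OF \<tau>_cont]) auto
  qed
  have f_bc: "apply_bcontfun (Bcontfun (f g)) = f g" if "g \<in> B" for g
    using bcontfun_normI[OF f_cont[OF that] f_le[OF that]] by (simp add: Bcontfun_inverse)
  have "\<exists>!g\<in>B. Bcontfun (f g) = g"
  proof (rule Banach_fix)
    show "Topological_Spaces.complete B" unfolding B_def by (simp add: complete_eq_closed)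
    show "(\<lambda>g. Bcontfun (f g)) ` B \<subseteq> B"
      using f_le by (auto simp: f_bc B_def intro!: norm_bound)
    show "dist (Bcontfun (f g)) (Bcontfun (f g')) \<le> 1 / 2 * dist g g'" if "g \<in> B" "g' \<in> B" for g g'
      using f_diff[OF that] that by (intro dist_bound) (simp add: f_bc dist_norm)
  qed (use B0 in auto)
  then obtain g where g: "g \<in> B" and fix_g: "Bcontfun (f g) = g" by blast
  have eq: "h g t \<eta> = duhamel_map \<gamma> p (H 0) (h g) t \<eta>" if t: "t \<in> {0..T}" for t \<eta>
  proof -
    have "apply_bcontfun g (t, \<eta>) = f g (t, \<eta>)" using f_bc[OF g] fix_g by simp
    then have "E g t \<eta> = of_real ((exp (K * t) * exp (- K * t)) * ((1 + \<eta>\<^sup>2) * wt \<eta>)) * (duhamel_map \<gamma> p (H 0) (h g) t \<eta> - H t \<eta>)"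
      unfolding E_def f_def case_prod_conv \<tau>_eq[OF t] of_real_mult by (simp only: mult_ac)
    then have "E g t \<eta> = duhamel_map \<gamma> p (H 0) (h g) t \<eta> - H t \<eta>"
      unfolding wt_cancel exp_add[symmetric] by simp
    then show ?thesis by (simp add: h_def)
  qed
  \<comment> \<open>At time 0 the integral is over a single point and drops out, so the exact
    solution has the initial value of the approximate one.\<close>
  have h0: "h g 0 = H 0"
  proof
    fix \<eta>
    have "(LBINT t':{0..0}. iexp ((0 - t') * p \<eta>) * cubic_conv (h g t') \<eta>) = 0"
      by (rule set_integral_Icc_self)
    then show "h g 0 \<eta> = H 0 \<eta>"
      using eq[of 0 \<eta>] T by (simp add: duhamel_map_def)
  qed
  show ?thesis
  proof (intro exI[of _ "h g"] conjI ballI allI)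
    show "unif_decaying (R + 1) (h g)" by (rule h[OF g])
    show "h g t \<eta> = duhamel_map \<gamma> p (h g 0) (h g) t \<eta>" if "t \<in> {0..T}" for t \<eta>
      unfolding h0 by (rule eq[OF that])
    show "norm (h g t \<eta> - H t \<eta>) \<le> 2 * \<sigma> * exp (K * T) * wt \<eta>" if "t \<in> {0..T}" for t \<eta>
      using E_le[OF g] by (simp add: h_def)
  qed (rule h0)
qed

section \<open>The Gaussian profile\<close>

text \<open>With \<open>G(y) = exp (- y\<^sup>2 / 2)\<close> this is \<open>G\<^sup>m exp (- i \<lambda> G\<^sup>2)\<close>; the function
  \<open>a G exp (- i \<gamma> a\<^sup>2 t G\<^sup>2)\<close> solves \<open>i w' = \<gamma> \<bar>w\<bar>\<^sup>2 w\<close>.\<close>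

definition gauss_phase :: "nat \<Rightarrow> real \<Rightarrow> real \<Rightarrow> complex" where
  "gauss_phase m l y = of_real (exp (- (m * y\<^sup>2) / 2)) * exp (- \<i> * of_real (l * exp (- y\<^sup>2)))"

text \<open>With the factor 1 / (2 pi), pointwise products correspond to convolutions without any
  constant, so that \<open>cubic_conv\<close> acts on profiles as the plain cube.\<close>

definition gauss_phase_ft :: "nat \<Rightarrow> real \<Rightarrow> real \<Rightarrow> complex" where
  "gauss_phase_ft m l \<eta> = of_real (1 / (2 * pi)) * fourier (gauss_phase m l) \<eta>"

lemma norm_gauss_phase: "norm (gauss_phase m l y) = exp (- (m * y\<^sup>2) / 2)"
  unfolding gauss_phase_def norm_mult by simp

lemma gaussian_le_wt:
  assumes "1 \<le> m"
  shows "exp (- (real m * y\<^sup>2) / 2) \<le> 2 * wt y"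
proof -
  have "(1 + y\<^sup>2) \<le> 2 * (1 + y\<^sup>2 / 2)" by simp
  also have "\<dots> \<le> 2 * exp (y\<^sup>2 / 2)" by (intro mult_left_mono exp_ge_add_one_self) auto
  finally have "(1 + y\<^sup>2) * exp (- y\<^sup>2 / 2) \<le> 2 * exp (y\<^sup>2 / 2) * exp (- y\<^sup>2 / 2)"
    by (rule mult_right_mono) simp
  also have "\<dots> = 2" by (simp add: mult.assoc exp_add[symmetric])
  finally have "(1 + y\<^sup>2) * exp (- y\<^sup>2 / 2) * wt y \<le> 2 * wt y" by (rule mult_right_mono) simp
  then have "exp (- y\<^sup>2 / 2) * ((1 + y\<^sup>2) * wt y) \<le> 2 * wt y" by (simp only: mult_ac)
  then have *: "exp (- y\<^sup>2 / 2) \<le> 2 * wt y" unfolding wt_cancel by simp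
  have "1 * y\<^sup>2 \<le> real m * y\<^sup>2" using assms by (intro mult_right_mono) auto
  then have "exp (- (real m * y\<^sup>2) / 2) \<le> exp (- y\<^sup>2 / 2)" by simp
  then show ?thesis using * by linarith
qed

lemma unif_decaying_gauss_phase:
  assumes "1 \<le> m"
  shows "unif_decaying 2 (gauss_phase m)"
  unfolding unif_decaying_def
proof (intro conjI allI)
  show "continuous_on UNIV (\<lambda>(l, y). gauss_phase m l y)"
    unfolding gauss_phase_def case_prod_beta by (intro continuous_intros) auto
  show "norm (gauss_phase m l y) \<le> 2 * wt y" for l y
    unfolding norm_gauss_phase by (rule gaussian_le_wt[OF assms])
qed

lemmas decaying_gauss_phase = unif_decayingD[OF unif_decaying_gauss_phase]

text \<open>The estimate x^2 / 2 \<le> exp x is used at x = (1 + \<eta>^2) / (2 n), whose square is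
  the required fourth-order growth divided by 4 n^2. The bound loses only n^2, which keeps the later
  series over n summable.\<close>

lemma gaussian_wt2_bound:
  assumes n: "1 \<le> n"
  shows "exp (- \<eta>\<^sup>2 / (2 * n)) \<le> 16 * n\<^sup>2 * (wt \<eta>)\<^sup>2"
proof -
  define x where "x = (1 + \<eta>\<^sup>2) / (2 * n)"
  have x: "0 \<le> x" using n by (simp add: x_def)
  have "x\<^sup>2 / 2 \<le> exp x" using exp_lower_Taylor_quadratic[OF x] x by linarith
  then have "x\<^sup>2 \<le> 2 * exp x" by simp
  also have "exp x = exp (1 / (2 * n)) * exp (\<eta>\<^sup>2 / (2 * n))"
    by (simp add: x_def add_divide_distrib exp_add)
  also have "exp (1 / (2 * n)) \<le> 2"
  proof -
    have "exp (1 / (2 * n)) \<le> exp (1 / 2)" using n by (simp add: divide_le_eq)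
    also have "\<dots> \<le> 2"
      using exp_bound[of "1/2"] by (simp add: power2_eq_square)
    finally show ?thesis .
  qed
  finally have "x\<^sup>2 \<le> 4 * exp (\<eta>\<^sup>2 / (2 * n))" by simp
  then have "(1 + \<eta>\<^sup>2)\<^sup>2 \<le> 16 * n\<^sup>2 * exp (\<eta>\<^sup>2 / (2 * n))"
    using n by (simp add: x_def power_divide power_mult_distrib divide_le_eq mult_ac)
  then have "(1 + \<eta>\<^sup>2)\<^sup>2 * (exp (- \<eta>\<^sup>2 / (2 * n)) * (wt \<eta>)\<^sup>2) \<le> 16 * n\<^sup>2 * exp (\<eta>\<^sup>2 / (2 * n)) * (exp (- \<eta>\<^sup>2 / (2 * n)) * (wt \<eta>)\<^sup>2)"
    by (rule mult_right_mono) simp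
  then have "((1 + \<eta>\<^sup>2) * wt \<eta>)\<^sup>2 * exp (- \<eta>\<^sup>2 / (2 * n)) \<le> 16 * n\<^sup>2 * (wt \<eta>)\<^sup>2 * (exp (\<eta>\<^sup>2 / (2 * n)) * exp (- \<eta>\<^sup>2 / (2 * n)))"
    by (simp only: power_mult_distrib mult_ac)
  then show ?thesis unfolding wt_cancel exp_add[symmetric] by simp
qed

text \<open>Expanding the exponential of - i l G^2 turns the profile into a series of powers G^(m +
  2k), each a Gaussian with explicit transform. The factorials justify integration term by
  term.\<close>

lemma fourier_gauss_phase_sums:
  assumes m: "1 \<le> m"
  shows "(\<lambda>k. (- \<i> * of_real l) ^ k / fact k * of_real (sqrt (2 * pi / (m + 2 * k)) * exp (- \<eta>\<^sup>2 / (2 * (m + 2 * k)))))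
    sums fourier (gauss_phase m l) \<eta>"
proof -
  define c where "c k = (- \<i> * of_real l) ^ k / (fact k :: complex)" for k
  define G where "G k y = (of_real (exp (- (real (m + 2 * k) * y\<^sup>2) / 2)) :: complex)" for k y
  define f where "f k y = exp (- \<i> * of_real (y * \<eta>)) * (c k * G k y)" for k y
  have nc: "norm (c k) = \<bar>l\<bar> ^ k / fact k" for k
    by (simp add: c_def norm_divide norm_mult norm_power)
  have Gi: "integrable lborel (G k)" for k
    unfolding G_def using m by (intro integrable_of_real integrable_gaussian) auto
  have fi: "integrable lborel (f k)" for k
    unfolding f_def by (intro fourier_integrand_integrable integrable_mult_right Gi)
  have sum_l: "summable (\<lambda>k. \<bar>l\<bar> ^ k / fact k)"
    using summable_exp[of "\<bar>l\<bar>"] by (simp add: divide_inverse mult.commute)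
  have nf: "norm (f k y) = \<bar>l\<bar> ^ k / fact k * exp (- (real (m + 2 * k) * y\<^sup>2) / 2)" for k y
    unfolding f_def norm_mult nc G_def by simp
  have nG: "exp (- (real (m + 2 * k) * y\<^sup>2) / 2) \<le> 1" for k y
  proof -
    have "0 \<le> real (m + 2 * k) * y\<^sup>2" by simp
    then show ?thesis by simp
  qed
  have 1: "AE y in lborel. summable (\<lambda>k. norm (f k y))"
  proof (intro always_eventually allI summable_comparison_test'[OF sum_l])
    show "norm (norm (f k y)) \<le> \<bar>l\<bar> ^ k / fact k" for k y
      using mult_left_le[OF nG[of k y], of "\<bar>l\<bar> ^ k / fact k"] by (simp add: nf)
  qed
  have 2: "summable (\<lambda>k. LBINT y. norm (f k y))"
  proof (rule summable_comparison_test'[where N = 0])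
    show "summable (\<lambda>k. \<bar>l\<bar> ^ k / fact k * (2 * pi))" using sum_l by (rule summable_mult2)
    fix k
    have "(LBINT y. norm (f k y)) = \<bar>l\<bar> ^ k / fact k * (LBINT y. exp (- (real (m + 2 * k) * y\<^sup>2) / 2))"
      unfolding nf by simp
    also have "\<dots> \<le> \<bar>l\<bar> ^ k / fact k * (LBINT y. 2 * wt y)"
    proof (intro mult_left_mono integral_mono)
      show "integrable lborel (\<lambda>y. exp (- (real (m + 2 * k) * y\<^sup>2) / 2))"
        using m by (intro integrable_gaussian) auto
    qed (use m gaussian_le_wt[of "m + 2 * k"] integrable_wt in auto)
    finally have "(LBINT y. norm (f k y)) \<le> \<bar>l\<bar> ^ k / fact k * (2 * pi)" by (simp add: integral_wt)
    then show "norm (LBINT y. norm (f k y)) \<le> \<bar>l\<bar> ^ k / fact k * (2 * pi)"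
      by simp
  qed
  have "(\<lambda>k. integral\<^sup>L lborel (f k)) sums (LBINT y. (\<Sum>k. f k y))"
    by (rule sums_integral[OF fi 1 2])
  moreover have "integral\<^sup>L lborel (f k) = c k * of_real (sqrt (2 * pi / (m + 2 * k)) * exp (- \<eta>\<^sup>2 / (2 * (m + 2 * k))))" for k
  proof -
    have "integral\<^sup>L lborel (f k) = fourier (\<lambda>y. c k * G k y) \<eta>"
      unfolding f_def fourier_def ..
    also have "\<dots> = c k * fourier (G k) \<eta>" by (rule fourier_mult)
    also have "fourier (G k) \<eta> = of_real (sqrt (2 * pi / real (m + 2 * k)) * exp (- \<eta>\<^sup>2 / (2 * real (m + 2 * k))))"
      unfolding G_def using m by (intro fourier_gaussian) auto
    finally show ?thesis by simp
  qed
  moreover have "(LBINT y. (\<Sum>k. f k y)) = fourier (gauss_phase m l) \<eta>"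
  proof -
    have "(\<Sum>k. f k y) = exp (- \<i> * of_real (y * \<eta>)) * gauss_phase m l y" for y
    proof -
      have "f k y = exp (- \<i> * of_real (y * \<eta>)) * of_real (exp (- (m * y\<^sup>2) / 2)) * ((- \<i> * of_real (l * exp (- y\<^sup>2))) ^ k /\<^sub>R fact k)" for k
      proof -
        have 1: "exp (- (real (m + 2 * k) * y\<^sup>2) / 2) = exp (- (m * y\<^sup>2) / 2) * exp (- y\<^sup>2) ^ k"
          unfolding exp_of_nat_mult[symmetric] exp_add[symmetric] by (simp add: field_simps)
        have 2: "(- \<i> * of_real (l * b)) ^ k = (- \<i> * of_real l) ^ k * (of_real (b ^ k) :: complex)" for b
          by (simp only: of_real_mult mult.assoc[symmetric] power_mult_distrib of_real_power)
        show ?thesis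
          unfolding f_def c_def G_def 1 2 scaleR_conv_of_real
          by (simp only: of_real_mult of_real_inverse of_real_fact divide_inverse mult_ac)
      qed
      then have "(\<lambda>k. f k y) sums (exp (- \<i> * of_real (y * \<eta>)) * of_real (exp (- (m * y\<^sup>2) / 2)) * exp (- \<i> * of_real (l * exp (- y\<^sup>2))))"
        using sums_mult[OF exp_converges[of "- \<i> * of_real (l * exp (- y\<^sup>2))"]] by (simp only:)
      from sums_unique[OF this] show ?thesis unfolding gauss_phase_def by (simp only: mult.assoc)
    qed
    then show ?thesis by (simp only: fourier_def)
  qed
  ultimately show ?thesis by (simp add: c_def)
qed

text \<open>Each Gaussian of the series is bounded with n = m + 2k. Since n^2 is at most 4 m^2 4^k,
  the loss is absorbed into the exponential series, whose argument grows from L to 4 L.\<close>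

lemma norm_fourier_gauss_phase_le:
  assumes m: "1 \<le> m" and l: "\<bar>l\<bar> \<le> L"
  shows "norm (fourier (gauss_phase m l) \<eta>) \<le> 64 * sqrt (2 * pi) * (real m)\<^sup>2 * exp (4 * L) * (wt \<eta>)\<^sup>2"
proof -
  define c where "c k = (- \<i> * of_real l) ^ k / fact k * of_real (sqrt (2 * pi / (m + 2 * k)) * exp (- \<eta>\<^sup>2 / (2 * (m + 2 * k))))" for k
  define B where "B = 64 * sqrt (2 * pi) * (real m)\<^sup>2 * (wt \<eta>)\<^sup>2"
  have c_le: "norm (c k) \<le> B * ((4 * L) ^ k /\<^sub>R fact k)" for k
  proof -
    have L: "0 \<le> L" using l by simp
    have "norm (c k) = \<bar>l\<bar> ^ k / fact k * (sqrt (2 * pi / (m + 2 * k)) * exp (- \<eta>\<^sup>2 / (2 * (m + 2 * k))))"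
      unfolding c_def norm_mult norm_of_real by (simp add: norm_divide norm_power norm_mult)
    also have "\<dots> \<le> L ^ k / fact k * (sqrt (2 * pi) * (64 * ((real m)\<^sup>2 * 4 ^ k) * (wt \<eta>)\<^sup>2))"
    proof (intro mult_mono)
      show "\<bar>l\<bar> ^ k / fact k \<le> L ^ k / fact k" using l by (intro divide_right_mono power_mono) auto
      have "2 * pi * 1 \<le> 2 * pi * (m + 2 * k)" using m by (intro mult_left_mono) auto
      then have "2 * pi / (m + 2 * k) \<le> 2 * pi" using m by (simp add: divide_le_eq)
      then show "sqrt (2 * pi / (m + 2 * k)) \<le> sqrt (2 * pi)" by (rule real_sqrt_le_mono)
      have "real (m + 2 * k) \<le> 2 * (real m * 2 ^ k)"
      proof -
        have "k + 1 \<le> 2 ^ k" by (induction k) auto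
        have "m * (2 * (k + 1)) = 2 * (m * k) + 2 * m" by (simp add: algebra_simps)
        then have "m + 2 * k \<le> m * (2 * (k + 1))"
          using mult_le_mono1[OF m, of k] by linarith
        moreover have "m * (2 * (k + 1)) \<le> m * (2 * 2 ^ k)"
          using \<open>k + 1 \<le> 2 ^ k\<close> by (intro mult_le_mono2) simp
        ultimately have "m + 2 * k \<le> 2 * (m * 2 ^ k)" by simp
        then have "real (m + 2 * k) \<le> real (2 * (m * 2 ^ k))" by (rule of_nat_mono)
        then show ?thesis by simp
      qed
      then have "(real (m + 2 * k))\<^sup>2 \<le> (2 * (real m * 2 ^ k))\<^sup>2" by (intro power_mono) auto
      also have "\<dots> = 4 * ((real m)\<^sup>2 * 4 ^ k)"
      proof -
        have "(2 ^ k)\<^sup>2 = (4 :: real) ^ k" by (simp add: power2_eq_square flip: power_mult_distrib)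
        then show ?thesis by (simp add: power_mult_distrib)
      qed
      finally have sq: "(real (m + 2 * k))\<^sup>2 \<le> 4 * ((real m)\<^sup>2 * 4 ^ k)" .
      have "exp (- \<eta>\<^sup>2 / (2 * real (m + 2 * k))) \<le> 16 * (real (m + 2 * k))\<^sup>2 * (wt \<eta>)\<^sup>2"
        using m by (intro gaussian_wt2_bound) simp
      also have "\<dots> \<le> 16 * (4 * ((real m)\<^sup>2 * 4 ^ k)) * (wt \<eta>)\<^sup>2"
        by (intro mult_right_mono mult_left_mono sq) auto
      finally show "exp (- \<eta>\<^sup>2 / (2 * (m + 2 * k))) \<le> 64 * ((real m)\<^sup>2 * 4 ^ k) * (wt \<eta>)\<^sup>2"
        by (simp add: mult_ac)
    qed (use L in auto)
    also have "\<dots> = B * ((4 * L) ^ k /\<^sub>R fact k)"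
      by (simp add: B_def power_mult_distrib divide_inverse mult_ac)
    finally show ?thesis .
  qed
  have s: "summable (\<lambda>k. B * ((4 * L) ^ k /\<^sub>R fact k))"
    by (intro summable_mult summable_exp_generic)
  have "fourier (gauss_phase m l) \<eta> = (\<Sum>k. c k)"
    using fourier_gauss_phase_sums[OF m] unfolding c_def by (rule sums_unique)
  also have "norm \<dots> \<le> (\<Sum>k. B * ((4 * L) ^ k /\<^sub>R fact k))"
    using c_le s by (rule norm_suminf_le)
  also have "\<dots> = B * exp (4 * L)"
    by (simp only: suminf_mult[OF summable_exp_generic] exp_def)
  finally show ?thesis by (simp add: B_def mult_ac)
qed

text \<open>Two powers of the weight are kept because the dispersive remainder costs a factor
  \<eta>^2. Uniformity in |l| \<le> L is needed since \<open>l\<close> follows the rotation through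
  the whole time interval.\<close>

lemma norm_gauss_phase_ft_le:
  assumes "1 \<le> m"
  shows "\<exists>R\<ge>0. \<forall>l \<eta>. \<bar>l\<bar> \<le> L \<longrightarrow> norm (gauss_phase_ft m l \<eta>) \<le> R * (wt \<eta>)\<^sup>2"
proof (intro exI[of _ "64 * sqrt (2 * pi) * (real m)\<^sup>2 * exp (4 * L)"] conjI allI impI)
  fix l \<eta> assume l: "\<bar>l\<bar> \<le> L"
  have "norm (gauss_phase_ft m l \<eta>) = 1 / (2 * pi) * norm (fourier (gauss_phase m l) \<eta>)"
    by (simp add: gauss_phase_ft_def norm_mult norm_divide)
  also have "\<dots> \<le> 1 * norm (fourier (gauss_phase m l) \<eta>)"
    using pi_gt3 by (intro mult_right_mono) (auto simp: divide_le_eq)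
  finally show "norm (gauss_phase_ft m l \<eta>) \<le> 64 * sqrt (2 * pi) * (real m)\<^sup>2 * exp (4 * L) * (wt \<eta>)\<^sup>2"
    using norm_fourier_gauss_phase_le[OF assms l, of \<eta>] by simp
qed simp

lemma continuous_on_gauss_phase_ft:
  assumes "1 \<le> m"
  shows "continuous_on UNIV (\<lambda>(l, \<eta>). gauss_phase_ft m l \<eta>)"
proof -
  note P = unif_decaying_gauss_phase[OF assms]
  have "continuous_on UNIV (\<lambda>z. LBINT y. exp (- \<i> * of_real (y * snd z)) * gauss_phase m (fst z) y)"
  proof (rule continuous_on_lborel_integral)
    show "(\<lambda>y. exp (- \<i> * of_real (y * snd z)) * gauss_phase m (fst z) y) \<in> borel_measurable borel" for z :: "real \<times> real"
      by (intro borel_measurable_continuous_onI continuous_intros unif_decaying_continuous[OF P])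
    have "continuous_on UNIV (\<lambda>z. exp (- \<i> * of_real (y * snd z)) * gauss_phase m (fst z) y)" for y
      by (intro continuous_intros unif_decaying_continuous[OF P])
    then show "AE y in lborel. isCont (\<lambda>z. exp (- \<i> * of_real (y * snd z)) * gauss_phase m (fst z) y) z" for z :: "real \<times> real"
      by (simp add: continuous_on_eq_continuous_at del: split_paired_All)
    show "integrable lborel (\<lambda>y. 2 * wt y)" using integrable_wt by simp
    show "norm (exp (- \<i> * of_real (y * snd z)) * gauss_phase m (fst z) y) \<le> 2 * wt y" for z y
      using decayingD(2)[OF unif_decayingD[OF P]] by (simp add: norm_mult)
  qed
  then show ?thesis
    unfolding gauss_phase_ft_def fourier_def case_prod_beta by (intro continuous_intros)
qed

lemma decaying_gauss_phase_ft:
  assumes "1 \<le> m"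
  shows "\<exists>R. decaying R (gauss_phase_ft m l)"
proof -
  obtain R where R: "0 \<le> R" "\<And>\<eta>. norm (gauss_phase_ft m l \<eta>) \<le> R * (wt \<eta>)\<^sup>2"
    using norm_gauss_phase_ft_le[OF assms, of "\<bar>l\<bar>"] by auto
  have "norm (gauss_phase_ft m l \<eta>) \<le> R * wt \<eta>" for \<eta>
    using R(2)[of \<eta>] mult_left_mono[OF wt_square_le[of \<eta>] R(1)] by simp
  moreover have "continuous_on UNIV (gauss_phase_ft m l)"
    using continuous_on_pair_compose[OF continuous_on_gauss_phase_ft[OF assms] continuous_on_const continuous_on_id] by simp
  ultimately show ?thesis by (auto simp: decaying_def)
qed

lemma integrable_fourier_gauss_phase:
  assumes "1 \<le> m"
  shows "integrable lborel (fourier (gauss_phase m l))"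
proof -
  obtain R where "decaying R (gauss_phase_ft m l)" using decaying_gauss_phase_ft[OF assms] by blast
  then have "integrable lborel (\<lambda>\<eta>. of_real (2 * pi) * gauss_phase_ft m l \<eta>)"
    by (intro integrable_mult_right decaying_integrable)
  then show ?thesis by (simp add: gauss_phase_ft_def)
qed

lemma inverse_fourier_gauss_phase_ft:
  assumes "1 \<le> m"
  shows "inverse_fourier (gauss_phase_ft m l) y = of_real (1 / (2 * pi)) * gauss_phase m l y"
proof -
  note d = decaying_gauss_phase[OF assms, of l]
  show ?thesis
  unfolding gauss_phase_ft_def inverse_fourier_mult
  using fourier_inversion[OF decayingD(1)[OF d] decaying_bounded[OF d] decaying_integrable[OF d]
      integrable_fourier_gauss_phase[OF assms]] by simp
qed

lemma gauss_phase_cubic: "of_real ((norm (gauss_phase 1 l y))\<^sup>2) * gauss_phase 1 l y = gauss_phase 3 l y"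
proof -
  have "exp (- (1 * y\<^sup>2) / 2) ^ 2 * exp (- (1 * y\<^sup>2) / 2) = exp (- (3 * y\<^sup>2) / 2)"
    unfolding exp_of_nat_mult[symmetric] exp_add[symmetric] by simp
  then show ?thesis
    unfolding norm_gauss_phase unfolding gauss_phase_def mult.assoc[symmetric] of_real_mult[symmetric] by simp
qed

text \<open>The inverse transforms of both sides agree, because on that side the cubic term is a
  pointwise cube and the phase factor has modulus 1. Fourier inversion then carries the identity
  back.\<close>

lemma cubic_conv_gauss_phase_ft:
  "cubic_conv (\<lambda>\<eta>. of_real a * gauss_phase_ft 1 l \<eta>) = (\<lambda>\<eta>. of_real (a ^ 3) * gauss_phase_ft 3 l \<eta>)"
proof
  fix \<eta>
  let ?h = "\<lambda>\<eta>. of_real a * gauss_phase_ft 1 l \<eta>"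
  obtain R where R: "decaying R (gauss_phase_ft 1 l)" using decaying_gauss_phase_ft[of 1 l] by auto
  have h: "decaying (\<bar>a\<bar> * R) ?h"
    by (rule decaying_mult[OF R]) auto
  note c = decaying_cubic_conv[OF h]
  have "inverse_fourier (cubic_conv ?h) y = of_real (1 / (2 * pi)) * (of_real (a ^ 3) * gauss_phase 3 l y)" for y
  proof -
    let ?P = "gauss_phase 1 l y"
    have n: "(norm (of_real a * (of_real (1 / (2 * pi)) * ?P)))\<^sup>2 = (a / (2 * pi))\<^sup>2 * (norm ?P)\<^sup>2"
      unfolding norm_mult norm_of_real power_mult_distrib power2_abs by (simp add: power_divide)
    have "inverse_fourier (cubic_conv ?h) y =
        of_real (4 * pi\<^sup>2) * (of_real ((a / (2 * pi))\<^sup>2 * (norm ?P)\<^sup>2) * (of_real a * (of_real (1 / (2 * pi)) * ?P)))"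
      unfolding inverse_fourier_cubic_conv[OF h] inverse_fourier_mult inverse_fourier_gauss_phase_ft[OF order_refl] n ..
    also have "\<dots> = of_real (4 * pi\<^sup>2 * (a / (2 * pi))\<^sup>2 * a * (1 / (2 * pi))) * (of_real ((norm ?P)\<^sup>2) * ?P)"
      by (simp only: of_real_mult mult_ac)
    also have "4 * pi\<^sup>2 * (a / (2 * pi))\<^sup>2 * a * (1 / (2 * pi)) = 1 / (2 * pi) * a ^ 3"
      by (simp add: power_divide power2_eq_square power3_eq_cube)
    finally show ?thesis unfolding gauss_phase_cubic by (simp only: of_real_mult mult.assoc)
  qed
  then have eq: "inverse_fourier (cubic_conv ?h) = (\<lambda>y. of_real (1 / (2 * pi)) * (of_real (a ^ 3) * gauss_phase 3 l y))" by blast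
  have "integrable lborel (inverse_fourier (cubic_conv ?h))"
    unfolding eq by (intro integrable_mult_right decaying_integrable[OF decaying_gauss_phase]) auto
  from fourier_inverse_fourier[OF decayingD(1)[OF c] decaying_bounded[OF c] decaying_integrable[OF c] this]
  have "cubic_conv ?h \<eta> = fourier (inverse_fourier (cubic_conv ?h)) \<eta>" by (rule sym)
  also have "\<dots> = of_real (1 / (2 * pi)) * (of_real (a ^ 3) * fourier (gauss_phase 3 l) \<eta>)"
    unfolding eq fourier_mult ..
  also have "\<dots> = of_real (a ^ 3) * gauss_phase_ft 3 l \<eta>"
    unfolding gauss_phase_ft_def by (simp only: mult_ac)
  finally show "cubic_conv ?h \<eta> = of_real (a ^ 3) * gauss_phase_ft 3 l \<eta>" .
qed

text \<open>At a fixed point y the time derivative of G exp(- i c t G^2) is - i c G^3 exp(- i c t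
  G^2). The fundamental theorem of calculus gives the integrated form in y, and Fubini transports it
  to the frequency side.\<close>

lemma gauss_phase_ft_ode:
  assumes t: "0 \<le> t"
  shows "gauss_phase_ft 1 (c * t) \<eta> - gauss_phase_ft 1 0 \<eta> =
    - \<i> * of_real c * (LBINT t':{0..t}. gauss_phase_ft 3 (c * t') \<eta>)"
proof -
  note P3 = unif_decaying_gauss_phase[of 3, simplified]
  have K: "unif_decaying (1 * 2) (\<lambda>t' y. exp (- \<i> * of_real (y * \<eta>)) * gauss_phase 3 (c * t') y)"
    by (rule unif_decaying_mult)
      (use P3 in \<open>auto simp: unif_decaying_def case_prod_beta intro!: continuous_intros unif_decaying_continuous[OF P3]\<close>)
  have ftc: "- \<i> * of_real c * (LBINT t':{0..t}. gauss_phase 3 (c * t') y) = gauss_phase 1 (c * t) y - gauss_phase 1 0 y" for y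
  proof -
    have d: "((\<lambda>t'. gauss_phase 1 (c * t') y) has_vector_derivative (- \<i> * of_real c) * gauss_phase 3 (c * t') y) (at t')" for t'
    proof -
      have e: "exp (- y\<^sup>2) * exp (- y\<^sup>2 / 2) = exp (- (3 * y\<^sup>2) / 2)"
        unfolding exp_add[symmetric] by simp
      have "((\<lambda>z. of_real (exp (- y\<^sup>2 / 2)) * exp (- \<i> * (of_real c * z * of_real (exp (- y\<^sup>2))))) has_field_derivative
        (- \<i> * of_real c) * (of_real (exp (- y\<^sup>2)) * of_real (exp (- y\<^sup>2 / 2)) * exp (- \<i> * (of_real c * of_real t' * of_real (exp (- y\<^sup>2)))))) (at (of_real t'))"
        by (rule derivative_eq_intros refl)+ (simp only: mult_ac mult_1 mult_zero_left add_0 add_0_right)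
      from has_vector_derivative_real_field[OF this] show ?thesis
        unfolding of_real_mult[symmetric] e gauss_phase_def by (simp add: o_def)
    qed
    have "(LBINT t':{0..t}. (- \<i> * of_real c) * gauss_phase 3 (c * t') y) = gauss_phase 1 (c * t) y - gauss_phase 1 (c * 0) y"
      unfolding set_lebesgue_integral_def
      by (intro integral_FTC_atLeastAtMost t has_vector_derivative_at_within[OF d] continuous_intros unif_decaying_continuous[OF P3])
    then show ?thesis by (simp only: set_integral_mult_right mult_zero_right)
  qed
  have "(LBINT t':{0..t}. gauss_phase_ft 3 (c * t') \<eta>) = of_real (1 / (2 * pi)) * (LBINT t':{0..t}. fourier (gauss_phase 3 (c * t')) \<eta>)"
    unfolding gauss_phase_ft_def by (rule set_integral_mult_right)
  also have "(LBINT t':{0..t}. fourier (gauss_phase 3 (c * t')) \<eta>) =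
      (LBINT y. (LBINT t':{0..t}. exp (- \<i> * of_real (y * \<eta>)) * gauss_phase 3 (c * t') y))"
    unfolding fourier_def by (rule integral_strip_swap[OF K])
  also have "\<dots> = fourier (\<lambda>y. LBINT t':{0..t}. gauss_phase 3 (c * t') y) \<eta>"
    unfolding fourier_def by (simp only: set_integral_mult_right)
  finally have "- \<i> * of_real c * (LBINT t':{0..t}. gauss_phase_ft 3 (c * t') \<eta>) =
     of_real (1 / (2 * pi)) * fourier (\<lambda>y. - \<i> * of_real c * (LBINT t':{0..t}. gauss_phase 3 (c * t') y)) \<eta>"
    by (simp only: fourier_mult mult_ac)
  also have "\<dots> = gauss_phase_ft 1 (c * t) \<eta> - gauss_phase_ft 1 0 \<eta>"
    unfolding ftc gauss_phase_ft_def right_diff_distrib[symmetric]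
    by (subst fourier_diff) (auto intro!: decaying_integrable[OF decaying_gauss_phase])
  finally show ?thesis by simp
qed


section \<open>Residual of the rotating Gaussian, and its correction to an exact profile\<close>

lemma norm_exp_i_minus_1_le: "norm (iexp x - 1) \<le> \<bar>x\<bar>"
  using iexp_approx1[of x 0] by simp

lemma norm_exp_i_minus_1_ge:
  assumes "\<bar>x\<bar> \<le> 1"
  shows "\<bar>x\<bar> / 2 \<le> norm (iexp x - 1)"
proof -
  have "norm (iexp x - (1 + \<i> * of_real x)) \<le> \<bar>x\<bar> ^ 2 / 2"
    using iexp_approx1[of x 1] by (simp add: numeral_2_eq_2)
  also have "\<dots> \<le> \<bar>x\<bar> / 2"
    using assms mult_left_le[of "\<bar>x\<bar>" "\<bar>x\<bar>"] by (simp add: power2_eq_square)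
  finally have 1: "norm (iexp x - (1 + \<i> * of_real x)) \<le> \<bar>x\<bar> / 2" .
  have "norm (\<i> * of_real x) \<le> norm (iexp x - 1) + norm (iexp x - (1 + \<i> * of_real x))"
    using norm_triangle_ineq4[of "iexp x - 1" "iexp x - (1 + \<i> * of_real x)"] by simp
  then show ?thesis using 1 by (simp add: norm_mult)
qed

text \<open>For p = 0 the profile solves the equation exactly. Subtracting that identity leaves only
  factors exp(i r p) - 1 with r in [0, T], bounded by T \<mu> \<eta>^2; the \<eta>^2 is paid for by
  the second power of the weight. \<open>R\<close> and \<open>S\<close> are fixed before \<mu> and
  p, so the residual can be made small by the choice of \<mu>.\<close>

lemma gauss_profile_source:
  fixes a \<gamma> T :: real
  assumes T: "0 \<le> T"
  defines "H \<equiv> \<lambda>t \<eta>. of_real a * gauss_phase_ft 1 (\<gamma> * a\<^sup>2 * max 0 (min T t)) \<eta>"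
  shows "\<exists>R S. 0 \<le> S \<and> unif_decaying R H \<and>
    (\<forall>\<mu> p. 0 \<le> \<mu> \<longrightarrow> continuous_on UNIV p \<longrightarrow> (\<forall>\<eta>. \<bar>p \<eta>\<bar> \<le> \<mu> * \<eta>\<^sup>2) \<longrightarrow>
      (\<forall>t\<in>{0..T}. \<forall>\<eta>. norm (duhamel_map \<gamma> p (H 0) H t \<eta> - H t \<eta>) \<le> \<mu> * S * wt \<eta>))"
proof -
  let ?\<tau> = "\<lambda>t. max 0 (min T t)"
  define L where "L = \<bar>\<gamma>\<bar> * a\<^sup>2 * T"
  have arg_le: "\<bar>\<gamma> * a\<^sup>2 * ?\<tau> t\<bar> \<le> L" for t
    using T by (auto simp: L_def abs_mult intro!: mult_left_mono)
  obtain R1 where R1: "0 \<le> R1" "\<And>l \<eta>. \<bar>l\<bar> \<le> L \<Longrightarrow> norm (gauss_phase_ft 1 l \<eta>) \<le> R1 * (wt \<eta>)\<^sup>2"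
    using norm_gauss_phase_ft_le[of 1 L] by auto
  obtain R3 where R3: "0 \<le> R3" "\<And>l \<eta>. \<bar>l\<bar> \<le> L \<Longrightarrow> norm (gauss_phase_ft 3 l \<eta>) \<le> R3 * (wt \<eta>)\<^sup>2"
    using norm_gauss_phase_ft_le[of 3 L] by auto
  have H_le: "norm (H t \<eta>) \<le> \<bar>a\<bar> * R1 * (wt \<eta>)\<^sup>2" for t \<eta>
    unfolding H_def norm_mult using R1(2)[OF arg_le] by (simp add: mult.assoc mult_left_mono)
  have H: "unif_decaying (\<bar>a\<bar> * R1) H"
    unfolding unif_decaying_def
  proof (intro conjI allI)
    show "continuous_on UNIV (\<lambda>(t, \<eta>). H t \<eta>)"
      unfolding H_def case_prod_beta
      by (intro continuous_intros continuous_on_pair_compose[OF continuous_on_gauss_phase_ft]) auto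
    show "norm (H t \<eta>) \<le> \<bar>a\<bar> * R1 * wt \<eta>" for t \<eta>
      using H_le[of t \<eta>] mult_left_mono[OF wt_square_le[of \<eta>], of "\<bar>a\<bar> * R1"] R1(1) by simp
  qed
  define S where "S = T * (\<bar>a\<bar> * R1 + \<bar>\<gamma>\<bar> * T * (\<bar>a\<bar> ^ 3 * R3))"
  have S: "0 \<le> S" unfolding S_def using T R1 R3 by auto
  have "norm (duhamel_map \<gamma> p (H 0) H t \<eta> - H t \<eta>) \<le> \<mu> * S * wt \<eta>"
    if \<mu>: "0 \<le> \<mu>" and p: "continuous_on UNIV p" "\<And>\<eta>. \<bar>p \<eta>\<bar> \<le> \<mu> * \<eta>\<^sup>2" and t: "t \<in> {0..T}" for \<mu> p t \<eta>
  proof -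
    define F where "F t' = cubic_conv (H t') \<eta>" for t'
    let ?e = "\<lambda>t. iexp (t * p \<eta>)"
    have F_eq: "F t' = of_real (a ^ 3) * gauss_phase_ft 3 (\<gamma> * a\<^sup>2 * ?\<tau> t') \<eta>" for t'
      unfolding F_def H_def cubic_conv_gauss_phase_ft ..
    have F_le: "norm (F t') \<le> \<bar>a\<bar> ^ 3 * R3 * (wt \<eta>)\<^sup>2" for t'
      unfolding F_eq norm_mult using R3(2)[OF arg_le[of t'], of \<eta>] by (simp add: mult.assoc mult_left_mono norm_power)
    have F_cont: "continuous_on S F" for S
      unfolding F_def by (rule unif_decaying_continuous[OF unif_decaying_cubic_conv[OF H]]) (auto intro: continuous_intros)
    have ode: "H t \<eta> - H 0 \<eta> = - \<i> * of_real \<gamma> * (LBINT t':{0..t}. F t')"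
    proof -
      have "H t \<eta> - H 0 \<eta> = of_real a * (gauss_phase_ft 1 (\<gamma> * a\<^sup>2 * t) \<eta> - gauss_phase_ft 1 0 \<eta>)"
        using t T by (simp add: H_def right_diff_distrib)
      also have "\<dots> = - \<i> * of_real \<gamma> * (of_real (a ^ 3) * (LBINT t':{0..t}. gauss_phase_ft 3 (\<gamma> * a\<^sup>2 * t') \<eta>))"
        using t by (subst gauss_phase_ft_ode) (auto simp: power2_eq_square power3_eq_cube)
      also have "of_real (a ^ 3) * (LBINT t':{0..t}. gauss_phase_ft 3 (\<gamma> * a\<^sup>2 * t') \<eta>) = (LBINT t':{0..t}. F t')"
        unfolding set_integral_mult_right[symmetric]
        by (rule set_lebesgue_integral_cong) (use t T in \<open>auto simp: F_eq\<close>)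
      finally show ?thesis .
    qed
    have i: "set_integrable lborel {0..t} F" "set_integrable lborel {0..t} (\<lambda>t'. ?e (t - t') * F t')"
      by (intro borel_integrable_atLeastAtMost' continuous_intros F_cont)+
    have "duhamel_map \<gamma> p (H 0) H t \<eta> - H t \<eta> = (?e t - 1) * H 0 \<eta>
       - \<i> * of_real \<gamma> * ((LBINT t':{0..t}. ?e (t - t') * F t') - (LBINT t':{0..t}. F t'))"
      using ode unfolding duhamel_map_def F_def by (simp add: algebra_simps)
    also have "(LBINT t':{0..t}. ?e (t - t') * F t') - (LBINT t':{0..t}. F t') =
        (LBINT t':{0..t}. (?e (t - t') - 1) * F t')"
      using i by (simp add: left_diff_distrib set_integral_diff)
    finally have eq: "duhamel_map \<gamma> p (H 0) H t \<eta> - H t \<eta> = (?e t - 1) * H 0 \<eta>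
       - \<i> * of_real \<gamma> * (LBINT t':{0..t}. (?e (t - t') - 1) * F t')" .
    have e_le: "norm (?e r - 1) \<le> T * (\<mu> * \<eta>\<^sup>2)" if "r \<in> {0..T}" for r
    proof -
      have "norm (?e r - 1) \<le> \<bar>r\<bar> * \<bar>p \<eta>\<bar>" using norm_exp_i_minus_1_le[of "r * p \<eta>"] by (simp add: abs_mult)
      also have "\<dots> \<le> T * (\<mu> * \<eta>\<^sup>2)" using that p(2)[of \<eta>] T by (intro mult_mono) auto
      finally show ?thesis .
    qed
    define Y where "Y = T * (\<mu> * \<eta>\<^sup>2) * (\<bar>a\<bar> ^ 3 * R3 * (wt \<eta>)\<^sup>2)"
    have Y: "0 \<le> Y" unfolding Y_def using T \<mu> R3 by auto
    have "norm (LBINT t':{0..t}. (?e (t - t') - 1) * F t') \<le> (LBINT t':{0..t}. Y)"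
      unfolding set_lebesgue_integral_def
    proof (rule norm_integral_complex_bound)
      show "integrable lborel (\<lambda>t'. indicator {0..t} t' *\<^sub>R Y)"
        by (simp add: integrable_indicator_iff emeasure_lborel_Icc_eq)
      show "norm (indicator {0..t} t' *\<^sub>R ((?e (t - t') - 1) * F t')) \<le> indicator {0..t} t' *\<^sub>R Y" for t'
      proof (cases "t' \<in> {0..t}")
        case True
        then have "norm ((?e (t - t') - 1) * F t') \<le> Y"
          unfolding norm_mult Y_def using t T \<mu> by (intro mult_mono e_le F_le) auto
        with True show ?thesis by simp
      qed simp
    qed
    also have "\<dots> = t * Y" using t by (simp add: set_lebesgue_integral_def)
    also have "\<dots> \<le> T * Y" using t Y by (intro mult_right_mono) auto
    finally have I: "norm (LBINT t':{0..t}. (?e (t - t') - 1) * F t') \<le> T * Y" .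
    have "norm (duhamel_map \<gamma> p (H 0) H t \<eta> - H t \<eta>) \<le>
        norm ((?e t - 1) * H 0 \<eta>) + norm (\<i> * of_real \<gamma> * (LBINT t':{0..t}. (?e (t - t') - 1) * F t'))"
      unfolding eq by (rule norm_triangle_ineq4)
    also have "\<dots> \<le> T * (\<mu> * \<eta>\<^sup>2) * (\<bar>a\<bar> * R1 * (wt \<eta>)\<^sup>2) + \<bar>\<gamma>\<bar> * (T * Y)"
    proof (rule add_mono)
      show "norm ((?e t - 1) * H 0 \<eta>) \<le> T * (\<mu> * \<eta>\<^sup>2) * (\<bar>a\<bar> * R1 * (wt \<eta>)\<^sup>2)"
        unfolding norm_mult using t T \<mu> by (intro mult_mono e_le H_le) auto
      show "norm (\<i> * of_real \<gamma> * (LBINT t':{0..t}. (?e (t - t') - 1) * F t')) \<le> \<bar>\<gamma>\<bar> * (T * Y)"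
        using I by (simp add: norm_mult mult_left_mono)
    qed
    also have "\<dots> = \<mu> * S * wt \<eta> * (\<eta>\<^sup>2 * wt \<eta>)"
      unfolding Y_def S_def by (simp add: algebra_simps power2_eq_square)
    also have "\<dots> \<le> \<mu> * S * wt \<eta>"
      using square_wt_le_1[of \<eta>] \<mu> S by (intro mult_left_le) auto
    finally show ?thesis .
  qed
  then show ?thesis using S H by blast
qed

text \<open>The threshold \<mu> depends on the amplitude, on \<gamma>, T and the accuracy \<rho>,
  but not on the symbol p. Hence the frequency, which determines p, can be chosen afterwards and
  jointly for two amplitudes.\<close>

lemma exact_profile:
  fixes a \<gamma> T \<rho> :: real
  assumes T: "0 \<le> T" and \<rho>: "0 < \<rho>"
  shows "\<exists>\<mu>>0. \<forall>p. continuous_on UNIV p \<longrightarrow> (\<forall>\<eta>. \<bar>p \<eta>\<bar> \<le> \<mu> * \<eta>\<^sup>2) \<longrightarrow>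
    (\<exists>A h. unif_decaying A h \<and> h 0 = (\<lambda>\<eta>. of_real a * gauss_phase_ft 1 0 \<eta>) \<and>
       (\<forall>t\<in>{0..T}. \<forall>\<eta>. h t \<eta> = duhamel_map \<gamma> p (h 0) h t \<eta>) \<and>
       (\<forall>\<eta>. norm (h T \<eta> - of_real a * gauss_phase_ft 1 (\<gamma> * a\<^sup>2 * T) \<eta>) \<le> \<rho> * wt \<eta>))"
proof -
  define H where "H t \<eta> = of_real a * gauss_phase_ft 1 (\<gamma> * a\<^sup>2 * max 0 (min T t)) \<eta>" for t \<eta>
  obtain R S where S: "0 \<le> S" and R: "unif_decaying R H"
    and source: "\<And>\<mu> p t \<eta>. 0 \<le> \<mu> \<Longrightarrow> continuous_on UNIV p \<Longrightarrow> (\<And>\<eta>. \<bar>p \<eta>\<bar> \<le> \<mu> * \<eta>\<^sup>2) \<Longrightarrow>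
      t \<in> {0..T} \<Longrightarrow> norm (duhamel_map \<gamma> p (H 0) H t \<eta> - H t \<eta>) \<le> \<mu> * S * wt \<eta>"
    using gauss_profile_source[OF T, of a \<gamma>] unfolding H_def[abs_def] by blast
  define K where "K = 1 + 2 * (\<bar>\<gamma>\<bar> * (48 * pi\<^sup>2 * (R + 1)\<^sup>2))"
  have K: "1 \<le> K" "2 * (\<bar>\<gamma>\<bar> * (48 * pi\<^sup>2 * (R + 1)\<^sup>2)) \<le> K" by (simp_all add: K_def)
  \<comment> \<open>Chosen so that 2 \<mu> S exp (K T) is at most 1, as the fixed point argument
    demands, and at most the accuracy \<rho>; S + 1 in place of S keeps the denominator
    positive.\<close>
  define \<mu> where "\<mu> = min 1 \<rho> / (2 * (S + 1) * exp (K * T))"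
  have \<mu>: "0 < \<mu>" using S \<rho> by (simp add: \<mu>_def)
  have small: "2 * (\<mu> * S) * exp (K * T) \<le> min 1 \<rho>"
  proof -
    have "2 * (\<mu> * S) * exp (K * T) \<le> 2 * (\<mu> * (S + 1)) * exp (K * T)"
      using \<mu> by (intro mult_right_mono mult_left_mono) auto
    also have "\<dots> = min 1 \<rho>"
    proof -
      have *: "2 * (x / (2 * A * E) * A) * E = x" if "0 < A" "0 < E" for x A E :: real
        using that by simp
      show ?thesis unfolding \<mu>_def by (rule *) (use S in auto)
    qed
    finally show ?thesis .
  qed
  show ?thesis
  proof (rule exI[of _ \<mu>], intro conjI allI impI \<mu>)
    fix p assume p: "continuous_on UNIV p" "\<forall>\<eta>. \<bar>p \<eta>\<bar> \<le> \<mu> * \<eta>\<^sup>2"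
    obtain h where h: "unif_decaying (R + 1) h"
      "\<And>t \<eta>. t \<in> {0..T} \<Longrightarrow> h t \<eta> = duhamel_map \<gamma> p (h 0) h t \<eta>"
      "\<And>t \<eta>. t \<in> {0..T} \<Longrightarrow> norm (h t \<eta> - H t \<eta>) \<le> 2 * (\<mu> * S) * exp (K * T) * wt \<eta>" "h 0 = H 0"
      using duhamel_fixed_point[OF T p(1) R _ K source[of \<mu> p]] \<mu> S p small by fastforce
    have "norm (h T \<eta> - of_real a * gauss_phase_ft 1 (\<gamma> * a\<^sup>2 * T) \<eta>) \<le> \<rho> * wt \<eta>" for \<eta>
      using h(3)[of T \<eta>] mult_right_mono[OF order_trans[OF small min.cobounded2] wt_nonneg[of \<eta>]] T
      by (simp add: H_def)
    moreover have "h 0 = (\<lambda>\<eta>. of_real a * gauss_phase_ft 1 0 \<eta>)"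
      using h(4) T by (simp add: H_def fun_eq_iff)
    ultimately show "\<exists>A h. unif_decaying A h \<and> h 0 = (\<lambda>\<eta>. of_real a * gauss_phase_ft 1 0 \<eta>) \<and>
       (\<forall>t\<in>{0..T}. \<forall>\<eta>. h t \<eta> = duhamel_map \<gamma> p (h 0) h t \<eta>) \<and>
       (\<forall>\<eta>. norm (h T \<eta> - of_real a * gauss_phase_ft 1 (\<gamma> * a\<^sup>2 * T) \<eta>) \<le> \<rho> * wt \<eta>)"
      using h(1,2) by blast
  qed
qed

section \<open>Separation in L^2 of two rotated Gaussians\<close>

lemma plancherel:
  assumes f: "decaying A f" and Ff: "integrable lborel (fourier f)"
  shows "(LBINT \<xi>. (norm (fourier f \<xi>))\<^sup>2) = 2 * pi * (LBINT x. (norm (f x))\<^sup>2)"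
proof -
  have cnj_f: "integrable lborel (\<lambda>x. cnj (f x))" using decaying_integrable[OF f] by simp
  have inv: "inverse_fourier (fourier f) x = f x" for x
    by (rule fourier_inversion[OF decayingD(1)[OF f] decaying_bounded[OF f] decaying_integrable[OF f] Ff])
  have c: "inverse_fourier (\<lambda>x. cnj (f x)) \<xi> = of_real (1 / (2 * pi)) * cnj (fourier f \<xi>)" for \<xi>
    by (simp add: inverse_fourier_eq fourier_cnj)
  \<comment> \<open>The exchange formula for the inverse transform, applied to
    \<open>fourier f\<close> and the conjugate of \<open>f\<close>.\<close>
  have "(LBINT x. f x * cnj (f x)) = (LBINT \<xi>. fourier f \<xi> * (of_real (1 / (2 * pi)) * cnj (fourier f \<xi>)))"
    using inverse_fourier_multiplication_formula[OF Ff cnj_f] unfolding inv c .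
  then have "complex_of_real (LBINT x. (norm (f x))\<^sup>2) =
      of_real (1 / (2 * pi)) * of_real (LBINT \<xi>. (norm (fourier f \<xi>))\<^sup>2)"
    unfolding mult.left_commute[of _ "of_real (1 / (2 * pi))"] integral_mult_right_zero
      complex_norm_square[symmetric] integral_complex_of_real .
  then have "(LBINT x. (norm (f x))\<^sup>2) = 1 / (2 * pi) * (LBINT \<xi>. (norm (fourier f \<xi>))\<^sup>2)"
    unfolding of_real_mult[symmetric] of_real_eq_iff .
  then show ?thesis by simp
qed

lemma norm_add_square_ge:
  fixes x y :: complex
  shows "(norm x)\<^sup>2 / 2 - (norm y)\<^sup>2 \<le> (norm (x + y))\<^sup>2"
proof -
  have "norm x \<le> norm (x + y) + norm y"
    using norm_triangle_ineq4[of "x + y" y] by simp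
  then have "(norm x)\<^sup>2 \<le> (norm (x + y) + norm y)\<^sup>2" by (intro power_mono) auto
  also have "\<dots> \<le> 2 * ((norm (x + y))\<^sup>2 + (norm y)\<^sup>2)"
    using zero_le_power2[of "norm (x + y) - norm y"] by (simp add: power2_eq_square algebra_simps)
  finally show ?thesis by simp
qed

lemma decaying_square_integrable: "decaying A f \<Longrightarrow> integrable lborel (\<lambda>x. (norm (f x))\<^sup>2)"
  using sobolev_integrable[of A f 0] by (simp add: one_plus_square_nonzero)

text \<open>Measured in the space variable, with G = exp(- y^2 / 2), the phase difference
  contributes at least a^2 G^6 / 18 and the amplitude difference removes at most (a - a')^2 G^2.
  Integrated, these are at least a^2 sqrt pi / 36 and at most a^2 sqrt pi / 144, which explains the
  threshold 1 / 12. What remains, a^2 sqrt pi / 48, is divided by 2 pi in Plancherel's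
  formula.\<close>

lemma gauss_phase_ft_diff_ge:
  assumes l: "2 / 3 \<le> \<bar>l - l'\<bar>" "\<bar>l - l'\<bar> \<le> 1" and a: "\<bar>a - a'\<bar> \<le> \<bar>a\<bar> / 12"
  shows "a\<^sup>2 / (96 * sqrt pi) \<le>
    (LBINT \<eta>. (norm (of_real a * gauss_phase_ft 1 l \<eta> - of_real a' * gauss_phase_ft 1 l' \<eta>))\<^sup>2)"
proof -
  let ?P = "gauss_phase 1"
  define f where "f y = of_real a * ?P l y - of_real a' * ?P l' y" for y
  have dP: "decaying 2 (?P l)" for l by (rule decaying_gauss_phase) simp
  have daP: "decaying (\<bar>a\<bar> * 2) (\<lambda>y. of_real a * ?P l y)" for a l by (rule decaying_mult[OF dP]) auto
  have f: "decaying (\<bar>a\<bar> * 2 + \<bar>a'\<bar> * 2) f"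
    unfolding f_def by (rule decaying_diff[OF daP daP])
  have Ff: "fourier f \<eta> = of_real (2 * pi) * (of_real a * gauss_phase_ft 1 l \<eta> - of_real a' * gauss_phase_ft 1 l' \<eta>)" for \<eta>
    unfolding f_def fourier_diff[OF decaying_integrable[OF daP] decaying_integrable[OF daP]] fourier_mult gauss_phase_ft_def
    by (simp add: right_diff_distrib)
  have Ffi: "integrable lborel (fourier f)"
  proof -
    obtain R R' where "decaying R (gauss_phase_ft 1 l)" "decaying R' (gauss_phase_ft 1 l')"
      using decaying_gauss_phase_ft[of 1] by blast
    then show ?thesis unfolding Ff
      by (intro integrable_mult_right Bochner_Integration.integrable_diff decaying_integrable)
  qed
  have pw: "a\<^sup>2 / 18 * exp (- (6 * y\<^sup>2) / 2) - (a - a')\<^sup>2 * exp (- (2 * y\<^sup>2) / 2) \<le> (norm (f y))\<^sup>2" for y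
  proof -
    define g where "g = exp (- (1 * y\<^sup>2) / 2)"
    have g: "g\<^sup>2 = exp (- y\<^sup>2)" "g\<^sup>2 = exp (- (2 * y\<^sup>2) / 2)" "g ^ 6 = exp (- (6 * y\<^sup>2) / 2)"
      unfolding g_def exp_of_nat_mult[symmetric] by simp_all
    \<comment> \<open>The relative phase at y. The upper bound 1 on the phase gap keeps |\<theta>|
      \<le> 1, so no rotation wraps around and |exp(i \<theta>) - 1| is at least |\<theta>| /
      2.\<close>
    define \<theta> where "\<theta> = (l' - l) * g\<^sup>2"
    have th: "\<bar>\<theta>\<bar> \<le> 1" "2 / 3 * g\<^sup>2 \<le> \<bar>\<theta>\<bar>"
    proof -
      have "g\<^sup>2 \<le> 1" unfolding g(1) by simp
      then show "\<bar>\<theta>\<bar> \<le> 1" using l(2) mult_mono[of "\<bar>l' - l\<bar>" 1 "g\<^sup>2" 1] by (simp add: \<theta>_def abs_mult abs_minus_commute)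
      show "2 / 3 * g\<^sup>2 \<le> \<bar>\<theta>\<bar>" using l(1) mult_right_mono[of "2/3" "\<bar>l' - l\<bar>" "g\<^sup>2"] by (simp add: \<theta>_def abs_mult abs_minus_commute)
    qed
    have "?P l y = ?P l' y * iexp \<theta>"
    proof -
      have "exp (- \<i> * of_real (l * exp (- y\<^sup>2))) = exp (- \<i> * of_real (l' * exp (- y\<^sup>2))) * iexp \<theta>"
        unfolding exp_add[symmetric] \<theta>_def g(1) by (rule arg_cong[where f = exp]) (simp add: algebra_simps)
      then show ?thesis unfolding gauss_phase_def by (simp only: mult.assoc)
    qed
    then have "?P l y - ?P l' y = ?P l' y * (iexp \<theta> - 1)" by (simp add: right_diff_distrib)
    then have "norm (?P l y - ?P l' y) = g * norm (iexp \<theta> - 1)"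
      by (simp add: norm_mult norm_gauss_phase g_def)
    also have "\<dots> \<ge> g * (g\<^sup>2 / 3)"
      using norm_exp_i_minus_1_ge[OF th(1)] th(2) by (intro mult_left_mono) (auto simp: g_def)
    finally have d: "g ^ 3 / 3 \<le> norm (?P l y - ?P l' y)" by (simp add: power2_eq_square power3_eq_cube)
    have "f y = of_real a * (?P l y - ?P l' y) + of_real (a - a') * ?P l' y"
      by (simp add: f_def algebra_simps)
    then have "(norm (of_real a * (?P l y - ?P l' y)))\<^sup>2 / 2 - (norm (of_real (a - a') * ?P l' y))\<^sup>2 \<le> (norm (f y))\<^sup>2"
      using norm_add_square_ge by metis
    moreover have "(norm (of_real (a - a') * ?P l' y))\<^sup>2 = (a - a')\<^sup>2 * g\<^sup>2"
      unfolding norm_mult norm_of_real norm_gauss_phase g_def power_mult_distrib power2_abs by simp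
    moreover have "a\<^sup>2 * (g ^ 6 / 9) \<le> (norm (of_real a * (?P l y - ?P l' y)))\<^sup>2"
    proof -
      have "a\<^sup>2 * (g ^ 3 / 3)\<^sup>2 \<le> a\<^sup>2 * (norm (?P l y - ?P l' y))\<^sup>2"
        using d by (intro mult_left_mono power_mono) (auto simp: g_def)
      moreover have "(g ^ 3 / 3)\<^sup>2 = g ^ 6 / 9" by (simp add: power_divide flip: power_mult)
      ultimately show ?thesis by (simp add: norm_mult power_mult_distrib)
    qed
    ultimately show ?thesis unfolding g(2)[symmetric] g(3)[symmetric] by linarith
  qed
  have I6: "sqrt pi / 2 \<le> (LBINT y. exp (- (6 * y\<^sup>2) / 2))"
  proof -
    have "sqrt (pi / 4) \<le> sqrt (2 * pi / 6)" using pi_gt_zero by (intro real_sqrt_le_mono) simp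
    then show ?thesis using integrable_gaussian(2)[of 6] by (simp add: real_sqrt_divide)
  qed
  have I2: "(LBINT y. exp (- (2 * y\<^sup>2) / 2)) = sqrt pi"
    using integrable_gaussian(2)[of 2] by simp
  have aa: "(a - a')\<^sup>2 \<le> a\<^sup>2 / 144"
    using power_mono[OF a, of 2] by (simp add: power_divide)
  have "a\<^sup>2 / 48 * sqrt pi \<le> a\<^sup>2 / 18 * (sqrt pi / 2) - a\<^sup>2 / 144 * sqrt pi" by simp
  also have "\<dots> \<le> a\<^sup>2 / 18 * (LBINT y. exp (- (6 * y\<^sup>2) / 2)) - (a - a')\<^sup>2 * (LBINT y. exp (- (2 * y\<^sup>2) / 2))"
    unfolding I2 by (intro diff_mono mult_left_mono mult_right_mono I6 aa) auto
  also have "\<dots> = (LBINT y. a\<^sup>2 / 18 * exp (- (6 * y\<^sup>2) / 2) - (a - a')\<^sup>2 * exp (- (2 * y\<^sup>2) / 2))"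
    using integrable_gaussian(1)[of 6] integrable_gaussian(1)[of 2]
    by (subst Bochner_Integration.integral_diff) auto
  also have "\<dots> \<le> (LBINT y. (norm (f y))\<^sup>2)"
    using integrable_gaussian(1)[of 6] integrable_gaussian(1)[of 2]
    by (intro integral_mono pw decaying_square_integrable[OF f] Bochner_Integration.integrable_diff integrable_mult_right) auto
  finally have lower: "a\<^sup>2 / 48 * sqrt pi \<le> (LBINT y. (norm (f y))\<^sup>2)" .
  let ?I = "LBINT \<eta>. (norm (of_real a * gauss_phase_ft 1 l \<eta> - of_real a' * gauss_phase_ft 1 l' \<eta>))\<^sup>2"
  have "(2 * pi)\<^sup>2 * ?I = 2 * pi * (LBINT y. (norm (f y))\<^sup>2)"
    using plancherel[OF f Ffi] unfolding Ff norm_mult power_mult_distrib by simp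
  then have "2 * pi * ?I = (LBINT y. (norm (f y))\<^sup>2)"
    by (simp add: power2_eq_square)
  with lower have "a\<^sup>2 / 48 * sqrt pi \<le> 2 * pi * ?I" by simp
  then have "a\<^sup>2 / 48 * sqrt pi / (2 * pi) \<le> ?I" by (simp add: divide_le_eq mult.commute)
  moreover have "a\<^sup>2 / 48 * sqrt pi / (2 * pi) = a\<^sup>2 / (96 * sqrt pi)"
  proof -
    have "pi = sqrt pi * sqrt pi" by simp
    then show ?thesis by (simp add: divide_simps)
  qed
  ultimately show ?thesis by simp
qed

section \<open>Symbol, Sobolev weight and convolution at high frequency\<close>

text \<open>Weighted arithmetic-geometric mean of 1 + x and 1.\<close>

lemma powr_le_Bernoulli:
  fixes x b :: real
  assumes "0 \<le> b" "b \<le> 1" "-1 \<le> x"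
  shows "(1 + x) powr b \<le> 1 + b * x"
proof (cases "x = -1")
  case False
  then show ?thesis
    using Youngs_inequality_0[of b "1 - b" "1 + x" 1] assms by (simp add: algebra_simps)
qed (use assms in auto)

text \<open>Where the left side is positive, this is the preceding inequality for the exponent 1 / b
  at b x, raised to the power b.\<close>

lemma Bernoulli_le_powr:
  fixes x b :: real
  assumes "1 \<le> b" "-1 \<le> x"
  shows "1 + b * x \<le> (1 + x) powr b"
proof (cases "1 + b * x \<le> 0")
  case True
  also have "0 \<le> (1 + x) powr b" by simp
  finally show ?thesis .
next
  case False
  have "(1 + b * x) powr (1 / b) \<le> 1 + x"
    using powr_le_Bernoulli[of "1 / b" "b * x"] assms False by (simp add: divide_simps)
  then have "((1 + b * x) powr (1 / b)) powr b \<le> (1 + x) powr b"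
    using assms by (intro powr_mono2) auto
  then show ?thesis using False assms by (simp add: powr_powr)
qed

text \<open>For \<alpha> < 2 the second derivative of the symbol blows up at x = -1, so a bound by
  its supremum fails. To the right of -1, Bernoulli's inequality bounds the power from below, and,
  after one factor 1 + x is split off, from above. To the left of -1 every term is of order
  x^2.\<close>

lemma powr_abs_taylor_1:
  fixes x \<alpha> :: real
  assumes \<alpha>: "1 < \<alpha>" "\<alpha> < 2"
  shows "\<bar>\<bar>1 + x\<bar> powr \<alpha> - 1 - \<alpha> * x\<bar> \<le> 8 * x\<^sup>2"
proof (cases "-1 \<le> x")
  case True
  have "1 + \<alpha> * x \<le> (1 + x) powr \<alpha>" using Bernoulli_le_powr[of \<alpha> x] \<alpha> True by simp
  moreover have "(1 + x) powr \<alpha> \<le> 1 + \<alpha> * x + x\<^sup>2"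
  proof -
    have "(1 + x) powr \<alpha> = (1 + x) powr (1 + (\<alpha> - 1))" by simp
    also have "\<dots> = (1 + x) * (1 + x) powr (\<alpha> - 1)" unfolding powr_add using True by simp
    also have "\<dots> \<le> (1 + x) * (1 + (\<alpha> - 1) * x)"
      using powr_le_Bernoulli[of "\<alpha> - 1" x] \<alpha> True by (intro mult_left_mono) auto
    also have "\<dots> = 1 + \<alpha> * x + (\<alpha> - 1) * x\<^sup>2" by (simp add: power2_eq_square algebra_simps)
    also have "(\<alpha> - 1) * x\<^sup>2 \<le> 1 * x\<^sup>2" using \<alpha> by (intro mult_right_mono) auto
    finally show ?thesis by simp
  qed
  ultimately show ?thesis using True zero_le_power2[of x] by simp
next
  case False
  define y where "y = - x"
  have y: "1 < y" and x: "x = - y" using False by (auto simp: y_def)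
  have yy1: "y \<le> y * y" using mult_right_mono[of 1 y y] y by simp
  have yy: "y \<le> y * y" "1 \<le> y * y" using yy1 y by linarith+
  have "\<bar>1 + x\<bar> powr \<alpha> \<le> y powr \<alpha>" using y \<alpha> by (intro powr_mono2) (auto simp: x)
  also have "\<dots> \<le> y powr 2" using y \<alpha> by (intro powr_mono) auto
  also have "\<dots> = y * y" using y by (simp add: power2_eq_square)
  finally have 1: "\<bar>1 + x\<bar> powr \<alpha> \<le> y * y" .
  have "\<alpha> * y \<le> 2 * y" "0 \<le> \<alpha> * y" using \<alpha> y by auto
  then have "\<bar>\<bar>1 + x\<bar> powr \<alpha> - 1 - \<alpha> * x\<bar> \<le> y * y + 1 + 2 * y"
    using 1 by (simp add: x abs_le_iff) (smt (verit) powr_ge_zero)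
  also have "\<dots> \<le> 8 * x\<^sup>2" using yy unfolding x power2_eq_square by simp
  finally show ?thesis .
qed

lemma symbol_taylor:
  fixes N h \<alpha> :: real
  assumes \<alpha>: "1 < \<alpha>" "\<alpha> < 2" and N: "0 < N"
  shows "\<bar>\<bar>N + h\<bar> powr \<alpha> - N powr \<alpha> - \<alpha> * N powr (\<alpha> - 1) * h\<bar> \<le> 8 * N powr (\<alpha> - 2) * h\<^sup>2"
proof -
  have 1: "N powr (\<alpha> - 1) = N powr \<alpha> / N" "N powr (\<alpha> - 2) = N powr \<alpha> / N\<^sup>2"
    using N by (auto simp: powr_diff)
  have "N + h = N * (1 + h / N)" using N by (simp add: field_simps)
  then have "\<bar>N + h\<bar> = N * \<bar>1 + h / N\<bar>" using N by (simp add: abs_mult)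
  then have 2: "\<bar>N + h\<bar> powr \<alpha> = N powr \<alpha> * \<bar>1 + h / N\<bar> powr \<alpha>"
    using N by (simp add: powr_mult)
  have "\<bar>N + h\<bar> powr \<alpha> - N powr \<alpha> - \<alpha> * N powr (\<alpha> - 1) * h = N powr \<alpha> * (\<bar>1 + h / N\<bar> powr \<alpha> - 1 - \<alpha> * (h / N))"
    unfolding 1 2 by (simp add: algebra_simps)
  then have "\<bar>\<bar>N + h\<bar> powr \<alpha> - N powr \<alpha> - \<alpha> * N powr (\<alpha> - 1) * h\<bar> = N powr \<alpha> * \<bar>\<bar>1 + h / N\<bar> powr \<alpha> - 1 - \<alpha> * (h / N)\<bar>"
    by (simp add: abs_mult)
  also have "\<dots> \<le> N powr \<alpha> * (8 * (h / N)\<^sup>2)"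
    by (intro mult_left_mono powr_abs_taylor_1 \<alpha>) auto
  also have "\<dots> = 8 * N powr (\<alpha> - 2) * h\<^sup>2" unfolding 1 by (simp add: power_divide)
  finally show ?thesis .
qed

text \<open>For \<open>s < 0\<close> this is Peetre's inequality.\<close>

lemma sobolev_weight_upper:
  fixes N L \<eta> s :: real
  assumes s: "\<bar>s\<bar> \<le> 1" and N: "1 \<le> N" and L: "0 < L" "1 \<le> N * L" "s < 0 \<Longrightarrow> 1 \<le> L"
  shows "(1 + \<bar>N + \<eta> / L\<bar>\<^sup>2) powr s \<le> 5 * N powr (2 * s) * (1 + \<eta>\<^sup>2)"
proof -
  define X where "X = 1 + (N + \<eta> / L)\<^sup>2"
  define Y where "Y = 1 + \<eta>\<^sup>2"
  have sq_add: "(p + q)\<^sup>2 \<le> 2 * p\<^sup>2 + 2 * q\<^sup>2" for p q :: real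
    using zero_le_power2[of "p - q"] by (simp add: power2_eq_square algebra_simps)
  have X: "1 \<le> X" and Y: "1 \<le> Y" by (auto simp: X_def Y_def)
  have N2: "(N\<^sup>2) powr r = N powr (2 * r)" for r
    using N by (simp add: powr_power[symmetric] powr_powr flip: powr_numeral)
  have "X powr s \<le> 5 * N powr (2 * s) * Y"
  proof (cases "0 \<le> s")
    case True
    have "(\<eta> / L)\<^sup>2 \<le> N\<^sup>2 * \<eta>\<^sup>2"
    proof -
      have "\<bar>\<eta>\<bar> * 1 \<le> \<bar>\<eta>\<bar> * (N * L)" using L by (intro mult_left_mono) auto
      then have "\<bar>\<eta> / L\<bar> \<le> \<bar>N * \<eta>\<bar>" using L N by (simp add: abs_mult divide_le_eq mult_ac)
      then show ?thesis using abs_le_square_iff power_mult_distrib by metis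
    qed
    moreover have "1 \<le> N\<^sup>2" using N by simp
    moreover have "(N + \<eta> / L)\<^sup>2 \<le> 2 * N\<^sup>2 + 2 * (\<eta> / L)\<^sup>2"
      by (rule sq_add)
    ultimately have "X \<le> N\<^sup>2 + 2 * N\<^sup>2 + 2 * (N\<^sup>2 * \<eta>\<^sup>2)" unfolding X_def by linarith
    also have "\<dots> \<le> 5 * (N\<^sup>2 * Y)" unfolding Y_def by (simp add: algebra_simps)
    finally have "X powr s \<le> (5 * (N\<^sup>2 * Y)) powr s" using X True by (intro powr_mono2) auto
    also have "\<dots> = 5 powr s * (N powr (2 * s) * Y powr s)" using N Y by (simp add: powr_mult N2)
    also have "\<dots> \<le> 5 powr 1 * (N powr (2 * s) * Y powr 1)"
      using powr_mono[of s 1 5] powr_mono[of s 1 Y] s Y by (intro mult_mono order_refl) auto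
    finally show ?thesis using Y by (simp add: mult_ac)
  next
    case False
    then have L1: "1 \<le> L" using L by simp
    have "(\<eta> / L)\<^sup>2 \<le> \<eta>\<^sup>2"
    proof -
      have "\<bar>\<eta>\<bar> * 1 \<le> \<bar>\<eta>\<bar> * L" using L1 by (intro mult_left_mono) auto
      then have "\<bar>\<eta> / L\<bar> \<le> \<bar>\<eta>\<bar>" using L1 by (simp add: divide_le_eq)
      then show ?thesis using abs_le_square_iff by blast
    qed
    moreover have "N\<^sup>2 \<le> 2 * (N + \<eta> / L)\<^sup>2 + 2 * (\<eta> / L)\<^sup>2"
      using sq_add[of "N + \<eta> / L" "- (\<eta> / L)"] by simp
    ultimately have "N\<^sup>2 \<le> 2 * (N + \<eta> / L)\<^sup>2 + 2 * \<eta>\<^sup>2"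
      by (meson add_left_mono mult_left_mono order_trans zero_le_numeral)
    then have "N\<^sup>2 \<le> 2 * X + 2 * Y" unfolding X_def Y_def by simp
    also have "\<dots> \<le> 5 * (X * Y)"
    proof -
      have "0 \<le> (X - 1) * (Y - 1)" using X Y by simp
      then have "X + Y \<le> X * Y + 1" by (simp add: algebra_simps)
      moreover have "1 \<le> X * Y" using mult_mono[OF X Y] X by simp
      ultimately show ?thesis by linarith
    qed
    finally have "(N\<^sup>2) powr (- s) \<le> (5 * (X * Y)) powr (- s)" using False by (intro powr_mono2) auto
    also have "\<dots> = 5 powr (- s) * (X powr (- s) * Y powr (- s))" using X Y by (simp add: powr_mult)
    also have "\<dots> \<le> 5 powr 1 * (X powr (- s) * Y powr 1)"
      using powr_mono[of "- s" 1 5] powr_mono[of "- s" 1 Y] s Y by (intro mult_mono order_refl) auto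
    finally have "N powr (2 * (- s)) \<le> 5 * (X powr (- s) * Y)" using Y by (simp only: N2) simp
    then have "N powr (2 * (- s)) * (N powr (2 * s) * X powr s) \<le> 5 * (X powr (- s) * Y) * (N powr (2 * s) * X powr s)"
      by (rule mult_right_mono) simp
    then have "(N powr (- (2 * s)) * N powr (2 * s)) * X powr s \<le> 5 * N powr (2 * s) * Y * (X powr (- s) * X powr s)"
      by (simp add: mult_ac)
    then show ?thesis using N X by (simp add: powr_add[symmetric])
  qed
  then show ?thesis by (simp add: X_def Y_def)
qed

text \<open>For |\<eta>| \<le> N L / 2 the frequency N + \<eta> / L is comparable to N. Beyond that
  range the factor 1 - 4 \<eta>^2 / (N L)^2 is not positive and nothing is claimed. This parabola
  replaces a cutoff and is easy to integrate against a decaying profile.\<close>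

lemma sobolev_weight_lower:
  fixes N L \<eta> s :: real
  assumes s: "\<bar>s\<bar> \<le> 1" and N: "1 \<le> N" and L: "0 < L"
  shows "N powr (2 * s) / 4 * (1 - 4 * \<eta>\<^sup>2 / (N * L)\<^sup>2) \<le> (1 + \<bar>N + \<eta> / L\<bar>\<^sup>2) powr s"
proof (cases "2 * \<bar>\<eta>\<bar> \<le> N * L")
  case True
  define X where "X = 1 + (N + \<eta> / L)\<^sup>2"
  have N2: "(N\<^sup>2) powr r = N powr (2 * r)" for r
    using N by (simp add: powr_power[symmetric] powr_powr flip: powr_numeral)
  have e: "\<bar>\<eta> / L\<bar> \<le> N / 2" using True L by (simp add: divide_le_eq mult_ac)
  then have bds: "N / 2 \<le> N + \<eta> / L" "N + \<eta> / L \<le> 3 / 2 * N"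
    unfolding abs_le_iff by linarith+
  have "(N / 2)\<^sup>2 \<le> (N + \<eta> / L)\<^sup>2" "(N + \<eta> / L)\<^sup>2 \<le> (3 / 2 * N)\<^sup>2"
    using N bds by (intro power_mono; linarith)+
  moreover have "(3 / 2 * N)\<^sup>2 = 9 / 4 * N\<^sup>2" "(N / 2)\<^sup>2 = N\<^sup>2 / 4" by (auto simp: power_mult_distrib power_divide)
  moreover have "1 \<le> N\<^sup>2" using N by simp
  ultimately have X: "N\<^sup>2 / 4 \<le> X" "X \<le> 4 * N\<^sup>2" unfolding X_def by linarith+
  have "N powr (2 * s) / 4 \<le> X powr s"
  proof (cases "0 \<le> s")
    case True
    have "N powr (2 * s) / 4 \<le> N powr (2 * s) / 4 powr s"
      using powr_mono[of s 1 4] s by (intro divide_left_mono) auto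
    also have "\<dots> = (N\<^sup>2 / 4) powr s" using N by (simp add: powr_divide N2)
    also have "\<dots> \<le> X powr s" using X True by (intro powr_mono2) auto
    finally show ?thesis .
  next
    case False
    have "1 / 4 = (4 :: real) powr (-1)" by (simp add: powr_minus_divide)
    also have "\<dots> \<le> 4 powr s" using s by (intro powr_mono) auto
    finally have "N powr (2 * s) * (1 / 4) \<le> N powr (2 * s) * 4 powr s" by (rule mult_left_mono) simp
    also have "\<dots> = (4 * N\<^sup>2) powr s" using N by (simp add: powr_mult N2)
    also have "\<dots> \<le> X powr s"
      using X False by (intro powr_mono2') (auto simp: X_def add_pos_nonneg)
    finally show ?thesis by simp
  qed
  moreover have "N powr (2 * s) / 4 * (1 - 4 * \<eta>\<^sup>2 / (N * L)\<^sup>2) \<le> N powr (2 * s) / 4"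
    by (rule mult_left_le) auto
  ultimately show ?thesis by (simp add: X_def)
next
  case False
  have "(N * L)\<^sup>2 \<le> (2 * \<bar>\<eta>\<bar>)\<^sup>2" using False N L by (intro power_mono) auto
  then have "1 \<le> 4 * \<eta>\<^sup>2 / (N * L)\<^sup>2" using N L by (simp add: power_mult_distrib le_divide_eq)
  then have "N powr (2 * s) / 4 * (1 - 4 * \<eta>\<^sup>2 / (N * L)\<^sup>2) \<le> 0"
    by (intro mult_nonneg_nonpos) auto
  then show ?thesis by (rule order_trans) simp
qed

section \<open>Convolutions of modulated, translated and rescaled functions\<close>

lemma conv_mult: "conv (\<lambda>x. c * f x) (\<lambda>x. d * g x) x = c * d * conv f g x"
  unfolding conv_def by (subst integral_mult_right_zero[symmetric]) (simp add: mult_ac)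

text \<open>A linear phase passes through a convolution because \<theta> a + \<theta> (x - a) =
  \<theta> x; the centres add, and the rescaling costs one factor 1 / L.\<close>

lemma conv_modulated_affine:
  assumes L: "0 < L"
  shows "conv (\<lambda>x. iexp (\<theta> * x) * F (L * (x - A))) (\<lambda>x. iexp (\<theta> * x) * G (L * (x - B))) x
    = of_real (1 / L) * (iexp (\<theta> * x) * conv F G (L * (x - (A + B))))"
proof -
  have e: "iexp (\<theta> * a) * iexp (\<theta> * (x - a)) = iexp (\<theta> * x)" for a
    unfolding exp_add[symmetric] by (rule arg_cong[where f = exp]) (simp add: algebra_simps)
  have "iexp (\<theta> * a) * F (L * (a - A)) * (iexp (\<theta> * (x - a)) * G (L * (x - a - B)))
     = iexp (\<theta> * x) * (F (L * (a - A)) * G (L * (x - a - B)))" for a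
    unfolding e[of a, symmetric] by (simp only: mult_ac)
  then have "conv (\<lambda>x. iexp (\<theta> * x) * F (L * (x - A))) (\<lambda>x. iexp (\<theta> * x) * G (L * (x - B))) x
    = iexp (\<theta> * x) * (LBINT a. F (L * (a - A)) * G (L * (x - a - B)))"
    unfolding conv_def by (simp only: integral_mult_right_zero)
  also have "(LBINT a. F (L * (a - A)) * G (L * (x - a - B))) =
      \<bar>1 / L\<bar> *\<^sub>R (LBINT b. F (L * (A + 1 / L * b - A)) * G (L * (x - (A + 1 / L * b) - B)))"
    using L by (subst lborel_integral_real_affine[where c = "1 / L" and t = A]) auto
  also have "(\<lambda>b. F (L * (A + 1 / L * b - A)) * G (L * (x - (A + 1 / L * b) - B))) = (\<lambda>b. F b * G (L * (x - (A + B)) - b))"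
    using L by (auto simp: fun_eq_iff algebra_simps)
  finally show ?thesis using L by (simp add: conv_def scaleR_conv_of_real)
qed

text \<open>The centres N, -N, N add up to N, and the constant phases k, \<open>cnj k\<close>, k
  multiply to k. The cubic term therefore returns a packet at the same frequency with the same
  affine phase.\<close>

lemma cubic_conv_modulated_affine:
  assumes L: "0 < L"
  shows "cubic_conv (\<lambda>x. of_real c * (iexp (\<theta>\<^sub>0 + \<theta> * (x - N)) * F (L * (x - N)))) x
    = of_real (c ^ 3 / L\<^sup>2) * (iexp (\<theta>\<^sub>0 + \<theta> * (x - N)) * cubic_conv F (L * (x - N)))"
proof -
  define k where "k = iexp (\<theta>\<^sub>0 - \<theta> * N)"
  define f where "f x = iexp (\<theta> * x) * F (L * (x - N))" for x
  define F' where "F' x = cnj (F (- x))" for x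
  define f' where "f' x = iexp (\<theta> * x) * F' (L * (x - (- N)))" for x
  have kk: "k * cnj k = 1"
    unfolding k_def exp_cnj exp_add[symmetric] by simp
  have split: "iexp (\<theta>\<^sub>0 + \<theta> * (x - N)) = k * iexp (\<theta> * x)" for x
    unfolding k_def exp_add[symmetric] by (rule arg_cong[where f = exp]) (simp add: algebra_simps)
  have 1: "(\<lambda>x. of_real c * (iexp (\<theta>\<^sub>0 + \<theta> * (x - N)) * F (L * (x - N)))) = (\<lambda>x. (of_real c * k) * f x)"
    unfolding split f_def by (simp only: mult.assoc)
  have 2: "cnj ((of_real c * k) * f (- x)) = (of_real c * cnj k) * f' x" for x
  proof -
    have "L * (- x - N) = - (L * (x - - N))" by (simp add: algebra_simps)
    then show ?thesis by (simp add: f_def f'_def F'_def exp_cnj)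
  qed
  have 3: "conv f f' = (\<lambda>x. of_real (1 / L) * (iexp (\<theta> * x) * conv F F' (L * (x - 0))))"
    unfolding f_def f'_def by (rule ext) (subst conv_modulated_affine[OF L], simp)
  have 4: "conv (\<lambda>x. iexp (\<theta> * x) * conv F F' (L * (x - 0))) f x
      = of_real (1 / L) * (iexp (\<theta> * x) * conv (conv F F') F (L * (x - N)))" for x
    unfolding f_def by (subst conv_modulated_affine[OF L]) simp
  have 5: "conv (\<lambda>x. (of_real c * k) * f x) (\<lambda>x. (of_real c * cnj k) * f' x) = (\<lambda>x. (of_real (c\<^sup>2 / L)) * (iexp (\<theta> * x) * conv F F' (L * (x - 0))))"
  proof
    fix x
    have "(of_real c * k) * (of_real c * cnj k) * (of_real (1 / L)) = of_real (c * c * (1 / L)) * (k * cnj k)"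
      by (simp only: of_real_mult mult_ac)
    also have "\<dots> = of_real (c\<^sup>2 / L)" unfolding kk by (simp add: power2_eq_square)
    finally have *: "(of_real c * k) * (of_real c * cnj k) * (of_real (1 / L)) = of_real (c\<^sup>2 / L)" .
    show "conv (\<lambda>x. (of_real c * k) * f x) (\<lambda>x. (of_real c * cnj k) * f' x) x = (of_real (c\<^sup>2 / L)) * (iexp (\<theta> * x) * conv F F' (L * (x - 0)))"
      unfolding conv_mult 3 *[symmetric] by (simp only: mult.assoc)
  qed
  have "cubic_conv (\<lambda>x. of_real c * (iexp (\<theta>\<^sub>0 + \<theta> * (x - N)) * F (L * (x - N)))) x =
     of_real (c\<^sup>2 / L) * (of_real c * k) * (of_real (1 / L) * (iexp (\<theta> * x) * cubic_conv F (L * (x - N))))"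
    unfolding cubic_conv_def 1 2 5 conv_mult 4 F'_def ..
  also have "\<dots> = of_real (c\<^sup>2 / L * c * (1 / L)) * ((k * iexp (\<theta> * x)) * cubic_conv F (L * (x - N)))"
    by (simp only: of_real_mult mult_ac)
  also have "c\<^sup>2 / L * c * (1 / L) = c ^ 3 / L\<^sup>2" by (simp add: power2_eq_square power3_eq_cube)
  finally show ?thesis unfolding split .
qed

section \<open>Wave packets\<close>

text \<open>Profiles in the variable \<open>\<eta> = L (\<xi> - N)\<close> are carried to solutions at frequency \<open>N\<close>: removing
  the first-order Taylor polynomial of the symbol at \<open>N\<close> is a phase shift and a translation, which
  the cubic term respects.\<close>

definition wave_packet :: "real \<Rightarrow> real \<Rightarrow> real \<Rightarrow> (real \<Rightarrow> real \<Rightarrow> complex) \<Rightarrow> real \<Rightarrow> real \<Rightarrow> complex" where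
  "wave_packet \<alpha> N L h t \<xi> = of_real (2 * pi * L) *
     (iexp (t * N powr \<alpha> + t * \<alpha> * N powr (\<alpha> - 1) * (\<xi> - N)) * h t (L * (\<xi> - N)))"

definition taylor_symbol :: "real \<Rightarrow> real \<Rightarrow> real \<Rightarrow> real \<Rightarrow> real" where
  "taylor_symbol \<alpha> N L \<eta> = \<bar>N + \<eta> / L\<bar> powr \<alpha> - N powr \<alpha> - \<alpha> * N powr (\<alpha> - 1) * (\<eta> / L)"

lemma continuous_on_taylor_symbol: "0 < \<alpha> \<Longrightarrow> 0 < L \<Longrightarrow> continuous_on UNIV (taylor_symbol \<alpha> N L)"
  unfolding taylor_symbol_def by (intro continuous_intros continuous_on_powr') auto

lemma wt_affine_le:
  assumes "0 < L"
  shows "wt (L * (\<xi> - N)) \<le> (1 + 2 * N\<^sup>2 + 2 / L\<^sup>2) * wt \<xi>"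
proof -
  define D where "D = 1 + (L * (\<xi> - N))\<^sup>2"
  have D: "0 < D" unfolding D_def by (simp add: add_pos_nonneg)
  have "\<xi>\<^sup>2 \<le> 2 * N\<^sup>2 + 2 * (\<xi> - N)\<^sup>2"
    using zero_le_power2[of "\<xi> - 2 * N"] by (simp add: power2_eq_square algebra_simps)
  also have "(\<xi> - N)\<^sup>2 = (D - 1) / L\<^sup>2" using assms by (simp add: D_def power_mult_distrib)
  finally have "1 + \<xi>\<^sup>2 \<le> (1 + 2 * N\<^sup>2) * 1 + 2 / L\<^sup>2 * (D - 1)" by simp
  also have "\<dots> \<le> (1 + 2 * N\<^sup>2) * D + 2 / L\<^sup>2 * D"
    using D by (intro add_mono mult_left_mono) (auto simp: D_def)
  also have "\<dots> = (1 + 2 * N\<^sup>2 + 2 / L\<^sup>2) * D" by (simp add: algebra_simps)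
  finally have "(1 + \<xi>\<^sup>2) * (wt \<xi> * (1 / D)) \<le> (1 + 2 * N\<^sup>2 + 2 / L\<^sup>2) * D * (wt \<xi> * (1 / D))"
    using D by (intro mult_right_mono) auto
  then have "((1 + \<xi>\<^sup>2) * wt \<xi>) * (1 / D) \<le> (1 + 2 * N\<^sup>2 + 2 / L\<^sup>2) * wt \<xi>"
    using D by (simp add: mult.assoc)
  then show ?thesis unfolding wt_cancel by (simp add: D_def wt_def)
qed

text \<open>The constant degenerates with N and L and is kept existential: it only certifies that
  the packet belongs to the class. Quantitative norms are computed in the profile variable.\<close>

lemma unif_decaying_wave_packet:
  assumes L: "0 < L" and h: "unif_decaying A h"
  shows "\<exists>C. unif_decaying C (wave_packet \<alpha> N L h)"
proof (intro exI)
  let ?K = "2 * pi * L * (A * (1 + 2 * N\<^sup>2 + 2 / L\<^sup>2))"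
  show "unif_decaying ?K (wave_packet \<alpha> N L h)"
    unfolding unif_decaying_def
  proof (intro conjI allI)
    show "continuous_on UNIV (\<lambda>(t, \<xi>). wave_packet \<alpha> N L h t \<xi>)"
      unfolding wave_packet_def case_prod_beta
      by (intro continuous_intros unif_decaying_continuous[OF h])
    fix t \<xi>
    have "norm (h t (L * (\<xi> - N))) \<le> A * wt (L * (\<xi> - N))" by (rule decayingD[OF unif_decayingD[OF h]])
    also have "\<dots> \<le> A * ((1 + 2 * N\<^sup>2 + 2 / L\<^sup>2) * wt \<xi>)"
      using decaying_nonneg[OF unif_decayingD[OF h]] by (intro mult_left_mono wt_affine_le L)
    finally have b: "norm (h t (L * (\<xi> - N))) \<le> A * ((1 + 2 * N\<^sup>2 + 2 / L\<^sup>2) * wt \<xi>)" .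
    have "norm (wave_packet \<alpha> N L h t \<xi>) = 2 * pi * L * norm (h t (L * (\<xi> - N)))"
      unfolding wave_packet_def norm_mult norm_exp_i norm_of_real using L by simp
    also have "\<dots> \<le> 2 * pi * L * (A * ((1 + 2 * N\<^sup>2 + 2 / L\<^sup>2) * wt \<xi>))"
      using L by (intro mult_left_mono b) auto
    finally show "norm (wave_packet \<alpha> N L h t \<xi>) \<le> ?K * wt \<xi>" by (simp add: mult_ac)
  qed
qed

text \<open>The symbol splits as |\<xi>|^\<alpha> = p(\<eta>) + q(\<xi>) with q affine. The phase
  exp(i t q) commutes with the cubic term, so only the remainder p acts on the profile. The
  amplitude 2 pi L is the one for which the constants match: (2 pi L)^3 / (4 pi^2 L^2) = 2 pi
  L.\<close>

lemma duhamel_solution_wave_packet: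
  assumes \<alpha>: "0 < \<alpha>" and s: "s \<le> 1" and T: "0 \<le> T" and L: "0 < L" and h: "unif_decaying A h"
    and eq: "\<And>t \<eta>. t \<in> {0..T} \<Longrightarrow> h t \<eta> = duhamel_map \<gamma> (taylor_symbol \<alpha> N L) (h 0) h t \<eta>"
  shows "duhamel_solution \<alpha> \<gamma> s T (dist_of (wave_packet \<alpha> N L h 0)) (\<lambda>t. dist_of (wave_packet \<alpha> N L h t))"
proof -
  obtain C where C: "unif_decaying C (wave_packet \<alpha> N L h)"
    using unif_decaying_wave_packet[OF L h] by blast
  define q where "q \<xi> = N powr \<alpha> + \<alpha> * N powr (\<alpha> - 1) * (\<xi> - N)" for \<xi>
  define p where "p = taylor_symbol \<alpha> N L"
  define e where "e x = iexp x" for x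
  have e_add: "e (x + y) = e x * e y" for x y
    unfolding e_def exp_add[symmetric] by (simp add: distrib_left)
  have sym: "\<bar>\<xi>\<bar> powr \<alpha> = p (L * (\<xi> - N)) + q \<xi>" for \<xi>
    using L by (simp add: p_def q_def taylor_symbol_def)
  have W: "wave_packet \<alpha> N L h t \<xi> = of_real (2 * pi * L) * (e (t * q \<xi>) * h t (L * (\<xi> - N)))" for t \<xi>
    by (simp add: wave_packet_def q_def e_def algebra_simps)
  have cubic: "of_real (1 / (4 * pi\<^sup>2)) * cubic_conv (wave_packet \<alpha> N L h t) \<xi>
      = of_real (2 * pi * L) * (e (t * q \<xi>) * cubic_conv (h t) (L * (\<xi> - N)))" for t \<xi>
  proof -
    have "cubic_conv (wave_packet \<alpha> N L h t) \<xi> = of_real ((2 * pi * L) ^ 3 / L\<^sup>2) *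
       (iexp (t * N powr \<alpha> + t * \<alpha> * N powr (\<alpha> - 1) * (\<xi> - N)) * cubic_conv (h t) (L * (\<xi> - N)))"
      unfolding wave_packet_def[abs_def] by (rule cubic_conv_modulated_affine[OF L])
    also have "t * N powr \<alpha> + t * \<alpha> * N powr (\<alpha> - 1) * (\<xi> - N) = t * q \<xi>"
      by (simp add: q_def algebra_simps)
    finally have "of_real (1 / (4 * pi\<^sup>2)) * cubic_conv (wave_packet \<alpha> N L h t) \<xi> =
       of_real (1 / (4 * pi\<^sup>2) * ((2 * pi * L) ^ 3 / L\<^sup>2)) * (e (t * q \<xi>) * cubic_conv (h t) (L * (\<xi> - N)))"
      unfolding e_def by (simp only: of_real_mult mult.assoc)
    also have "1 / (4 * pi\<^sup>2) * ((2 * pi * L) ^ 3 / L\<^sup>2) = 2 * pi * L"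
      using L by (simp add: power2_eq_square power3_eq_cube)
    finally show ?thesis .
  qed
  show ?thesis
  proof (rule duhamel_solutionI[OF \<alpha> s T C])
    fix t \<xi> assume t: "t \<in> {0..T}"
    define \<eta> where "\<eta> = L * (\<xi> - N)"
    define c where "c = (of_real (2 * pi * L) :: complex)"
    have "(LBINT t':{0..t}. e ((t - t') * \<bar>\<xi>\<bar> powr \<alpha>) * (of_real (1 / (4 * pi\<^sup>2)) * cubic_conv (wave_packet \<alpha> N L h t') \<xi>))
        = (LBINT t':{0..t}. (c * e (t * q \<xi>)) * (e ((t - t') * p \<eta>) * cubic_conv (h t') \<eta>))"
    proof -
      have "e ((t - t') * \<bar>\<xi>\<bar> powr \<alpha>) * e (t' * q \<xi>) = e (t * q \<xi>) * e ((t - t') * p \<eta>)" for t'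
        unfolding sym e_add[symmetric] \<eta>_def by (rule arg_cong[where f = e]) (simp add: algebra_simps)
      then have *: "e ((t - t') * \<bar>\<xi>\<bar> powr \<alpha>) * (c * (e (t' * q \<xi>) * z)) = (c * e (t * q \<xi>)) * (e ((t - t') * p \<eta>) * z)" for t' z
        by (metis mult.assoc mult.left_commute)
      show ?thesis unfolding cubic c_def[symmetric] \<eta>_def[symmetric] * ..
    qed
    also have "\<dots> = (c * e (t * q \<xi>)) * (LBINT t':{0..t}. e ((t - t') * p \<eta>) * cubic_conv (h t') \<eta>)"
      by (rule set_integral_mult_right)
    finally have I: "(LBINT t':{0..t}. e ((t - t') * \<bar>\<xi>\<bar> powr \<alpha>) * (of_real (1 / (4 * pi\<^sup>2)) * cubic_conv (wave_packet \<alpha> N L h t') \<xi>))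
        = (c * e (t * q \<xi>)) * (LBINT t':{0..t}. e ((t - t') * p \<eta>) * cubic_conv (h t') \<eta>)" .
    have e1: "e (t * \<bar>\<xi>\<bar> powr \<alpha>) = e (t * q \<xi>) * e (t * p \<eta>)"
      unfolding sym e_add[symmetric] \<eta>_def by (rule arg_cong[where f = e]) (simp add: algebra_simps)
    have "wave_packet \<alpha> N L h t \<xi> = (c * e (t * q \<xi>)) * (e (t * p \<eta>) * h 0 \<eta> -
        \<i> * of_real \<gamma> * (LBINT t':{0..t}. e ((t - t') * p \<eta>) * cubic_conv (h t') \<eta>))"
      unfolding W \<eta>_def[symmetric] eq[OF t, of \<eta>] duhamel_map_def e_def p_def c_def by (simp only: mult.assoc)
    also have "\<dots> = e (t * \<bar>\<xi>\<bar> powr \<alpha>) * wave_packet \<alpha> N L h 0 \<xi> - \<i> * of_real \<gamma> *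
        ((c * e (t * q \<xi>)) * (LBINT t':{0..t}. e ((t - t') * p \<eta>) * cubic_conv (h t') \<eta>))"
    proof -
      have "wave_packet \<alpha> N L h 0 \<xi> = c * h 0 \<eta>" by (simp add: W \<eta>_def c_def e_def)
      then show ?thesis unfolding e1 by (simp add: right_diff_distrib mult_ac)
    qed
    finally show "wave_packet \<alpha> N L h t \<xi> = iexp (t * \<bar>\<xi>\<bar> powr \<alpha>) * wave_packet \<alpha> N L h 0 \<xi>
      - \<i> * of_real \<gamma> * (LBINT t':{0..t}. iexp ((t - t') * \<bar>\<xi>\<bar> powr \<alpha>) *
          (of_real (1 / (4 * pi\<^sup>2)) * cubic_conv (wave_packet \<alpha> N L h t') \<xi>))"
      unfolding I[unfolded e_def] e_def .
  qed
qed

section \<open>Sobolev norms of wave packets\<close>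

lemma wave_packet_diff:
  "wave_packet \<alpha> N L h t \<xi> - wave_packet \<alpha> N L k t \<xi> = wave_packet \<alpha> N L (\<lambda>t \<eta>. h t \<eta> - k t \<eta>) t \<xi>"
  by (simp add: wave_packet_def right_diff_distrib)

lemma sobolev_norm_wave_packet:
  assumes L: "0 < L" and s: "s \<le> 1" and h: "unif_decaying A h"
  shows "(sobolev_norm s (dist_of (wave_packet \<alpha> N L h t)))\<^sup>2 =
      4 * pi\<^sup>2 * L * (LBINT \<eta>. (1 + \<bar>N + \<eta> / L\<bar>\<^sup>2) powr s * (norm (h t \<eta>))\<^sup>2)"
proof -
  obtain C where C: "unif_decaying C (wave_packet \<alpha> N L h)"
    using unif_decaying_wave_packet[OF L h] by blast
  have n: "norm (wave_packet \<alpha> N L h t \<xi>) = 2 * pi * L * norm (h t (L * (\<xi> - N)))" for \<xi>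
    unfolding wave_packet_def norm_mult norm_exp_i norm_of_real using L by simp
  have "(sobolev_norm s (dist_of (wave_packet \<alpha> N L h t)))\<^sup>2 =
      (LBINT \<xi>. (1 + \<bar>\<xi>\<bar>\<^sup>2) powr s * (2 * pi * L * norm (h t (L * (\<xi> - N))))\<^sup>2)"
    unfolding sobolev_dist_of(2)[OF unif_decayingD[OF C] s] n
    by (rule real_sqrt_pow2) (rule Bochner_Integration.integral_nonneg, simp)
  also have "\<dots> = \<bar>1 / L\<bar> *\<^sub>R (LBINT \<eta>. (1 + \<bar>N + 1 / L * \<eta>\<bar>\<^sup>2) powr s * (2 * pi * L * norm (h t (L * (N + 1 / L * \<eta> - N))))\<^sup>2)"
    using L by (subst lborel_integral_real_affine[where c = "1 / L" and t = N]) auto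
  also have "(\<lambda>\<eta>. (1 + \<bar>N + 1 / L * \<eta>\<bar>\<^sup>2) powr s * (2 * pi * L * norm (h t (L * (N + 1 / L * \<eta> - N))))\<^sup>2) =
      (\<lambda>\<eta>. (2 * pi * L)\<^sup>2 * ((1 + \<bar>N + \<eta> / L\<bar>\<^sup>2) powr s * (norm (h t \<eta>))\<^sup>2))"
    using L by (auto simp: fun_eq_iff power_mult_distrib)
  also have "\<bar>1 / L\<bar> *\<^sub>R (LBINT \<eta>. (2 * pi * L)\<^sup>2 * ((1 + \<bar>N + \<eta> / L\<bar>\<^sup>2) powr s * (norm (h t \<eta>))\<^sup>2)) =
      (1 / L * (2 * pi * L)\<^sup>2) * (LBINT \<eta>. (1 + \<bar>N + \<eta> / L\<bar>\<^sup>2) powr s * (norm (h t \<eta>))\<^sup>2)"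
    using L by (simp only: integral_mult_right_zero) simp
  also have "1 / L * (2 * pi * L)\<^sup>2 = 4 * pi\<^sup>2 * L" using L by (simp add: power2_eq_square)
  finally show ?thesis .
qed

lemma integrable_weighted_profile:
  assumes L: "0 < L" and s: "s \<le> 1" and k: "decaying A k"
  shows "integrable lborel (\<lambda>\<eta>. (1 + \<bar>N + \<eta> / L\<bar>\<^sup>2) powr s * (norm (k \<eta>))\<^sup>2)"
proof -
  \<comment> \<open>A packet with a time-independent profile: its square against the Sobolev weight
    is already known to be integrable, and rescaling returns the claim. Only the modulus enters, so
    any exponent would do in place of 0.\<close>
  obtain C where C: "unif_decaying C (wave_packet 0 N L (\<lambda>t. k))"
    using unif_decaying_wave_packet[OF L unif_decaying_const[OF k]] by blast
  from sobolev_integrable[OF unif_decayingD[OF C, of 0] s]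
  have "integrable lborel (\<lambda>\<xi>. (1 + \<bar>\<xi>\<bar>\<^sup>2) powr s * (2 * pi * L * norm (k (L * (\<xi> - N))))\<^sup>2)"
    unfolding wave_packet_def norm_mult norm_exp_i norm_of_real using L by simp
  from lborel_integrable_real_affine[OF this, of "1 / L" N]
  have "integrable lborel (\<lambda>\<eta>. (2 * pi * L)\<^sup>2 * ((1 + \<bar>N + \<eta> / L\<bar>\<^sup>2) powr s * (norm (k \<eta>))\<^sup>2))"
    using L by (simp add: power_mult_distrib mult_ac)
  then show ?thesis using L by simp
qed

text \<open>The constant is 4 pi^2 from the change of variables, 5 from the weight, and pi from the
  integral of \<open>wt\<close>. Width and frequency enter only through L N^(2 s), the quantity that
  is later held fixed.\<close>

lemma sobolev_norm_wave_packet_le: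
  assumes s: "\<bar>s\<bar> \<le> 1" and N: "1 \<le> N" and L: "0 < L" "1 \<le> N * L" "s < 0 \<Longrightarrow> 1 \<le> L"
    and h: "unif_decaying A h" and B: "\<And>\<eta>. norm (h t \<eta>) \<le> B * wt \<eta>"
  shows "(sobolev_norm s (dist_of (wave_packet \<alpha> N L h t)))\<^sup>2 \<le> 20 * pi ^ 3 * (L * N powr (2 * s)) * B\<^sup>2"
proof -
  have "(LBINT \<eta>. (1 + \<bar>N + \<eta> / L\<bar>\<^sup>2) powr s * (norm (h t \<eta>))\<^sup>2) \<le> (LBINT \<eta>. 5 * N powr (2 * s) * B\<^sup>2 * wt \<eta>)"
  proof (rule integral_mono)
    show "integrable lborel (\<lambda>\<eta>. (1 + \<bar>N + \<eta> / L\<bar>\<^sup>2) powr s * (norm (h t \<eta>))\<^sup>2)"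
      using s by (intro integrable_weighted_profile[OF L(1) _ unif_decayingD[OF h]]) simp
    show "integrable lborel (\<lambda>\<eta>. 5 * N powr (2 * s) * B\<^sup>2 * wt \<eta>)" using integrable_wt by simp
    fix \<eta>
    have "(1 + \<bar>N + \<eta> / L\<bar>\<^sup>2) powr s * (norm (h t \<eta>))\<^sup>2 \<le> 5 * N powr (2 * s) * (1 + \<eta>\<^sup>2) * (B * wt \<eta>)\<^sup>2"
      by (intro mult_mono sobolev_weight_upper power_mono s N L B) auto
    also have "\<dots> = 5 * N powr (2 * s) * B\<^sup>2 * wt \<eta> * ((1 + \<eta>\<^sup>2) * wt \<eta>)"
      by (simp add: power2_eq_square mult_ac)
    finally show "(1 + \<bar>N + \<eta> / L\<bar>\<^sup>2) powr s * (norm (h t \<eta>))\<^sup>2 \<le> 5 * N powr (2 * s) * B\<^sup>2 * wt \<eta>"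
      unfolding wt_cancel by simp
  qed
  also have "\<dots> = 5 * N powr (2 * s) * B\<^sup>2 * pi" by (simp add: integral_wt)
  finally have "4 * pi\<^sup>2 * L * (LBINT \<eta>. (1 + \<bar>N + \<eta> / L\<bar>\<^sup>2) powr s * (norm (h t \<eta>))\<^sup>2) \<le> 4 * pi\<^sup>2 * L * (5 * N powr (2 * s) * B\<^sup>2 * pi)"
    using L by (intro mult_left_mono) auto
  then show ?thesis
    using s by (subst sobolev_norm_wave_packet[OF L(1) _ h]) (auto simp: power2_eq_square power3_eq_cube mult_ac)
qed

text \<open>Half of the mass of the reference profile \<open>D\<close> survives its replacement by
  \<open>h t\<close>, at the price of the error term in \<rho>. The last term pays for frequencies
  far from N, where the weight is not comparable to N^(2 s); it vanishes as N L grows.\<close>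

lemma sobolev_norm_wave_packet_ge:
  assumes s: "\<bar>s\<bar> \<le> 1" and N: "1 \<le> N" and L: "0 < L"
    and h: "unif_decaying A h" and D: "decaying R D" and \<rho>: "\<And>\<eta>. norm (h t \<eta> - D \<eta>) \<le> \<rho> * wt \<eta>"
  shows "pi\<^sup>2 * (L * N powr (2 * s)) * ((LBINT \<eta>. (norm (D \<eta>))\<^sup>2) / 2 - \<rho>\<^sup>2 * pi - 4 * (R + \<rho>)\<^sup>2 * pi / (N * L)\<^sup>2)
    \<le> (sobolev_norm s (dist_of (wave_packet \<alpha> N L h t)))\<^sup>2"
proof -
  let ?I = "LBINT \<eta>. (norm (D \<eta>))\<^sup>2"
  have h_le: "norm (h t \<eta>) \<le> (R + \<rho>) * wt \<eta>" for \<eta>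
    using norm_triangle_sub[of "h t \<eta>" "D \<eta>"] decayingD(2)[OF D, of \<eta>] \<rho>[of \<eta>] by (simp add: distrib_right)
  note dh = unif_decayingD[OF h, of t]
  have "?I / 2 - \<rho>\<^sup>2 * pi = (LBINT \<eta>. (norm (D \<eta>))\<^sup>2 / 2 - \<rho>\<^sup>2 * wt \<eta>)"
    using decaying_square_integrable[OF D] integrable_wt
    by (subst Bochner_Integration.integral_diff) (auto simp: integral_wt)
  also have "\<dots> \<le> (LBINT \<eta>. (norm (h t \<eta>))\<^sup>2)"
  proof (rule integral_mono)
    show "integrable lborel (\<lambda>\<eta>. (norm (D \<eta>))\<^sup>2 / 2 - \<rho>\<^sup>2 * wt \<eta>)"
      using decaying_square_integrable[OF D] integrable_wt by simp
    show "integrable lborel (\<lambda>\<eta>. (norm (h t \<eta>))\<^sup>2)" by (rule decaying_square_integrable[OF dh])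
    fix \<eta>
    have "(norm (h t \<eta> - D \<eta>))\<^sup>2 \<le> (\<rho> * wt \<eta>)\<^sup>2" using \<rho> by (intro power_mono) auto
    also have "\<dots> \<le> \<rho>\<^sup>2 * wt \<eta>" unfolding power_mult_distrib by (intro mult_left_mono wt_square_le) auto
    finally show "(norm (D \<eta>))\<^sup>2 / 2 - \<rho>\<^sup>2 * wt \<eta> \<le> (norm (h t \<eta>))\<^sup>2"
      using norm_add_square_ge[of "D \<eta>" "h t \<eta> - D \<eta>"] by simp
  qed
  finally have I1: "?I / 2 - \<rho>\<^sup>2 * pi \<le> (LBINT \<eta>. (norm (h t \<eta>))\<^sup>2)" .
  have m: "\<eta>\<^sup>2 * (norm (h t \<eta>))\<^sup>2 \<le> (R + \<rho>)\<^sup>2 * wt \<eta>" for \<eta>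
  proof -
    have "\<eta>\<^sup>2 * (norm (h t \<eta>))\<^sup>2 \<le> \<eta>\<^sup>2 * ((R + \<rho>) * wt \<eta>)\<^sup>2" using h_le by (intro mult_left_mono power_mono) auto
    also have "\<dots> = (R + \<rho>)\<^sup>2 * wt \<eta> * (\<eta>\<^sup>2 * wt \<eta>)" by (simp add: power2_eq_square mult_ac)
    also have "\<dots> \<le> (R + \<rho>)\<^sup>2 * wt \<eta>" using square_wt_le_1 by (intro mult_left_le) auto
    finally show ?thesis .
  qed
  define c where "c = N powr (2 * s) / 4"
  define M where "M = 4 / (N * L)\<^sup>2"
  have c: "0 \<le> c" and M: "0 \<le> M" by (auto simp: c_def M_def)
  have "c * (?I / 2 - \<rho>\<^sup>2 * pi - M * ((R + \<rho>)\<^sup>2 * pi)) \<le> c * ((LBINT \<eta>. (norm (h t \<eta>))\<^sup>2) - M * ((R + \<rho>)\<^sup>2 * pi))"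
    using I1 c by (intro mult_left_mono) auto
  also have "\<dots> = (LBINT \<eta>. c * ((norm (h t \<eta>))\<^sup>2 - M * ((R + \<rho>)\<^sup>2 * wt \<eta>)))"
    using decaying_square_integrable[OF dh] integrable_wt by (simp add: integral_wt)
  also have "\<dots> \<le> (LBINT \<eta>. (1 + \<bar>N + \<eta> / L\<bar>\<^sup>2) powr s * (norm (h t \<eta>))\<^sup>2)"
  proof (rule integral_mono)
    show "integrable lborel (\<lambda>\<eta>. c * ((norm (h t \<eta>))\<^sup>2 - M * ((R + \<rho>)\<^sup>2 * wt \<eta>)))"
      using decaying_square_integrable[OF dh] integrable_wt by simp
    show "integrable lborel (\<lambda>\<eta>. (1 + \<bar>N + \<eta> / L\<bar>\<^sup>2) powr s * (norm (h t \<eta>))\<^sup>2)"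
      using s by (intro integrable_weighted_profile[OF L _ dh]) simp
    fix \<eta>
    have "c * ((norm (h t \<eta>))\<^sup>2 - M * ((R + \<rho>)\<^sup>2 * wt \<eta>)) \<le> c * ((norm (h t \<eta>))\<^sup>2 - M * (\<eta>\<^sup>2 * (norm (h t \<eta>))\<^sup>2))"
      using m c M by (intro mult_left_mono diff_left_mono) auto
    also have "\<dots> = (c * (1 - 4 * \<eta>\<^sup>2 / (N * L)\<^sup>2)) * (norm (h t \<eta>))\<^sup>2"
      by (simp add: M_def algebra_simps)
    also have "\<dots> \<le> (1 + \<bar>N + \<eta> / L\<bar>\<^sup>2) powr s * (norm (h t \<eta>))\<^sup>2"
      unfolding c_def by (intro mult_right_mono sobolev_weight_lower s N L) auto
    finally show "c * ((norm (h t \<eta>))\<^sup>2 - M * ((R + \<rho>)\<^sup>2 * wt \<eta>)) \<le> (1 + \<bar>N + \<eta> / L\<bar>\<^sup>2) powr s * (norm (h t \<eta>))\<^sup>2" .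
  qed
  finally have "4 * pi\<^sup>2 * L * (c * (?I / 2 - \<rho>\<^sup>2 * pi - M * ((R + \<rho>)\<^sup>2 * pi))) \<le>
      4 * pi\<^sup>2 * L * (LBINT \<eta>. (1 + \<bar>N + \<eta> / L\<bar>\<^sup>2) powr s * (norm (h t \<eta>))\<^sup>2)"
    using L by (intro mult_left_mono) auto
  also have "\<dots> = (sobolev_norm s (dist_of (wave_packet \<alpha> N L h t)))\<^sup>2"
    using s by (subst sobolev_norm_wave_packet[OF L _ h]) auto
  finally show ?thesis by (simp add: c_def M_def mult_ac)
qed

section \<open>Failure of uniform continuity\<close>

lemma eventually_powr_ge:
  fixes c K :: real
  assumes "0 < c"
  shows "eventually (\<lambda>N. K \<le> N powr c) at_top"
proof -
  have *: "K \<le> N powr c" if "max 1 K powr (1 / c) \<le> N" for N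
  proof -
    have "K \<le> (max 1 K powr (1 / c)) powr c" using assms by (simp add: powr_powr)
    also have "\<dots> \<le> N powr c" using that assms by (intro powr_mono2) auto
    finally show ?thesis .
  qed
  show ?thesis
    using eventually_ge_at_top[of "max 1 K powr (1 / c)"] by eventually_elim (rule *)
qed

text \<open>With L N^(2 s) = b prescribed, every requirement becomes a lower bound on a positive
  power of N; for instance N L = b N^(1 - 2 s). The threshold \<open>K\<close> is free because the
  tail constant is known only after the profiles are.\<close>

lemma frequency_exists:
  fixes \<alpha> s b \<mu> K :: real
  assumes s: "s < 1 / 2" "4 * s < 2 - \<alpha>" and b: "0 < b" and \<mu>: "0 < \<mu>"
  shows "\<exists>N L. 1 \<le> N \<and> 0 < L \<and> 1 \<le> N * L \<and> K \<le> (N * L)\<^sup>2 \<and> (s < 0 \<longrightarrow> 1 \<le> L) \<and>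
    L * N powr (2 * s) = b \<and> 8 * N powr (\<alpha> - 2) / L\<^sup>2 \<le> \<mu>"
proof -
  have "eventually (\<lambda>N. 1 \<le> N \<and> max 1 K / b \<le> N powr (1 - 2 * s) \<and>
      1 / b \<le> N powr (if s < 0 then - 2 * s else 1) \<and> 8 / (b\<^sup>2 * \<mu>) \<le> N powr (2 - \<alpha> - 4 * s)) at_top"
    using s by (intro eventually_conj eventually_powr_ge eventually_ge_at_top) auto
  then obtain N where N: "1 \<le> N" "max 1 K / b \<le> N powr (1 - 2 * s)"
      "1 / b \<le> N powr (if s < 0 then - 2 * s else 1)" "8 / (b\<^sup>2 * \<mu>) \<le> N powr (2 - \<alpha> - 4 * s)"
    using eventually_happens'[OF trivial_limit_at_top_linorder] by blast
  define L where "L = b * N powr (- 2 * s)"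
  have L: "0 < L" using b N by (simp add: L_def)
  have "N * L = b * (N powr 1 * N powr (- 2 * s))" using N by (simp add: L_def)
  also have "\<dots> = b * N powr (1 - 2 * s)" unfolding powr_add[symmetric] by simp
  finally have NL: "N * L = b * N powr (1 - 2 * s)" .
  then have NL1: "max 1 K \<le> N * L" using N(2) b by (simp add: divide_le_eq mult.commute)
  have "N * L * 1 \<le> N * L * (N * L)" using NL1 by (intro mult_left_mono) auto
  then have "K \<le> (N * L)\<^sup>2" using NL1 by (simp add: power2_eq_square)
  moreover have "s < 0 \<longrightarrow> 1 \<le> L" using N(3) b by (auto simp: L_def divide_le_eq mult.commute)
  moreover have "L * N powr (2 * s) = b"
    using N by (simp add: L_def mult.assoc flip: powr_add)
  moreover have "8 * N powr (\<alpha> - 2) / L\<^sup>2 \<le> \<mu>"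
  proof -
    have "L\<^sup>2 = b\<^sup>2 * N powr (- 4 * s)"
      by (simp add: L_def power_mult_distrib power2_eq_square flip: powr_add)
    then have "8 * N powr (\<alpha> - 2) / L\<^sup>2 = 8 / b\<^sup>2 * (N powr (\<alpha> - 2) / N powr (- 4 * s))" by simp
    also have "N powr (\<alpha> - 2) / N powr (- 4 * s) = 1 / N powr (2 - \<alpha> - 4 * s)"
      using N by (simp add: powr_minus_divide[symmetric] powr_diff[symmetric] algebra_simps)
    also have "8 / b\<^sup>2 * (1 / N powr (2 - \<alpha> - 4 * s)) \<le> \<mu>"
      using N b \<mu> by (simp add: divide_le_eq mult_ac)
    finally show ?thesis .
  qed
  ultimately show ?thesis using N(1) L NL1 by auto
qed

lemma abs_taylor_symbol_le:
  assumes "1 < \<alpha>" "\<alpha> < 2" "0 < N" "8 * N powr (\<alpha> - 2) / L\<^sup>2 \<le> \<mu>"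
  shows "\<bar>taylor_symbol \<alpha> N L \<eta>\<bar> \<le> \<mu> * \<eta>\<^sup>2"
proof -
  have "\<bar>taylor_symbol \<alpha> N L \<eta>\<bar> \<le> 8 * N powr (\<alpha> - 2) * (\<eta> / L)\<^sup>2"
    unfolding taylor_symbol_def by (rule symbol_taylor[OF assms(1-3)])
  also have "\<dots> = 8 * N powr (\<alpha> - 2) / L\<^sup>2 * \<eta>\<^sup>2" by (simp add: power_divide)
  also have "\<dots> \<le> \<mu> * \<eta>\<^sup>2" using assms(4) by (intro mult_right_mono) auto
  finally show ?thesis .
qed

lemma abs_le_of_square_le:
  fixes x y :: real
  assumes "x\<^sup>2 \<le> c * y\<^sup>2" "0 \<le> y" "0 \<le> c"
  shows "x \<le> sqrt c * y"
proof (rule power2_le_imp_le)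
  show "x\<^sup>2 \<le> (sqrt c * y)\<^sup>2" using assms by (simp add: power_mult_distrib)
qed (use assms in auto)

text \<open>\<open>C\<^sub>0\<close> belongs to the fixed Gaussian and is passed in as a parameter,
  so that the constants in the conclusion are visibly independent of \<epsilon>, \<delta> and
  T.\<close>

lemma two_solutions:
  fixes \<alpha> \<gamma> s \<epsilon> \<delta> T C\<^sub>0 :: real
  assumes \<alpha>: "1 < \<alpha>" "\<alpha> < 2" and \<gamma>: "\<gamma> \<noteq> 0" and s: "- 1 < s" "s < (2 - \<alpha>) / 4"
    and \<epsilon>: "0 < \<epsilon>" and \<delta>: "0 < \<delta>" "\<delta> \<le> \<epsilon> / 12" and T: "0 < T"
    and C0: "decaying C\<^sub>0 (gauss_phase_ft 1 0)"
  shows "\<exists>\<phi>\<^sub>1 \<phi>\<^sub>2 u\<^sub>1 u\<^sub>2.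
      duhamel_solution \<alpha> \<gamma> s T \<phi>\<^sub>1 u\<^sub>1 \<and> duhamel_solution \<alpha> \<gamma> s T \<phi>\<^sub>2 u\<^sub>2 \<and>
      sobolev_norm s \<phi>\<^sub>1 \<le> sqrt (20 * pi ^ 3 * C\<^sub>0\<^sup>2) * (2 * \<epsilon>) \<and> sobolev_norm s \<phi>\<^sub>2 \<le> sqrt (20 * pi ^ 3 * C\<^sub>0\<^sup>2) * (2 * \<epsilon>) \<and>
      sobolev_norm s (\<phi>\<^sub>1 - \<phi>\<^sub>2) \<le> sqrt (20 * pi ^ 3 * C\<^sub>0\<^sup>2) * \<delta> \<and>
      pi / 2 * sqrt (1 / (96 * sqrt pi)) * \<epsilon> \<le> sobolev_norm s (u\<^sub>1 T - u\<^sub>2 T)"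
proof -
  have s1: "\<bar>s\<bar> \<le> 1" "s \<le> 1" "s < 1 / 2" "4 * s < 2 - \<alpha>" using s \<alpha> by auto
  define b where "b = 3 * \<bar>\<gamma>\<bar> * T * \<epsilon> * \<delta>"
  have b: "0 < b" using \<gamma> T \<epsilon> \<delta> by (simp add: b_def)
  define a1 where "a1 = (\<epsilon> + \<delta>) / sqrt b"
  define a2 where "a2 = \<epsilon> / sqrt b"
  have a_pos: "0 < a1" "0 < a2" using b \<epsilon> \<delta> by (simp_all add: a1_def a2_def)
  have ba: "b * a1\<^sup>2 = (\<epsilon> + \<delta>)\<^sup>2" "b * a2\<^sup>2 = \<epsilon>\<^sup>2" "b * (a1 - a2)\<^sup>2 = \<delta>\<^sup>2"
    using b by (simp_all add: a1_def a2_def power_divide flip: diff_divide_distrib)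
  define l1 where "l1 = \<gamma> * a1\<^sup>2 * T"
  define l2 where "l2 = \<gamma> * a2\<^sup>2 * T"
  have l: "\<bar>l1 - l2\<bar> = (2 + \<delta> / \<epsilon>) / 3"
  proof -
    have "l1 - l2 = \<gamma> * T * ((\<epsilon> + \<delta>)\<^sup>2 - \<epsilon>\<^sup>2) / b"
      using b by (simp add: l1_def l2_def a1_def a2_def power_divide algebra_simps diff_divide_distrib)
    also have "(\<epsilon> + \<delta>)\<^sup>2 - \<epsilon>\<^sup>2 = \<epsilon> * \<delta> * (2 + \<delta> / \<epsilon>)"
      using \<epsilon> by (simp add: power2_eq_square algebra_simps)
    finally have "\<bar>l1 - l2\<bar> = \<bar>\<gamma>\<bar> * T * (\<epsilon> * \<delta> * (2 + \<delta> / \<epsilon>)) / b"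
      using T b \<epsilon> \<delta> by (simp add: abs_mult)
    also have "\<dots> = (2 + \<delta> / \<epsilon>) / 3" using \<gamma> T \<epsilon> \<delta> by (simp add: b_def)
    finally show ?thesis .
  qed
  have de: "0 \<le> \<delta> / \<epsilon>" "\<delta> / \<epsilon> \<le> 1" using \<epsilon> \<delta> by (auto simp: divide_le_eq)
  have l_bounds: "2 / 3 \<le> \<bar>l1 - l2\<bar>" "\<bar>l1 - l2\<bar> \<le> 1" unfolding l using de by auto
  have a_close: "\<bar>a1 - a2\<bar> \<le> \<bar>a1\<bar> / 12"
  proof -
    have "a1 - a2 = \<delta> / sqrt b" by (simp add: a1_def a2_def add_divide_distrib)
    moreover have "\<delta> / sqrt b \<le> (\<epsilon> + \<delta>) / 12 / sqrt b" using \<delta> b by (intro divide_right_mono) auto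
    ultimately show ?thesis using a_pos \<delta> b by (simp add: a1_def)
  qed
  define J where "J = gauss_phase_ft 1"
  define D where "D \<eta> = of_real a1 * J l1 \<eta> - of_real a2 * J l2 \<eta>" for \<eta>
  define c\<^sub>0 where "c\<^sub>0 = 1 / (96 * sqrt pi)"
  have c0: "0 < c\<^sub>0" by (simp add: c\<^sub>0_def)
  have D_ge: "c\<^sub>0 * a1\<^sup>2 \<le> (LBINT \<eta>. (norm (D \<eta>))\<^sup>2)"
    using gauss_phase_ft_diff_ge[OF l_bounds a_close] by (simp add: D_def J_def c\<^sub>0_def)
  obtain R where R: "decaying R D"
  proof -
    obtain R1 R2 where R12: "decaying R1 (J l1)" "decaying R2 (J l2)"
      unfolding J_def using decaying_gauss_phase_ft[of 1] by blast
    have "decaying (\<bar>a1\<bar> * R1 + \<bar>a2\<bar> * R2) D"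
      unfolding D_def by (intro decaying_diff decaying_mult R12) auto
    then show ?thesis by (rule that)
  qed
  \<comment> \<open>Error budget: half of the squared norm of \<open>D\<close> is at least
    \<open>c\<^sub>0 * a1\<^sup>2 / 2\<close>. Here \<open>r\<close>, and below \<open>M\<close>,
    are chosen so that the profile error and the frequency tail each cost at most
    \<open>c\<^sub>0 * a1\<^sup>2 / 8\<close>; half of the initial amount remains.\<close>
  define r where "r = a1 * sqrt (c\<^sub>0 / (8 * pi))"
  have r: "0 < r" using a_pos c0 by (simp add: r_def)
  have r2: "r\<^sup>2 * pi = c\<^sub>0 * a1\<^sup>2 / 8" using c0 by (simp add: r_def power_mult_distrib)
  obtain \<mu>1 where \<mu>1: "0 < \<mu>1" and prof1: "\<forall>p. continuous_on UNIV p \<longrightarrow> (\<forall>\<eta>. \<bar>p \<eta>\<bar> \<le> \<mu>1 * \<eta>\<^sup>2) \<longrightarrow>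
      (\<exists>A h. unif_decaying A h \<and> h 0 = (\<lambda>\<eta>. of_real a1 * J 0 \<eta>) \<and>
        (\<forall>t\<in>{0..T}. \<forall>\<eta>. h t \<eta> = duhamel_map \<gamma> p (h 0) h t \<eta>) \<and>
        (\<forall>\<eta>. norm (h T \<eta> - of_real a1 * J l1 \<eta>) \<le> r / 2 * wt \<eta>))"
    using exact_profile[OF less_imp_le[OF T] half_gt_zero[OF r], of a1 \<gamma>, folded J_def l1_def]
    by (elim exE conjE) (rule that)
  obtain \<mu>2 where \<mu>2: "0 < \<mu>2" and prof2: "\<forall>p. continuous_on UNIV p \<longrightarrow> (\<forall>\<eta>. \<bar>p \<eta>\<bar> \<le> \<mu>2 * \<eta>\<^sup>2) \<longrightarrow>
      (\<exists>A h. unif_decaying A h \<and> h 0 = (\<lambda>\<eta>. of_real a2 * J 0 \<eta>) \<and>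
        (\<forall>t\<in>{0..T}. \<forall>\<eta>. h t \<eta> = duhamel_map \<gamma> p (h 0) h t \<eta>) \<and>
        (\<forall>\<eta>. norm (h T \<eta> - of_real a2 * J l2 \<eta>) \<le> r / 2 * wt \<eta>))"
    using exact_profile[OF less_imp_le[OF T] half_gt_zero[OF r], of a2 \<gamma>, folded J_def l2_def]
    by (elim exE conjE) (rule that)
  define M where "M = 32 * (R + r)\<^sup>2 * pi / (c\<^sub>0 * a1\<^sup>2)"
  obtain N L where N: "1 \<le> N" and L: "0 < L" "1 \<le> N * L" "s < 0 \<Longrightarrow> 1 \<le> L" and NLM: "M \<le> (N * L)\<^sup>2"
    and Lb: "L * N powr (2 * s) = b" and \<mu>_le: "8 * N powr (\<alpha> - 2) / L\<^sup>2 \<le> min \<mu>1 \<mu>2"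
    using frequency_exists[OF s1(3,4) b, of "min \<mu>1 \<mu>2" M] \<mu>1 \<mu>2 by auto
  define p where "p = taylor_symbol \<alpha> N L"
  have p: "continuous_on UNIV p" unfolding p_def using \<alpha> L by (intro continuous_on_taylor_symbol) auto
  have p_le: "\<bar>p \<eta>\<bar> \<le> \<mu>1 * \<eta>\<^sup>2" "\<bar>p \<eta>\<bar> \<le> \<mu>2 * \<eta>\<^sup>2" for \<eta>
    unfolding p_def using \<alpha> N \<mu>_le by (auto intro!: abs_taylor_symbol_le)
  obtain A1 h1 where h1: "unif_decaying A1 h1" "h1 0 = (\<lambda>\<eta>. of_real a1 * J 0 \<eta>)"
      "\<And>t \<eta>. t \<in> {0..T} \<Longrightarrow> h1 t \<eta> = duhamel_map \<gamma> p (h1 0) h1 t \<eta>"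
      "\<And>\<eta>. norm (h1 T \<eta> - of_real a1 * J l1 \<eta>) \<le> r / 2 * wt \<eta>"
    using prof1[rule_format, OF p p_le(1)] by blast
  obtain A2 h2 where h2: "unif_decaying A2 h2" "h2 0 = (\<lambda>\<eta>. of_real a2 * J 0 \<eta>)"
      "\<And>t \<eta>. t \<in> {0..T} \<Longrightarrow> h2 t \<eta> = duhamel_map \<gamma> p (h2 0) h2 t \<eta>"
      "\<And>\<eta>. norm (h2 T \<eta> - of_real a2 * J l2 \<eta>) \<le> r / 2 * wt \<eta>"
    using prof2[rule_format, OF p p_le(2)] by blast
  let ?W = "wave_packet \<alpha> N L"
  define k where "k t \<eta> = h1 t \<eta> - h2 t \<eta>" for t \<eta>
  have k: "unif_decaying (A1 + A2) k"
    unfolding unif_decaying_def k_def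
    using decaying_diff[OF unif_decayingD[OF h1(1)] unif_decayingD[OF h2(1)]]
    by (auto simp: decaying_def case_prod_beta intro!: continuous_intros unif_decaying_continuous[OF h1(1)] unif_decaying_continuous[OF h2(1)])
  have diff: "dist_of (?W h1 t) - dist_of (?W h2 t) = dist_of (?W k t)" for t
  proof -
    obtain B1 B2 where "unif_decaying B1 (?W h1)" "unif_decaying B2 (?W h2)"
      using unif_decaying_wave_packet[OF L(1)] h1(1) h2(1) by blast
    then have "dist_of (?W h1 t) - dist_of (?W h2 t) = dist_of (\<lambda>\<xi>. ?W h1 t \<xi> - ?W h2 t \<xi>)"
      using dist_of_diff unif_decayingD by blast
    then show ?thesis unfolding wave_packet_diff k_def .
  qed
  have sol1: "duhamel_solution \<alpha> \<gamma> s T (dist_of (?W h1 0)) (\<lambda>t. dist_of (?W h1 t))"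
    and sol2: "duhamel_solution \<alpha> \<gamma> s T (dist_of (?W h2 0)) (\<lambda>t. dist_of (?W h2 t))"
    using \<alpha> T h1(3) h2(3) unfolding p_def
    by (intro duhamel_solution_wave_packet[OF _ s1(2) _ L(1) h1(1)] duhamel_solution_wave_packet[OF _ s1(2) _ L(1) h2(1)]; simp)+
  \<comment> \<open>All three data, \<open>h1\<close>, \<open>h2\<close> and their difference
    \<open>k\<close>, are real multiples of the single profile \<open>J 0\<close> at time 0, so one
    estimate serves them all, with b a^2 as the squared size.\<close>
  have data: "sobolev_norm s (dist_of (?W h 0)) \<le> sqrt (20 * pi ^ 3 * C\<^sub>0\<^sup>2) * y"
    if h: "unif_decaying A h" and h0: "\<And>\<eta>. norm (h 0 \<eta>) = a * norm (J 0 \<eta>)" and a: "0 \<le> a" "b * a\<^sup>2 \<le> y\<^sup>2" and y: "0 \<le> y" for A h a y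
  proof (rule abs_le_of_square_le)
    have "norm (h 0 \<eta>) \<le> (a * C\<^sub>0) * wt \<eta>" for \<eta>
      unfolding h0 J_def using mult_left_mono[OF decayingD(2)[OF C0, of \<eta>] a(1)] by (simp add: mult.assoc)
    from sobolev_norm_wave_packet_le[where t = 0 and B = "a * C\<^sub>0", OF s1(1) N L h this]
    have "(sobolev_norm s (dist_of (?W h 0)))\<^sup>2 \<le> 20 * pi ^ 3 * b * (a * C\<^sub>0)\<^sup>2" unfolding Lb .
    also have "\<dots> = 20 * pi ^ 3 * C\<^sub>0\<^sup>2 * (b * a\<^sup>2)" by (simp add: power_mult_distrib)
    also have "\<dots> \<le> 20 * pi ^ 3 * C\<^sub>0\<^sup>2 * y\<^sup>2" using a(2) by (intro mult_left_mono) auto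
    finally show "(sobolev_norm s (dist_of (?W h 0)))\<^sup>2 \<le> 20 * pi ^ 3 * C\<^sub>0\<^sup>2 * y\<^sup>2" .
  qed (use y in auto)
  have ba_le: "b * a1\<^sup>2 \<le> (2 * \<epsilon>)\<^sup>2" "b * a2\<^sup>2 \<le> (2 * \<epsilon>)\<^sup>2"
    unfolding ba using \<epsilon> \<delta> by (intro power_mono; linarith)+
  have data1: "sobolev_norm s (dist_of (?W h1 0)) \<le> sqrt (20 * pi ^ 3 * C\<^sub>0\<^sup>2) * (2 * \<epsilon>)"
    by (rule data[OF h1(1), of a1]) (use a_pos \<epsilon> ba_le(1) in \<open>simp_all add: h1(2) norm_mult\<close>)
  have data2: "sobolev_norm s (dist_of (?W h2 0)) \<le> sqrt (20 * pi ^ 3 * C\<^sub>0\<^sup>2) * (2 * \<epsilon>)"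
    by (rule data[OF h2(1), of a2]) (use a_pos \<epsilon> ba_le(2) in \<open>simp_all add: h2(2) norm_mult\<close>)
  have data12: "sobolev_norm s (dist_of (?W h1 0) - dist_of (?W h2 0)) \<le> sqrt (20 * pi ^ 3 * C\<^sub>0\<^sup>2) * \<delta>"
    unfolding diff
  proof (rule data[OF k, of "\<bar>a1 - a2\<bar>"])
    show "norm (k 0 \<eta>) = \<bar>a1 - a2\<bar> * norm (J 0 \<eta>)" for \<eta>
      unfolding k_def h1(2) h2(2) left_diff_distrib[symmetric] of_real_diff[symmetric] norm_mult norm_of_real ..
  qed (use ba \<delta> in auto)
  have lower: "pi / 2 * sqrt c\<^sub>0 * \<epsilon> \<le> sobolev_norm s (dist_of (?W h1 T) - dist_of (?W h2 T))"
    unfolding diff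
  proof (rule power2_le_imp_le)
    have kD: "norm (k T \<eta> - D \<eta>) \<le> r * wt \<eta>" for \<eta>
    proof -
      have "k T \<eta> - D \<eta> = (h1 T \<eta> - of_real a1 * J l1 \<eta>) - (h2 T \<eta> - of_real a2 * J l2 \<eta>)"
        by (simp add: k_def D_def)
      then have "norm (k T \<eta> - D \<eta>) \<le> norm (h1 T \<eta> - of_real a1 * J l1 \<eta>) + norm (h2 T \<eta> - of_real a2 * J l2 \<eta>)"
        by (simp only: norm_triangle_ineq4)
      also have "\<dots> \<le> r / 2 * wt \<eta> + r / 2 * wt \<eta>" by (intro add_mono h1(4) h2(4))
      finally show ?thesis by (simp add: field_simps)
    qed
    have "(N * L)\<^sup>2 > 0" using N L by simp
    then have tail: "4 * (R + r)\<^sup>2 * pi / (N * L)\<^sup>2 \<le> c\<^sub>0 * a1\<^sup>2 / 8"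
      using NLM c0 a_pos by (simp add: M_def divide_le_eq mult_ac)
    have "(pi / 2 * sqrt c\<^sub>0 * \<epsilon>)\<^sup>2 = pi\<^sup>2 * c\<^sub>0 / 4 * \<epsilon>\<^sup>2"
      using c0 by (simp add: power_mult_distrib power_divide)
    also have "\<dots> \<le> pi\<^sup>2 * c\<^sub>0 / 4 * (b * a1\<^sup>2)"
      unfolding ba using c0 \<epsilon> \<delta> by (intro mult_left_mono power_mono) auto
    also have "\<dots> = pi\<^sup>2 * b * (c\<^sub>0 * a1\<^sup>2 / 2 - c\<^sub>0 * a1\<^sup>2 / 8 - c\<^sub>0 * a1\<^sup>2 / 8)" by simp
    also have "\<dots> \<le> pi\<^sup>2 * b * ((LBINT \<eta>. (norm (D \<eta>))\<^sup>2) / 2 - r\<^sup>2 * pi - 4 * (R + r)\<^sup>2 * pi / (N * L)\<^sup>2)"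
      using D_ge tail r2 b by (intro mult_left_mono) auto
    also have "\<dots> \<le> (sobolev_norm s (dist_of (?W k T)))\<^sup>2"
      using sobolev_norm_wave_packet_ge[OF s1(1) N L(1) k R kD, of \<alpha>] unfolding Lb .
    finally show "(pi / 2 * sqrt c\<^sub>0 * \<epsilon>)\<^sup>2 \<le> (sobolev_norm s (dist_of (?W k T)))\<^sup>2" .
    show "0 \<le> sobolev_norm s (dist_of (?W k T))" by (simp add: sobolev_norm_def)
  qed
  show ?thesis
    using sol1 sol2 data1 data2 data12 lower unfolding c\<^sub>0_def by blast
qed

text \<open>The weight estimates are stated for |s| \<le> 1; this supplies the lower side of that
  range.\<close>

lemma sobolev_exponent_bound:
  assumes "1 < \<alpha>" "(2 - 3 * \<alpha>) / (4 * (\<alpha> + 1)) < (s :: real)"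
  shows "- 1 < s"
proof -
  have "- 1 \<le> (2 - 3 * \<alpha>) / (4 * (\<alpha> + 1))" using assms(1) by (simp add: le_divide_eq)
  then show ?thesis using assms(2) by simp
qed

theorem theorem1p2:
  fixes \<alpha> \<gamma> s :: real
  assumes "1 < \<alpha>" and "\<alpha> < 2" and "\<gamma> \<noteq> 0"
    and "(2 - 3 * \<alpha>) / (4 * (\<alpha> + 1)) < s" and "s < (2 - \<alpha>) / 4"
  shows "(\<forall>T>0. \<not> solution_map_locally_uniformly_continuous \<alpha> \<gamma> s T) \<and>
    (\<exists>\<epsilon>\<^sub>0>0. \<exists>\<kappa>>0. \<exists>C>0. \<exists>c>0. \<forall>\<epsilon> \<delta> T.
       0 < \<epsilon> \<longrightarrow> \<epsilon> \<le> \<epsilon>\<^sub>0 \<longrightarrow> 0 < \<delta> \<longrightarrow> \<delta> \<le> \<kappa> * \<epsilon> \<longrightarrow> 0 < T \<longrightarrow>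
       (\<exists>\<phi>\<^sub>1 \<phi>\<^sub>2 u\<^sub>1 u\<^sub>2.
          duhamel_solution \<alpha> \<gamma> s T \<phi>\<^sub>1 u\<^sub>1 \<and> duhamel_solution \<alpha> \<gamma> s T \<phi>\<^sub>2 u\<^sub>2 \<and>
          sobolev_norm s \<phi>\<^sub>1 \<le> C * \<epsilon> \<and> sobolev_norm s \<phi>\<^sub>2 \<le> C * \<epsilon> \<and>
          sobolev_norm s (\<phi>\<^sub>1 - \<phi>\<^sub>2) \<le> C * \<delta> \<and>
          ereal (c * \<epsilon>) \<le> sup_sobolev_norm s T (\<lambda>t. u\<^sub>1 t - u\<^sub>2 t)))"
proof -
  have s: "- 1 < s" using sobolev_exponent_bound assms by blast
  \<comment> \<open>The decay constant of one fixed Gaussian is the only non-explicit ingredient of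
    \<open>C\<close>, and \<open>c\<close> is a number. The summand 1 in \<open>C\<close> ensures
    positivity.\<close>
  obtain C\<^sub>0 where C0: "decaying C\<^sub>0 (gauss_phase_ft 1 0)" using decaying_gauss_phase_ft[of 1 0] by auto
  define C where "C = 2 * sqrt (20 * pi ^ 3 * C\<^sub>0\<^sup>2) + 1"
  define c where "c = pi / 2 * sqrt (1 / (96 * sqrt pi))"
  have C: "0 < C" by (simp add: C_def add_nonneg_pos)
  have c: "0 < c" by (simp add: c_def)
  let ?sols = "\<lambda>\<epsilon> \<delta> T. \<exists>\<phi>\<^sub>1 \<phi>\<^sub>2 u\<^sub>1 u\<^sub>2.
          duhamel_solution \<alpha> \<gamma> s T \<phi>\<^sub>1 u\<^sub>1 \<and> duhamel_solution \<alpha> \<gamma> s T \<phi>\<^sub>2 u\<^sub>2 \<and>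
          sobolev_norm s \<phi>\<^sub>1 \<le> C * \<epsilon> \<and> sobolev_norm s \<phi>\<^sub>2 \<le> C * \<epsilon> \<and>
          sobolev_norm s (\<phi>\<^sub>1 - \<phi>\<^sub>2) \<le> C * \<delta> \<and>
          ereal (c * \<epsilon>) \<le> sup_sobolev_norm s T (\<lambda>t. u\<^sub>1 t - u\<^sub>2 t)"
  have main: "?sols \<epsilon> \<delta> T"
    if *: "0 < \<epsilon>" "0 < \<delta>" "\<delta> \<le> 1 / 12 * \<epsilon>" "0 < T" for \<epsilon> \<delta> T
  proof -
    obtain \<phi>\<^sub>1 \<phi>\<^sub>2 u\<^sub>1 u\<^sub>2 where u: "duhamel_solution \<alpha> \<gamma> s T \<phi>\<^sub>1 u\<^sub>1" "duhamel_solution \<alpha> \<gamma> s T \<phi>\<^sub>2 u\<^sub>2"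
      and n: "sobolev_norm s \<phi>\<^sub>1 \<le> sqrt (20 * pi ^ 3 * C\<^sub>0\<^sup>2) * (2 * \<epsilon>)" "sobolev_norm s \<phi>\<^sub>2 \<le> sqrt (20 * pi ^ 3 * C\<^sub>0\<^sup>2) * (2 * \<epsilon>)"
        "sobolev_norm s (\<phi>\<^sub>1 - \<phi>\<^sub>2) \<le> sqrt (20 * pi ^ 3 * C\<^sub>0\<^sup>2) * \<delta>"
      and lower: "c * \<epsilon> \<le> sobolev_norm s (u\<^sub>1 T - u\<^sub>2 T)"
      using two_solutions[OF assms(1-3) s assms(5) *(1,2) _ *(4) C0] *(3) unfolding c_def by auto
    have S: "sqrt (20 * pi ^ 3 * C\<^sub>0\<^sup>2) * (2 * \<epsilon>) \<le> C * \<epsilon>" "sqrt (20 * pi ^ 3 * C\<^sub>0\<^sup>2) * \<delta> \<le> C * \<delta>"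
    proof -
      have "sqrt (20 * pi ^ 3 * C\<^sub>0\<^sup>2) * 2 * \<epsilon> \<le> C * \<epsilon>"
        using that by (intro mult_right_mono) (simp_all add: C_def)
      then show "sqrt (20 * pi ^ 3 * C\<^sub>0\<^sup>2) * (2 * \<epsilon>) \<le> C * \<epsilon>" by (simp only: mult.assoc)
      have "0 \<le> sqrt (20 * pi ^ 3 * C\<^sub>0\<^sup>2)" by simp
      then have "sqrt (20 * pi ^ 3 * C\<^sub>0\<^sup>2) \<le> C" unfolding C_def by linarith
      then show "sqrt (20 * pi ^ 3 * C\<^sub>0\<^sup>2) * \<delta> \<le> C * \<delta>" using that by (intro mult_right_mono) auto
    qed
    have "ereal (sobolev_norm s (u\<^sub>1 T - u\<^sub>2 T)) \<le> sup_sobolev_norm s T (\<lambda>t. u\<^sub>1 t - u\<^sub>2 t)"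
      unfolding sup_sobolev_norm_def by (rule SUP_upper) (use that in auto)
    then have "ereal (c * \<epsilon>) \<le> sup_sobolev_norm s T (\<lambda>t. u\<^sub>1 t - u\<^sub>2 t)"
      using lower order_trans[of "ereal (c * \<epsilon>)" "ereal (sobolev_norm s (u\<^sub>1 T - u\<^sub>2 T))"] by simp
    moreover have "sobolev_norm s \<phi>\<^sub>1 \<le> C * \<epsilon>" "sobolev_norm s \<phi>\<^sub>2 \<le> C * \<epsilon>" "sobolev_norm s (\<phi>\<^sub>1 - \<phi>\<^sub>2) \<le> C * \<delta>"
      using n S by linarith+
    ultimately show ?thesis using u by blast
  qed
  have "\<not> solution_map_locally_uniformly_continuous \<alpha> \<gamma> s T" if T: "0 < T" for T
  proof
    assume luc: "solution_map_locally_uniformly_continuous \<alpha> \<gamma> s T"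
    \<comment> \<open>Continuity already fails at zero data. For any radius r the size \<epsilon> =
      r / (2 C) puts both data into the ball, c \<epsilon> serves as the target accuracy, and
      \<delta> can be taken below whatever d is offered.\<close>
    let ?z = "(\<lambda>\<psi>. 0) :: dist"
    have "decaying 0 (\<lambda>x. 0)" by (simp add: decaying_def)
    then have "?z \<in> sobolev s"
      using sobolev_dist_of(1)[of 0 "\<lambda>x. 0" s] assms(1,5) by (simp add: dist_of_zero)
    then obtain r where r: "0 < r" and luc': "\<And>\<eta>. 0 < \<eta> \<Longrightarrow> \<exists>d>0. \<forall>\<phi>\<^sub>1 \<phi>\<^sub>2 u\<^sub>1 u\<^sub>2.
        duhamel_solution \<alpha> \<gamma> s T \<phi>\<^sub>1 u\<^sub>1 \<longrightarrow> duhamel_solution \<alpha> \<gamma> s T \<phi>\<^sub>2 u\<^sub>2 \<longrightarrow>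
        sobolev_norm s (\<phi>\<^sub>1 - ?z) < r \<longrightarrow> sobolev_norm s (\<phi>\<^sub>2 - ?z) < r \<longrightarrow>
        sobolev_norm s (\<phi>\<^sub>1 - \<phi>\<^sub>2) < d \<longrightarrow>
        sup_sobolev_norm s T (\<lambda>t. u\<^sub>1 t - u\<^sub>2 t) < ereal \<eta>"
      using luc unfolding solution_map_locally_uniformly_continuous_def by blast
    have z: "\<phi> - ?z = \<phi>" for \<phi> by (simp add: fun_eq_iff)
    define \<epsilon> where "\<epsilon> = r / (2 * C)"
    have \<epsilon>: "0 < \<epsilon>" "C * \<epsilon> < r" using r C by (auto simp: \<epsilon>_def)
    have "0 < c * \<epsilon>" using c \<epsilon> by simp
    from luc'[OF this, unfolded z] obtain d where d: "0 < d" and luc'': "\<forall>\<phi>\<^sub>1 \<phi>\<^sub>2 u\<^sub>1 u\<^sub>2.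
        duhamel_solution \<alpha> \<gamma> s T \<phi>\<^sub>1 u\<^sub>1 \<longrightarrow> duhamel_solution \<alpha> \<gamma> s T \<phi>\<^sub>2 u\<^sub>2 \<longrightarrow>
        sobolev_norm s \<phi>\<^sub>1 < r \<longrightarrow> sobolev_norm s \<phi>\<^sub>2 < r \<longrightarrow>
        sobolev_norm s (\<phi>\<^sub>1 - \<phi>\<^sub>2) < d \<longrightarrow>
        sup_sobolev_norm s T (\<lambda>t. u\<^sub>1 t - u\<^sub>2 t) < ereal (c * \<epsilon>)"
      by (elim exE conjE) (rule that)
    define \<delta> where "\<delta> = min (1 / 12 * \<epsilon>) (d / (2 * C))"
    have \<delta>: "0 < \<delta>" "\<delta> \<le> 1 / 12 * \<epsilon>" using \<epsilon> d C by (auto simp: \<delta>_def)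
    have "C * \<delta> \<le> C * (d / (2 * C))" using C by (intro mult_left_mono) (auto simp: \<delta>_def)
    also have "\<dots> = d / 2" using C by simp
    finally have Cd: "C * \<delta> < d" using d by simp
    obtain \<phi>\<^sub>1 \<phi>\<^sub>2 u\<^sub>1 u\<^sub>2 where u: "duhamel_solution \<alpha> \<gamma> s T \<phi>\<^sub>1 u\<^sub>1" "duhamel_solution \<alpha> \<gamma> s T \<phi>\<^sub>2 u\<^sub>2"
      and n: "sobolev_norm s \<phi>\<^sub>1 \<le> C * \<epsilon>" "sobolev_norm s \<phi>\<^sub>2 \<le> C * \<epsilon>" "sobolev_norm s (\<phi>\<^sub>1 - \<phi>\<^sub>2) \<le> C * \<delta>"
      and lower: "ereal (c * \<epsilon>) \<le> sup_sobolev_norm s T (\<lambda>t. u\<^sub>1 t - u\<^sub>2 t)"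
      using main[OF \<epsilon>(1) \<delta> T] by blast
    have "sup_sobolev_norm s T (\<lambda>t. u\<^sub>1 t - u\<^sub>2 t) < ereal (c * \<epsilon>)"
      using n \<epsilon> Cd by (intro luc''[rule_format, OF u]) auto
    with lower show False by simp
  qed
  moreover have "\<exists>\<epsilon>\<^sub>0>0. \<exists>\<kappa>>0. \<exists>C>0. \<exists>c>0. \<forall>\<epsilon> \<delta> T.
       0 < \<epsilon> \<longrightarrow> \<epsilon> \<le> \<epsilon>\<^sub>0 \<longrightarrow> 0 < \<delta> \<longrightarrow> \<delta> \<le> \<kappa> * \<epsilon> \<longrightarrow> 0 < T \<longrightarrow> (\<exists>\<phi>\<^sub>1 \<phi>\<^sub>2 u\<^sub>1 u\<^sub>2.
          duhamel_solution \<alpha> \<gamma> s T \<phi>\<^sub>1 u\<^sub>1 \<and> duhamel_solution \<alpha> \<gamma> s T \<phi>\<^sub>2 u\<^sub>2 \<and>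
          sobolev_norm s \<phi>\<^sub>1 \<le> C * \<epsilon> \<and> sobolev_norm s \<phi>\<^sub>2 \<le> C * \<epsilon> \<and>
          sobolev_norm s (\<phi>\<^sub>1 - \<phi>\<^sub>2) \<le> C * \<delta> \<and>
          ereal (c * \<epsilon>) \<le> sup_sobolev_norm s T (\<lambda>t. u\<^sub>1 t - u\<^sub>2 t))"
  \<comment> \<open>The bound 1 / 12 comes from the amplitude condition of
    \<open>gauss_phase_ft_diff_ge\<close>; the cap 1 on \<epsilon> is an arbitrary choice.\<close>
  proof (rule exI[of _ 1], rule conjI[OF zero_less_one], rule exI[of _ "1 / 12"], rule conjI,
      simp, rule exI[of _ C], rule conjI[OF C], rule exI[of _ c], rule conjI[OF c], intro allI impI)
    fix \<epsilon> \<delta> T :: real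
    assume "0 < \<epsilon>" "0 < \<delta>" "\<delta> \<le> 1 / 12 * \<epsilon>" "0 < T"
    from main[OF this] show "?sols \<epsilon> \<delta> T" .
  qed
  ultimately show ?thesis by blast
qed

end
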